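(* Let $N$ be a positive integer and let $t\ge 4$ be an integer. Then: (i) There exists a unique solution $y>0$ of the equation $$\frac{\mu_{1}((t+1)iy)-(t+1)\mu_{1}(iy)}{(t+1)y^{2}}=N+\frac{t}{24}.$$ Furthermore, this $y$ lies in the range $$\sqrt{\frac{t}{24(t+1)\left(N+\frac{t}{24}\right)}}<y<\frac{1}{\sqrt{24N-1}}.$$ (ii) For this value of $y$, $$p(N,t)=\frac{\sqrt{t+1}\,y^{3/2}\exp\left(2\pi y\left(N+\frac{t}{24}\right)\right)\eta((t+1)iy)}{\sqrt{(t+1)\mu_{2}(iy)-\mu_{2}((t+1)iy)}\;\eta(iy)}\,\bigl(1+O(y)\bigr).$$
   Context: $p(N,t)$ denotes the number of $(t+1)$-regular partitions of $N$, i.e. partitions of $N$ none of whose parts is divisible by $t+1$ (equivalently, $\sum_{N\ge0}p(N,t)q^N=\prod_{n\ge1}\frac{1-q^{(t+1)n}}{1-q^n}$). For $z$ in the upper half-plane, the Dedekind eta function is $\eta(z)=\exp\left(\frac{\pi i z}{12}\right)\prod_{n=1}^{\infty}(1-\exp(2\pi i n z))$, and for $k\ge1$, $\mu_k(z)=-\frac{z^{k+1}}{2\pi i}\left(\frac{d}{dz}\right)^k\log\eta(z)$. The implied constant in $O(y)$ is absolute (uniform in $N$ and $t$). *)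

theory Defs
  imports "HOL-Complex_Analysis.Complex_Analysis" "HOL-Library.Multiset"
begin

definition regular_partitions :: "nat \<Rightarrow> nat \<Rightarrow> nat multiset set" where
  "regular_partitions N t = {P. sum_mset P = N \<and> (\<forall>x \<in># P. 0 < x \<and> \<not> (t + 1) dvd x)}"

definition num_regular_partitions :: "nat \<Rightarrow> nat \<Rightarrow> nat" where
  "num_regular_partitions N t = card (regular_partitions N t)"

lemma finite_regular_partitions: "finite (regular_partitions N t)"
proof (rule finite_subset)
  show "regular_partitions N t \<subseteq> {P. set_mset P \<subseteq> {..N} \<and> size P \<in> {..N}}"
  proof
    fix P assume P: "P \<in> regular_partitions N t"
    hence pos: "\<forall>x\<in>#P. 0 < x" and s: "sum_mset P = N"
      by (auto simp: regular_partitions_def)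
    have "size P \<le> sum_mset P" using pos
      by (induction P) auto
    moreover have "x \<le> N" if "x \<in># P" for x
      using s multi_member_split[OF that] by auto
    ultimately show "P \<in> {P. set_mset P \<subseteq> {..N} \<and> size P \<in> {..N}}"
      using s by auto
  qed
next
  have "{P. set_mset P \<subseteq> {..N} \<and> size P \<in> {..N}} \<subseteq>
          mset ` {xs. set xs \<subseteq> {..N} \<and> length xs \<le> N}"
  proof
    fix P assume P: "P \<in> {P. set_mset P \<subseteq> {..N} \<and> size P \<in> {..N}}"
    obtain xs where "mset xs = P" using ex_mset by blast
    with P show "P \<in> mset ` {xs. set xs \<subseteq> {..N} \<and> length xs \<le> N}" by force
  qed
  thus "finite {P. set_mset P \<subseteq> {..N} \<and> size P \<in> {..N}}"
    by (rule finite_subset) (intro finite_imageI finite_lists_length_le finite_atMost)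
qed

definition eta :: "complex \<Rightarrow> complex" where
  "eta z = exp (of_real pi * \<i> * z / 12) *
           (\<Prod>n. 1 - exp (2 * of_real pi * \<i> * of_nat (Suc n) * z))"

text \<open>
  The holomorphic branch of \<open>log \<eta>\<close> on the upper half-plane that is real on the positive
  imaginary axis (see \<open>exp_log_eta\<close> and \<open>holomorphic_log_eta\<close> below). Note that \<open>Ln (eta z)\<close>
  would be discontinuous; the derivatives of \<open>log \<eta>\<close> do not depend on the choice of the
  holomorphic branch.
\<close>
definition log_eta :: "complex \<Rightarrow> complex" where
  "log_eta z = of_real pi * \<i> * z / 12 +
               (\<Sum>n. Ln (1 - exp (2 * of_real pi * \<i> * of_nat (Suc n) * z)))"

lemma norm_eta_factor:
  "norm (exp (2 * of_real pi * \<i> * of_nat (Suc n) * z)) = exp (- (2 * pi * Im z)) ^ Suc n"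
proof -
  have "exp (- (2 * pi * Im z)) ^ Suc n = exp (of_nat (Suc n) * (- (2 * pi * Im z)))"
    by (rule exp_of_nat_mult [symmetric])
  thus ?thesis by (simp add: norm_exp_eq_Re mult_ac del: power_Suc)
qed

lemma norm_eta_factor_less_1:
  assumes "Im z > 0"
  shows "norm (exp (2 * of_real pi * \<i> * of_nat (Suc n) * z)) < 1"
  unfolding norm_eta_factor using assms by (intro power_Suc_less_one) auto

lemma eta_factor_nonzero:
  assumes "Im z > 0"
  shows "1 - exp (2 * of_real pi * \<i> * of_nat (Suc n) * z) \<noteq> 0"
  using norm_eta_factor_less_1[OF assms, of n] by (metis less_irrefl norm_one right_minus_eq)

lemma log_eta_uniform_limit:
  assumes "d > 0"
  shows "uniform_limit {z. Im z \<ge> d}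
           (\<lambda>N z. \<Sum>n<N. Ln (1 - exp (2 * of_real pi * \<i> * of_nat (Suc n) * z)))
           (\<lambda>z. \<Sum>n. Ln (1 - exp (2 * of_real pi * \<i> * of_nat (Suc n) * z))) sequentially"
proof (rule Weierstrass_m_test_ev)
  define r where "r = exp (- (2 * pi * d))"
  have r: "0 < r" "r < 1" using assms by (auto simp: r_def)
  have "(\<lambda>n. r ^ Suc n) \<longlonglongrightarrow> 0"
    using r by (intro LIMSEQ_Suc LIMSEQ_power_zero) auto
  hence "eventually (\<lambda>n. r ^ Suc n < 1 / 2) sequentially"
    by (rule order_tendstoD) auto
  thus "\<forall>\<^sub>F n in sequentially. \<forall>z\<in>{z. d \<le> Im z}.
          norm (Ln (1 - exp (2 * of_real pi * \<i> * of_nat (Suc n) * z))) \<le> 2 * r ^ Suc n"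
  proof (eventually_elim, intro ballI)
    fix n z assume n: "r ^ Suc n < 1 / 2" and z: "z \<in> {z. d \<le> Im z}"
    let ?w = "exp (2 * of_real pi * \<i> * of_nat (Suc n) * z)"
    have "norm ?w \<le> r ^ Suc n"
      unfolding norm_eta_factor r_def using z by (intro power_mono) auto
    moreover from this have "norm (Ln (1 + (- ?w))) \<le> 2 * norm (- ?w)"
      using n by (intro norm_Ln_le) (simp only: norm_minus_cancel)
    ultimately show "norm (Ln (1 - ?w)) \<le> 2 * r ^ Suc n" by simp
  qed
  show "summable (\<lambda>n. 2 * r ^ Suc n)"
    using r by (intro summable_mult summable_ignore_initial_segment[of _ 1, simplified]
                  summable_geometric) auto
qed

lemma exp_log_eta:
  assumes "Im z > 0"
  shows "exp (log_eta z) = eta z"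
proof -
  let ?f = "\<lambda>n. Ln (1 - exp (2 * of_real pi * \<i> * of_nat (Suc n) * z))"
  have "(\<lambda>N. \<Sum>n<N. ?f n) \<longlonglongrightarrow> (\<Sum>n. ?f n)"
    using tendsto_uniform_limitI[OF log_eta_uniform_limit[OF assms], of z] by simp
  hence "summable ?f" by (auto simp: summable_def sums_def)
  from prodinf_exp[OF this] show ?thesis
    using eta_factor_nonzero[OF assms] by (simp add: log_eta_def eta_def exp_add)
qed

lemma holomorphic_log_eta: "log_eta holomorphic_on {z. Im z > 0}"
proof -
  let ?f = "\<lambda>n z. Ln (1 - exp (2 * of_real pi * \<i> * of_nat (Suc n) * z))"
  have "(\<lambda>z. \<Sum>n. ?f n z) holomorphic_on {z. Im z > 0}"
  proof (rule holomorphic_uniform_sequence)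
    show "open {z. Im z > 0}" by (simp add: open_halfspace_Im_gt)
    have *: "1 - exp (2 * of_real pi * \<i> * of_nat (Suc n) * z) \<notin> \<real>\<^sub>\<le>\<^sub>0" if "Im z > 0" for n z
    proof -
      have "Re (exp (2 * of_real pi * \<i> * of_nat (Suc n) * z)) < 1"
        using norm_eta_factor_less_1[OF that, of n] complex_Re_le_cmod le_less_trans by blast
      thus ?thesis by (auto simp: complex_nonpos_Reals_iff)
    qed
    show "(\<lambda>z. \<Sum>n<N. ?f n z) holomorphic_on {z. Im z > 0}" for N
      using * by (intro holomorphic_intros) auto
    fix z :: complex assume z: "z \<in> {z. Im z > 0}"
    have sub: "cball z (Im z / 2) \<subseteq> {w. Im w \<ge> Im z / 2}"
    proof
      fix w assume "w \<in> cball z (Im z / 2)"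
      hence "\<bar>Im (z - w)\<bar> \<le> Im z / 2"
        using abs_Im_le_cmod[of "z - w"] by (simp add: dist_norm)
      hence "Im z - Im w \<le> Im z / 2" by (simp only: minus_complex.sel abs_le_iff)
      thus "w \<in> {w. Im w \<ge> Im z / 2}" by simp
    qed
    have "uniform_limit (cball z (Im z / 2)) (\<lambda>N z. \<Sum>n<N. ?f n z) (\<lambda>z. \<Sum>n. ?f n z) sequentially"
      using z by (intro uniform_limit_on_subset[OF log_eta_uniform_limit sub]) auto
    moreover have "cball z (Im z / 2) \<subseteq> {z. Im z > 0}" using sub z by fastforce
    ultimately show "\<exists>d>0. cball z d \<subseteq> {z. Im z > 0} \<and>
        uniform_limit (cball z d) (\<lambda>N z. \<Sum>n<N. ?f n z) (\<lambda>z. \<Sum>n. ?f n z) sequentially"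
      using z by (intro exI[of _ "Im z / 2"]) auto
  qed
  thus ?thesis unfolding log_eta_def[abs_def] by (intro holomorphic_intros) auto
qed

definition mu :: "nat \<Rightarrow> complex \<Rightarrow> complex" where
  "mu k z = - (z ^ (k + 1) / (2 * of_real pi * \<i>)) * (deriv ^^ k) log_eta z"

definition saddle_point_eq :: "nat \<Rightarrow> nat \<Rightarrow> real \<Rightarrow> bool" where
  "saddle_point_eq N t y \<longleftrightarrow>
     (mu 1 (of_nat (t + 1) * \<i> * of_real y) - of_nat (t + 1) * mu 1 (\<i> * of_real y)) /
       (of_nat (t + 1) * of_real y ^ 2)
     = of_nat N + of_nat t / 24"

text \<open>
  All quantities are complex-valued because \<open>eta\<close> and \<open>mu\<close> are, although they are real at the
  points considered; \<open>csqrt\<close> agrees with the real square root on nonnegative reals.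
\<close>
definition main_term :: "nat \<Rightarrow> nat \<Rightarrow> real \<Rightarrow> complex" where
  "main_term N t y =
     of_real (sqrt (real (t + 1)) * y powr (3 / 2) * exp (2 * pi * y * (real N + real t / 24))) *
       eta (of_nat (t + 1) * \<i> * of_real y) /
     (csqrt (of_nat (t + 1) * mu 2 (\<i> * of_real y) - mu 2 (of_nat (t + 1) * \<i> * of_real y)) *
       eta (\<i> * of_real y))"

end

theory Submission
  imports Defs "HOL-Probability.Probability" "HOL-Real_Asymp.Real_Asymp"
begin

text \<open>
  Write \<open>s = t + 1\<close>, \<open>q = exp (- 2 \<pi> z)\<close> and let \<open>F z\<close> be the logarithm of the generating function
  \<open>\<Prod>n. (1 - q ^ (s n)) / (1 - q ^ n)\<close>. Its \<open>q\<close>-coefficients are nonnegative (divisor sums over the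
  divisors not divisible by \<open>s\<close>, divided by the index), the saddle point equation says \<open>- F' y = 2 \<pi> N\<close>,
  and the main term is \<open>exp (2 \<pi> y N + F y) * sqrt (2 \<pi> / F'' y)\<close>.

  As \<open>- F'\<close> is strictly decreasing, part (i) amounts to comparing \<open>- F'\<close> with \<open>2 \<pi> N\<close> at two points.
  The upper bound for \<open>y\<close> is termwise from \<open>sinh a \<ge> a\<close>; the lower one uses the
  transformation law of the Eisenstein series of weight 2 on the imaginary axis, obtained from the
  partial fractions of \<open>1 / sinh\<^sup>2\<close> by exchanging the order of summation in a double series.

  For part (ii), Cauchy's formula on the circle of radius \<open>exp (- 2 \<pi> y)\<close> is estimated by Laplace's
  method: third and fourth moments of the coefficients give an error \<open>O(y)\<close> relative to the Gaussian,
  uniformly in \<open>s\<close>, and an elementary inequality for cosines gives, on the whole circle, the decay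
  \<open>Re (F (y + i u) - F y) \<le> - c u\<^sup>2 / (y (y\<^sup>2 + u\<^sup>2))\<close>, so no modularity is needed there.
\<close>

section \<open>A transformation law on the imaginary axis\<close>

text \<open>The shape of the proof is dictated by uniformity in \<open>s\<close>: nothing relates
  \<open>s\<close> to \<open>1 / y\<close>, so no constant may depend on \<open>s\<close>. Upper
  bounds for the j-th moment of the coefficients, of order \<open>y\<close> to the power -(j + 1),
  come from comparison with the full divisor sums. No such comparison bounds the second moment from
  below; there the decay estimate on the circle is evaluated at the angle \<open>y\<close>. That
  estimate is where \<open>t \<ge> 4\<close> enters: multiples of \<open>s\<close> cost a proportion
  \<open>4 / s\<close> of the sum, which has to be less than 1.

  The transformation law is needed because the lower end of the range for \<open>y\<close> has exact
  constants: what separates the first moment from the explicit bound is a positive multiple of the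
  same moment at the dual point \<open>1 / (s * y)\<close>.

  In Laplace's method the angle has the scale \<open>y powr (3/2)\<close>. The cubic term of the
  phase is then of order \<open>sqrt y\<close>, too large for the claim; it is harmless because only
  the real part of the integrand is integrated, where the phase enters squared.\<close>

lemma sinh_product_formula:
  "(\<lambda>n. pi * x * (\<Prod>k=1..n. 1 + x\<^sup>2 / real k ^ 2)) \<longlonglongrightarrow> sinh (pi * x)"
proof -
  have "(\<lambda>n. of_real pi * (\<i> * of_real x) * (\<Prod>k=1..n. 1 - (\<i> * of_real x)^2 / of_nat k^2))
          \<longlonglongrightarrow> sin (of_real pi * (\<i> * of_real x))"
    by (rule sin_product_formula_complex)
  hence "(\<lambda>n. Im (of_real pi * (\<i> * of_real x) * (\<Prod>k=1..n. 1 - (\<i> * of_real x)^2 / of_nat k^2)))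
          \<longlonglongrightarrow> Im (sin (of_real pi * (\<i> * of_real x)))"
    by (rule tendsto_Im)
  moreover have "Im (of_real pi * (\<i> * of_real x) * (\<Prod>k=1..n. 1 - (\<i> * of_real x)^2 / of_nat k^2))
      = pi * x * (\<Prod>k=1..n. 1 + x\<^sup>2 / real k ^ 2)" for n
  proof -
    have "of_real pi * (\<i> * of_real x) * (\<Prod>k=1..n. 1 - (\<i> * of_real x)^2 / of_nat k^2)
      = \<i> * complex_of_real (pi * x * (\<Prod>k=1..n. 1 + x\<^sup>2 / real k ^ 2))"
      by (simp add: power_mult_distrib)
    thus ?thesis by (simp only: Im_i_times Re_complex_of_real)
  qed
  moreover have "sin (of_real pi * (\<i> * of_real x)) = \<i> * complex_of_real (sinh (pi * x))"
    by (simp add: complex_eq_iff Re_sin Im_sin sinh_def cosh_def)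
  ultimately show ?thesis by (simp only: Im_i_times Re_complex_of_real)
qed

lemma ln_sinh_sums:
  fixes x :: real
  assumes "x > 0"
  shows "(\<lambda>n. ln (1 + x\<^sup>2 / (real (Suc n))\<^sup>2)) sums ln (sinh (pi * x) / (pi * x))"
proof -
  have "(\<lambda>n. (\<Prod>k=1..n. 1 + x\<^sup>2 / real k ^ 2)) \<longlonglongrightarrow> sinh (pi * x) / (pi * x)"
    using tendsto_divide[OF sinh_product_formula[of x] tendsto_const[of "pi * x"]] assms by simp
  hence "(\<lambda>n. ln (\<Prod>k=1..n. 1 + x\<^sup>2 / real k ^ 2)) \<longlonglongrightarrow> ln (sinh (pi * x) / (pi * x))"
    using assms by (intro tendsto_ln) auto
  moreover have "ln (\<Prod>k=1..n. 1 + x\<^sup>2 / real k ^ 2) = (\<Sum>k<n. ln (1 + x\<^sup>2 / (real (Suc k))\<^sup>2))" for n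
  proof -
    have "ln (\<Prod>k=1..n. 1 + x\<^sup>2 / real k ^ 2) = (\<Sum>k=1..n. ln (1 + x\<^sup>2 / real k ^ 2))"
      by (intro ln_prod) (auto simp: add_nonneg_eq_0_iff)
    also have "\<dots> = (\<Sum>k<n. ln (1 + x\<^sup>2 / (real (Suc k))\<^sup>2))"
      by (rule sum.reindex_bij_witness[of _ Suc "\<lambda>k. k - 1"]) auto
    finally show ?thesis .
  qed
  ultimately show ?thesis by (simp add: sums_def)
qed

lemma summable_inverse_Suc_squares: "summable (\<lambda>n. C / (real (Suc n))\<^sup>2)"
  using summable_mult[OF sums_summable[OF inverse_squares_sums], of C]
  by (simp add: add.commute)

lemma coth_partial_fractions:
  fixes x :: real
  assumes "x > 0"
  shows "(\<lambda>n. x / ((real (Suc n))\<^sup>2 + x\<^sup>2)) sums ((pi * cosh (pi * x) / sinh (pi * x) - 1 / x) / 2)"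
proof -
  \<comment> \<open>The interval ends at \<open>x + 1\<close> because the numerator
    \<open>2 * z\<close> has to stay bounded for the Weierstrass test.\<close>
  define S where "S = {0<..<x + 1}"
  let ?f = "\<lambda>n x. ln (1 + x\<^sup>2 / (real (Suc n))\<^sup>2)"
  let ?f' = "\<lambda>n x. 2 * x / ((real (Suc n))\<^sup>2 + x\<^sup>2)"
  have bd: "norm (?f' n z) \<le> 2 * (x + 1) / (real (Suc n))\<^sup>2" if "z \<in> S" for n z
    using that assms unfolding S_def by (auto intro!: frac_le simp: abs_of_pos add_pos_nonneg)
  have summ: "summable (\<lambda>n. ?f' n x)"
    by (rule summable_comparison_test'[OF summable_inverse_Suc_squares bd, where N = 0])
       (use assms in \<open>auto simp: S_def\<close>)
  have unif: "uniformly_convergent_on S (\<lambda>n z. \<Sum>i<n. ?f' i z)"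
    by (rule Weierstrass_m_test'[OF bd summable_inverse_Suc_squares])
  have "((\<lambda>z. \<Sum>n. ?f n z) has_field_derivative (\<Sum>n. ?f' n x)) (at x)"
  proof (rule has_field_derivative_series'(2)[OF _ _ unif])
    show "summable (\<lambda>n. ?f n x)" using ln_sinh_sums[OF assms] by (simp add: sums_iff)
    fix n z assume z: "z \<in> S"
    have "1 + z\<^sup>2 / (real (Suc n))\<^sup>2 > 0" by (intro add_pos_nonneg) auto
    thus "(?f n has_field_derivative ?f' n z) (at z within S)"
      by (auto intro!: derivative_eq_intros simp: divide_simps)
  qed (use assms in \<open>auto simp: S_def\<close>)
  moreover have "((\<lambda>z. \<Sum>n. ?f n z) has_field_derivative (\<Sum>n. ?f' n x)) (at x) \<longleftrightarrow>
     ((\<lambda>z. ln (sinh (pi * z) / (pi * z))) has_field_derivative (\<Sum>n. ?f' n x)) (at x)"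
  proof (rule DERIV_cong_ev)
    show "\<forall>\<^sub>F z in nhds x. (\<Sum>n. ?f n z) = ln (sinh (pi * z) / (pi * z))"
      using eventually_nhds_in_open[of "{0<..}" x] assms
      by (auto elim!: eventually_mono simp: sums_unique[OF ln_sinh_sums])
  qed auto
  moreover have "((\<lambda>z. ln (sinh (pi * z) / (pi * z))) has_field_derivative
      (pi * cosh (pi * x) / sinh (pi * x) - 1 / x)) (at x)"
    using assms by (auto intro!: derivative_eq_intros simp: divide_simps power2_eq_square)
      (simp_all add: algebra_simps)
  ultimately have "(\<Sum>n. ?f' n x) = pi * cosh (pi * x) / sinh (pi * x) - 1 / x"
    using DERIV_unique by blast
  with summ have "(\<lambda>n. ?f' n x) sums (pi * cosh (pi * x) / sinh (pi * x) - 1 / x)"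
    by (simp add: sums_iff)
  moreover have "2 * x / d / 2 = x / d" for d :: real by simp
  ultimately show ?thesis using sums_divide[of "\<lambda>n. ?f' n x" _ 2] by (simp only:)
qed

text \<open>Termwise differentiation of \<open>coth_partial_fractions\<close>. In the closed form,
  the difference of the squares of \<open>sinh\<close> and \<open>cosh\<close> collapses to
  -1.\<close>

lemma inverse_sinh_squared_partial_fractions:
  fixes x :: real
  assumes "x > 0"
  shows "(\<lambda>n. ((real (Suc n))\<^sup>2 - x\<^sup>2) / ((real (Suc n))\<^sup>2 + x\<^sup>2)\<^sup>2) sums
           (1 / (2 * x\<^sup>2) - pi\<^sup>2 / (2 * (sinh (pi * x))\<^sup>2))"
proof -
  define S where "S = {0<..<x + 1}"
  let ?f = "\<lambda>n x. x / ((real (Suc n))\<^sup>2 + x\<^sup>2)"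
  let ?f' = "\<lambda>n x. ((real (Suc n))\<^sup>2 - x\<^sup>2) / ((real (Suc n))\<^sup>2 + x\<^sup>2)\<^sup>2"
  have bd: "norm (?f' n z) \<le> 1 / (real (Suc n))\<^sup>2" for n z
  proof -
    have p: "(real (Suc n))\<^sup>2 + z\<^sup>2 > 0" by (intro add_pos_nonneg) auto
    have "\<bar>(real (Suc n))\<^sup>2 - z\<^sup>2\<bar> \<le> (real (Suc n))\<^sup>2 + z\<^sup>2"
      by (smt (verit) zero_le_power2)
    hence "\<bar>(real (Suc n))\<^sup>2 - z\<^sup>2\<bar> / ((real (Suc n))\<^sup>2 + z\<^sup>2)\<^sup>2
        \<le> ((real (Suc n))\<^sup>2 + z\<^sup>2) / ((real (Suc n))\<^sup>2 + z\<^sup>2)\<^sup>2"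
      by (intro divide_right_mono) auto
    also have "\<dots> = 1 / ((real (Suc n))\<^sup>2 + z\<^sup>2)"
      using p by (simp add: power2_eq_square del: of_nat_Suc)
    also have "\<dots> \<le> 1 / (real (Suc n))\<^sup>2"
      by (intro divide_left_mono) (auto intro!: mult_pos_pos add_pos_nonneg)
    finally show ?thesis by (simp add: abs_divide)
  qed
  have summ: "summable (\<lambda>n. ?f' n x)"
    by (rule summable_comparison_test'[OF summable_inverse_Suc_squares, where N = 0])
       (use bd in auto)
  have unif: "uniformly_convergent_on S (\<lambda>n z. \<Sum>i<n. ?f' i z)"
    by (rule Weierstrass_m_test'[OF bd summable_inverse_Suc_squares])
  have "((\<lambda>z. \<Sum>n. ?f n z) has_field_derivative (\<Sum>n. ?f' n x)) (at x)"
  proof (rule has_field_derivative_series'(2)[OF _ _ unif])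
    show "summable (\<lambda>n. ?f n x)" using coth_partial_fractions[OF assms] by (simp add: sums_iff)
    fix n z assume z: "z \<in> S"
    have "(real (Suc n))\<^sup>2 + z\<^sup>2 > 0" by (intro add_pos_nonneg) auto
    thus "(?f n has_field_derivative ?f' n z) (at z within S)"
      by (auto intro!: derivative_eq_intros simp: power2_eq_square simp del: of_nat_Suc)
  qed (use assms in \<open>auto simp: S_def\<close>)
  moreover have "((\<lambda>z. \<Sum>n. ?f n z) has_field_derivative (\<Sum>n. ?f' n x)) (at x) \<longleftrightarrow>
     ((\<lambda>z. (pi * cosh (pi * z) / sinh (pi * z) - 1 / z) / 2) has_field_derivative (\<Sum>n. ?f' n x)) (at x)"
  proof (rule DERIV_cong_ev)
    show "\<forall>\<^sub>F z in nhds x. (\<Sum>n. ?f n z) = (pi * cosh (pi * z) / sinh (pi * z) - 1 / z) / 2"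
      using eventually_nhds_in_open[of "{0<..}" x] assms
      by (auto elim!: eventually_mono simp: sums_unique[OF coth_partial_fractions, symmetric] simp del: of_nat_Suc)
  qed auto
  moreover have "((\<lambda>z. (pi * cosh (pi * z) / sinh (pi * z) - 1 / z) / 2) has_field_derivative
      (1 / (2 * x\<^sup>2) - pi\<^sup>2 / (2 * (sinh (pi * x))\<^sup>2))) (at x)"
  proof -
    have "((\<lambda>z. (pi * cosh (pi * z) / sinh (pi * z) - 1 / z) / 2) has_field_derivative
      (pi\<^sup>2 * ((sinh (pi * x))\<^sup>2 - (cosh (pi * x))\<^sup>2) / (sinh (pi * x))\<^sup>2 + 1 / x\<^sup>2) / 2) (at x)"
    proof -
      have nz: "sinh (pi * x) \<noteq> 0" "x \<noteq> 0" using assms by auto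
      have "((\<lambda>z. sinh (pi * z)) has_field_derivative pi * cosh (pi * x)) (at x)"
           "((\<lambda>z. pi * cosh (pi * z)) has_field_derivative pi * (pi * sinh (pi * x))) (at x)"
        by (auto intro!: derivative_eq_intros)
      from DERIV_cdivide[OF DERIV_diff[OF DERIV_divide[OF this(2,1) nz(1)]
          DERIV_divide[OF DERIV_const[of 1] DERIV_ident nz(2)]], of 2]
      show ?thesis by (simp add: power2_eq_square algebra_simps diff_divide_distrib)
    qed
    also have "(sinh (pi * x))\<^sup>2 - (cosh (pi * x))\<^sup>2 = -1"
      using hyperbolic_pythagoras[of "pi * x"] by simp
    also have "(pi\<^sup>2 * -1 / (sinh (pi * x))\<^sup>2 + 1 / x\<^sup>2) / 2
        = 1 / (2 * x\<^sup>2) - pi\<^sup>2 / (2 * (sinh (pi * x))\<^sup>2)"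
      by (simp add: field_simps)
    finally show ?thesis .
  qed
  ultimately have "(\<Sum>n. ?f' n x) = 1 / (2 * x\<^sup>2) - pi\<^sup>2 / (2 * (sinh (pi * x))\<^sup>2)"
    using DERIV_unique by blast
  with summ show ?thesis by (simp add: sums_iff)
qed

text \<open>
  Subtracting from the terms \<open>X'(y k)\<close>, \<open>X x = x / (n\<^sup>2 + x\<^sup>2)\<close>, the difference quotients of \<open>X\<close> makes the
  double series over \<open>n\<close> and \<open>k\<close> absolutely convergent. The quotients telescope in \<open>k\<close>; after
  summation over \<open>n\<close> they produce the anomalous term \<open>1 / (\<pi> y)\<close> below.
\<close>

lemma double_series_bound:
  assumes "y > 0" "n \<ge> (1::real)" "k \<ge> (0::real)"
  shows "\<bar>(n\<^sup>2 - (y*k)\<^sup>2) / (n\<^sup>2 + (y*k)\<^sup>2)\<^sup>2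
          - ((y*(k+1)) / (n\<^sup>2 + (y*(k+1))\<^sup>2) - (y*k) / (n\<^sup>2 + (y*k)\<^sup>2)) / y\<bar>
         \<le> y\<^sup>2 * (3 * k + 1) / (n\<^sup>2 + (y*k)\<^sup>2)\<^sup>2"
proof -
  define x where "x = y * k"
  have x: "x \<ge> 0" "y * (k + 1) = x + y" using assms by (auto simp: x_def algebra_simps)
  define A where "A = n\<^sup>2 + x\<^sup>2"
  define B where "B = n\<^sup>2 + (x + y)\<^sup>2"
  have A: "A > 0" "A = n\<^sup>2 + x\<^sup>2" and AB: "A \<le> B" "B = A + 2 * x * y + y\<^sup>2"
    using assms x by (auto simp: A_def B_def power2_eq_square algebra_simps intro!: add_pos_nonneg)
  \<comment> \<open>The difference quotient \<open>((x + y) / B - x / A) / y\<close> equals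
    \<open>(n\<^sup>2 - x\<^sup>2 - x * y) / (A * B)\<close>. Over the common denominator
    \<open>A\<^sup>2 * B\<close> the leading product \<open>(n\<^sup>2 - x\<^sup>2) * A\<close>
    cancels, and \<open>m\<close> is what remains.\<close>
  define m where "m = (n\<^sup>2 - x\<^sup>2) * (2 * x * y + y\<^sup>2) + x * y * A"
  have "(n\<^sup>2 - x\<^sup>2) / A\<^sup>2 - ((x + y) / B - x / A) / y = m / (A\<^sup>2 * B)"
  proof -
    have "((n\<^sup>2 - x\<^sup>2) * B * y - ((x + y) * A - x * B) * A) = m * y"
      unfolding m_def AB(2) A(2) by (simp add: power2_eq_square algebra_simps)
    moreover have "p / A\<^sup>2 - ((x + y) / B - x / A) / y
        = (p * B * y - ((x + y) * A - x * B) * A) / (A\<^sup>2 * B * y)" for p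
    proof -
      have "A \<noteq> 0" "B \<noteq> 0" "y \<noteq> 0" using A(1) AB(1) assms by auto
      thus ?thesis by (simp add: field_simps power2_eq_square)
    qed
    ultimately show ?thesis using A(1) AB(1) assms by simp
  qed
  also have "\<bar>m / (A\<^sup>2 * B)\<bar> \<le> (A * (3 * x * y + y\<^sup>2)) / (A\<^sup>2 * A)"
    unfolding abs_divide
  proof (rule frac_le)
    have "\<bar>n\<^sup>2 - x\<^sup>2\<bar> \<le> A" unfolding A_def by (smt (verit) zero_le_power2)
    hence "\<bar>n\<^sup>2 - x\<^sup>2\<bar> * (2 * x * y + y\<^sup>2) \<le> A * (2 * x * y + y\<^sup>2)"
      using x assms by (intro mult_right_mono) auto
    moreover have "\<bar>m\<bar> \<le> \<bar>n\<^sup>2 - x\<^sup>2\<bar> * (2 * x * y + y\<^sup>2) + x * y * A"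
      unfolding m_def using x assms A
      by (intro order.trans[OF abs_triangle_ineq]) (simp add: abs_mult)
    ultimately show "\<bar>m\<bar> \<le> A * (3 * x * y + y\<^sup>2)" by (simp add: algebra_simps)
  qed (use x assms A AB in \<open>auto intro!: mult_left_mono simp: abs_mult\<close>)
  also have "\<dots> = (3 * x * y + y\<^sup>2) / A\<^sup>2" using A(1) by simp
  also have "3 * x * y + y\<^sup>2 = y\<^sup>2 * (3 * k + 1)"
    by (simp add: power2_eq_square x_def algebra_simps)
  finally show ?thesis unfolding A_def B_def x(2) x_def[symmetric] .
qed

text \<open>Brings the bound into the product form that \<open>sums_swap_product_bound\<close> asks
  for. By \<open>n * x \<le> n\<^sup>2 + x\<^sup>2\<close> the denominator yields \<open>n\<close>
  to the power 3/2 and \<open>x\<close> to the power 5/2; against the numerator of size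
  \<open>k\<close> this leaves the exponent 3/2 in both variables, which is more than 1.\<close>

lemma double_series_majorant:
  assumes "y > 0" "n \<ge> (1::real)" "k \<ge> (1::real)"
  shows "y\<^sup>2 * (3 * k + 1) / (n\<^sup>2 + (y*k)\<^sup>2)\<^sup>2 \<le> 4 * y powr (-1/2) * (n powr (-3/2) * k powr (-3/2))"
proof -
  define x where "x = y * k"
  have x: "x > 0" using assms by (simp add: x_def)
  have "n * x \<le> n\<^sup>2 + x\<^sup>2" using x assms sum_squares_bound[of n x] mult_nonneg_nonneg[of n x] by linarith
  hence "(n * x) powr (3/2) * (x\<^sup>2) powr (1/2) \<le> (n\<^sup>2 + x\<^sup>2) powr (3/2) * (n\<^sup>2 + x\<^sup>2) powr (1/2)"
    using x assms by (intro mult_mono powr_mono2) auto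
  also have "\<dots> = (n\<^sup>2 + x\<^sup>2) powr (3/2 + 1/2)" by (simp only: powr_add)
  also have "\<dots> = (n\<^sup>2 + x\<^sup>2)\<^sup>2"
  proof -
    have "n\<^sup>2 + x\<^sup>2 > 0" using x by (intro add_nonneg_pos) auto
    thus ?thesis using powr_numeral[of "n\<^sup>2 + x\<^sup>2" "num.Bit0 num.One"] by simp
  qed
  finally have *: "(n * x) powr (3/2) * x \<le> (n\<^sup>2 + x\<^sup>2)\<^sup>2"
    using x by (simp add: powr_half_sqrt)
  have "y\<^sup>2 * (3 * k + 1) / (n\<^sup>2 + x\<^sup>2)\<^sup>2 \<le> (y\<^sup>2 * (4 * k)) / ((n * x) powr (3/2) * x)"
    using x assms * by (intro frac_le) (auto intro!: mult_left_mono mult_pos_pos)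
  also have "\<dots> = 4 * (y / (n * x) powr (3/2))"
  proof -
    have "y\<^sup>2 * (4 * k) / (P * x) = 4 * (y / P)" for P
      using assms unfolding x_def by (simp add: power2_eq_square)
    thus ?thesis .
  qed
  also have "y / (n * x) powr (3/2) = y powr 1 * (n powr (-3/2) * (y powr (-3/2) * k powr (-3/2)))"
  proof -
    have "(n * x) powr (3/2) = n powr (3/2) * (y powr (3/2) * k powr (3/2))"
      using assms unfolding x_def by (simp add: powr_mult)
    moreover have "z powr (-3/2) = inverse (z powr (3/2))" for z :: real
      by (simp flip: powr_minus)
    ultimately show ?thesis using assms by (simp only: divide_inverse inverse_mult_distrib) simp
  qed
  also have "\<dots> = y powr (1 + -3/2) * (n powr (-3/2) * k powr (-3/2))"
    unfolding powr_add by (simp add: mult_ac)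
  finally show ?thesis by (simp add: x_def)
qed

section \<open>Interchange of summation and regrouping of double series\<close>

lemma summable_on_product_bound:
  fixes f :: "nat \<Rightarrow> nat \<Rightarrow> 'a :: banach"
  assumes bound: "\<And>n k. norm (f n k) \<le> a n * b k"
    and a: "summable a" "\<And>n. a n \<ge> 0" and b: "summable b" "\<And>k. b k \<ge> 0"
  shows "(\<lambda>(n, k). f n k) summable_on UNIV \<times> UNIV"
proof -
  have "(\<lambda>p. case p of (n, k) \<Rightarrow> a n * b k) summable_on UNIV \<times> UNIV"
  proof (rule summable_on_SigmaI)
    show "((\<lambda>k. case (n, k) of (n, k) \<Rightarrow> a n * b k) has_sum (a n * suminf b)) UNIV" for n
      using sums_nonneg_imp_has_sum[OF sums_mult[OF summable_sums[OF b(1)]]] a b by simp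
    show "(\<lambda>n. a n * suminf b) summable_on UNIV"
      by (intro summable_nonneg_imp_summable_on summable_mult2 a mult_nonneg_nonneg suminf_nonneg b)
  qed (use a b in auto)
  hence "(\<lambda>p. norm (case p of (n, k) \<Rightarrow> f n k)) summable_on UNIV \<times> UNIV"
    by (rule Infinite_Sum.abs_summable_on_comparison_test') (use bound in auto)
  thus ?thesis by (rule abs_summable_summable)
qed

lemma has_sum_imp_sums_rows:
  fixes f :: "nat \<Rightarrow> nat \<Rightarrow> 'a :: banach"
  assumes S: "((\<lambda>(n, k). f n k) has_sum S) (UNIV \<times> UNIV)" and rows: "\<And>n. f n sums g n"
  shows "g sums S"
proof (rule has_sum_imp_sums, rule has_sum_Sigma[OF isUCont_plus S])
  fix n :: nat
  have "(\<lambda>(n, k). f n k) summable_on Pair n ` UNIV"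
    by (rule summable_on_subset_banach[where A = "UNIV \<times> UNIV"]) (use S in \<open>auto simp: summable_on_def\<close>)
  hence "f n summable_on UNIV"
    by (subst (asm) summable_on_reindex) (auto simp: inj_on_def o_def)
  then obtain s where s: "(f n has_sum s) UNIV" by (auto simp: summable_on_def)
  with rows[of n] show "((\<lambda>k. case (n, k) of (n, k) \<Rightarrow> f n k) has_sum g n) UNIV"
    using has_sum_imp_sums sums_unique2 by fastforce
qed

text \<open>The common value stays existential: both iterated sums are evaluated independently, and
  equating them is what gives \<open>csch_sum_reciprocity\<close>.\<close>

lemma sums_swap_product_bound:
  fixes f :: "nat \<Rightarrow> nat \<Rightarrow> 'a :: banach"
  assumes bound: "\<And>n k. norm (f n k) \<le> a n * b k"
    and a: "summable a" "\<And>n. a n \<ge> 0" and b: "summable b" "\<And>k. b k \<ge> 0"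
    and rows: "\<And>n. f n sums g n" and columns: "\<And>k. (\<lambda>n. f n k) sums h k"
  shows "\<exists>S. g sums S \<and> h sums S"
proof -
  obtain S where S: "((\<lambda>(n, k). f n k) has_sum S) (UNIV \<times> UNIV)"
    using summable_on_product_bound[OF bound a b] by (auto simp: summable_on_def)
  have "((\<lambda>(k, n). f n k) has_sum S) (UNIV \<times> UNIV)"
    using S by (subst (asm) has_sum_swap) simp
  from has_sum_imp_sums_rows[OF this columns] has_sum_imp_sums_rows[OF S rows]
  show ?thesis by blast
qed

text \<open>Rearrangement of a Lambert series: the index pairs are regrouped along the hyperbolas on
  which their product is constant. It is applied to \<open>q ^ (n * k) / k\<close> for
  \<open>log_eta\<close> and to \<open>n * r ^ (k * n)\<close> for the csch sum.\<close>

lemma divisor_sum_sums: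
  fixes f :: "nat \<Rightarrow> nat \<Rightarrow> 'a :: banach"
  assumes bound: "\<And>n k. norm (f (Suc n) (Suc k)) \<le> a n * b k"
    and a: "summable a" "\<And>n. a n \<ge> 0" and b: "summable b" "\<And>k. b k \<ge> 0"
    and rows: "\<And>n. (\<lambda>k. f (Suc n) (Suc k)) sums g n"
  shows "\<exists>S. g sums S \<and> (\<lambda>m. \<Sum>d | d dvd Suc m. f d (Suc m div d)) sums S"
proof -
  obtain S where S: "((\<lambda>(n, k). f (Suc n) (Suc k)) has_sum S) (UNIV \<times> UNIV)"
    using summable_on_product_bound[where f = "\<lambda>n k. f (Suc n) (Suc k)", OF bound a b]
    by (auto simp: summable_on_def)
  \<comment> \<open>Indices start at 0, so the pair \<open>(n, k)\<close> belongs to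
    \<open>m = k + n * Suc k\<close>, for which \<open>Suc m\<close> is the product of the shifted
    indices.\<close>
  have *: "Suc (k + n * Suc k) = Suc n * Suc k" for n k by simp
  have "((\<lambda>(n, k). f (Suc n) (Suc k)) has_sum S) (UNIV \<times> UNIV) \<longleftrightarrow>
      ((\<lambda>(m, d). f d (Suc m div d)) has_sum S) (SIGMA m:UNIV. {d. d dvd Suc m})"
  proof (rule has_sum_reindex_bij_witness[where
        i = "\<lambda>(m, d). (d - 1, Suc m div d - 1)" and j = "\<lambda>(n, k). (k + n * Suc k, Suc n)"])
    fix p assume "p \<in> (SIGMA m:UNIV. {d. d dvd Suc m})"
    then obtain m d where p: "p = (m, d)" "d dvd Suc m" by auto
    then obtain k where k: "Suc m = d * k" by (auto elim: dvdE)
    hence dk: "d > 0" "k > 0" by (auto intro!: Nat.gr0I)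
    hence "Suc m div d = k" unfolding k by simp
    moreover from dk obtain d' k' where "d = Suc d'" "k = Suc k'" by (metis gr0_implies_Suc)
    ultimately show "(case (case p of (m, d) \<Rightarrow> (d - 1, Suc m div d - 1)) of (n, k) \<Rightarrow> (k + n * Suc k, Suc n)) = p"
      using k p(1) by simp
  qed (auto simp: * simp del: mult_Suc_right mult_Suc)
  with S have "((\<lambda>(m, d). f d (Suc m div d)) has_sum S) (SIGMA m:UNIV. {d. d dvd Suc m})" by simp
  hence "((\<lambda>m. \<Sum>d | d dvd Suc m. f d (Suc m div d)) has_sum S) UNIV"
    by (rule has_sum_Sigma[OF isUCont_plus]) (auto intro!: has_sum_finiteI)
  with has_sum_imp_sums_rows[OF S rows] show ?thesis by (blast dest: has_sum_imp_sums)
qed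

lemma sinh_ge_self: "x \<le> sinh x" if "x \<ge> 0" for x :: real
  using real_le_x_sinh[OF that] by (simp add: sinh_def exp_minus)

lemma sums_inverse_Suc_squares: "(\<lambda>k. c / (real (Suc k))\<^sup>2) sums (c * (pi\<^sup>2 / 6))"
  using sums_mult[OF inverse_squares_sums, of c] by (simp add: add.commute)

lemma summable_csch_squared:
  assumes "y > 0"
  shows "summable (\<lambda>k. 1 / (sinh (pi * y * real (Suc k)))\<^sup>2)"
proof (rule summable_comparison_test'[OF summable_inverse_Suc_squares[of "1 / (pi\<^sup>2 * y\<^sup>2)"], of 0])
  fix k :: nat
  have "(pi * y * real (Suc k))\<^sup>2 \<le> (sinh (pi * y * real (Suc k)))\<^sup>2"
    using assms by (intro power_mono sinh_ge_self) auto
  hence "1 / (sinh (pi * y * real (Suc k)))\<^sup>2 \<le> 1 / (pi * y * real (Suc k))\<^sup>2"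
    using assms by (intro divide_left_mono mult_pos_pos) auto
  thus "norm (1 / (sinh (pi * y * real (Suc k)))\<^sup>2) \<le> 1 / (pi\<^sup>2 * y\<^sup>2) / (real (Suc k))\<^sup>2"
    by (simp add: power_mult_distrib)
qed

definition csch_sum :: "real \<Rightarrow> real" where
  "csch_sum y = (\<Sum>k. 1 / (sinh (pi * y * real (Suc k)))\<^sup>2)"

lemma csch_sum_sums:
  "y > 0 \<Longrightarrow> (\<lambda>k. 1 / (sinh (pi * y * real (Suc k)))\<^sup>2) sums csch_sum y"
  unfolding csch_sum_def by (intro summable_sums summable_csch_squared)

text \<open>\<open>csch_sum y\<close> is \<open>(1 - E\<^sub>2 (i y)) / 6\<close>, so this is \<open>E\<^sub>2 (i / y) = - y\<^sup>2 E\<^sub>2 (i y) + 6 y / \<pi>\<close>.\<close>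

lemma csch_sum_reciprocity:
  assumes y: "y > 0"
  shows "csch_sum y + csch_sum (1 / y) / y\<^sup>2 = 1 / (6 * y\<^sup>2) + 1 / 6 - 1 / (pi * y)"
proof -
  define N where "N = (\<lambda>n. real (Suc n))"
  have N: "N n \<ge> 1" "N n > 0" "N n \<noteq> 0" for n by (auto simp: N_def)
  define A where "A = (\<lambda>n k. ((N n)\<^sup>2 - (y * real k)\<^sup>2) / ((N n)\<^sup>2 + (y * real k)\<^sup>2)\<^sup>2)"
  define X where "X = (\<lambda>n k. y * real k / ((N n)\<^sup>2 + (y * real k)\<^sup>2))"
  define f where "f = (\<lambda>n k. A n k - (X n (Suc k) - X n k) / y)"
  \<comment> \<open>The first summand of \<open>C\<close> serves \<open>k > 0\<close>. The second
    serves \<open>k = 0\<close>, outside the reach of \<open>double_series_majorant\<close>;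
    \<open>b 0\<close> is set to 1 by hand because \<open>0 powr (-3/2)\<close> is 0.\<close>
  define C where "C = 4 * y powr (-1/2) + y\<^sup>2"
  define b where "b = (\<lambda>k. if k = 0 then 1 else real k powr (-3/2))"
  have b: "summable b"
  proof -
    have "summable (\<lambda>k. real k powr (-3/2))" by (simp add: summable_real_powr_iff)
    also have "?this \<longleftrightarrow> summable b"
      by (rule summable_cong, rule eventually_mono[OF eventually_gt_at_top[of 0]]) (auto simp: b_def)
    finally show ?thesis .
  qed
  have "summable (\<lambda>n. real n powr (-3/2))" by (simp add: summable_real_powr_iff)
  hence a: "summable (\<lambda>n. C * N n powr (-3/2))"
    unfolding N_def by (intro summable_mult) (subst summable_Suc_iff)
  have C: "C \<ge> 0" using y by (simp add: C_def)
  have bound: "\<bar>f n k\<bar> \<le> (C * N n powr (-3/2)) * b k" for n k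
  proof -
    have "\<bar>f n k\<bar> \<le> y\<^sup>2 * (3 * real k + 1) / ((N n)\<^sup>2 + (y * real k)\<^sup>2)\<^sup>2"
      using double_series_bound[OF y N(1)[of n], of "real k"]
      unfolding f_def A_def X_def by (simp add: add.commute)
    also have "\<dots> \<le> (C * N n powr (-3/2)) * b k"
    proof (cases "k = 0")
      case True
      have "1 / ((N n)\<^sup>2)\<^sup>2 = N n powr (-4)"
        using N[of n] by (simp add: powr_minus_divide powr_numeral flip: power_mult)
      also have "\<dots> \<le> N n powr (-3/2)" using N[of n] by (intro powr_mono) auto
      finally have "y\<^sup>2 * (1 / ((N n)\<^sup>2)\<^sup>2) \<le> C * N n powr (-3/2)"
        by (intro mult_mono) (auto simp: C_def)
      with True show ?thesis by (simp add: b_def)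
    next
      case False
      hence "y\<^sup>2 * (3 * real k + 1) / ((N n)\<^sup>2 + (y * real k)\<^sup>2)\<^sup>2
          \<le> 4 * y powr (-1/2) * (N n powr (-3/2) * real k powr (-3/2))"
        by (intro double_series_majorant y N) auto
      also have "\<dots> \<le> C * (N n powr (-3/2) * real k powr (-3/2))"
        by (intro mult_right_mono) (auto simp: C_def)
      finally show ?thesis using False by (simp add: b_def)
    qed
    finally show ?thesis .
  qed

  \<comment> \<open>By homogeneity \<open>A n k\<close> is \<open>- (1 / y\<^sup>2)\<close> times
    the same fraction with the roles of the indices exchanged, at the argument
    \<open>N n / y\<close>; that is how \<open>1 / y\<close> comes in. The telescoping part of a row
    vanishes, since \<open>X n\<close> is 0 both at \<open>k = 0\<close> and in the limit.\<close>
  have rows: "f n sums (1 / (2 * (N n)\<^sup>2) + pi\<^sup>2 / (2 * y\<^sup>2) * (1 / (sinh (pi * (1 / y) * N n))\<^sup>2))" for n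
  proof -
    have "(\<lambda>k. - (1 / y\<^sup>2) * (((real (Suc k))\<^sup>2 - (N n / y)\<^sup>2) / ((real (Suc k))\<^sup>2 + (N n / y)\<^sup>2)\<^sup>2)) sums
       (- (1 / y\<^sup>2) * (1 / (2 * (N n / y)\<^sup>2) - pi\<^sup>2 / (2 * (sinh (pi * (N n / y)))\<^sup>2)))"
      using N y by (intro sums_mult inverse_sinh_squared_partial_fractions) auto
    moreover have "- (1 / y\<^sup>2) * ((k\<^sup>2 - (m / y)\<^sup>2) / (k\<^sup>2 + (m / y)\<^sup>2)\<^sup>2)
        = (m\<^sup>2 - (y * k)\<^sup>2) / (m\<^sup>2 + (y * k)\<^sup>2)\<^sup>2" if "m > 0" for k m :: real
    proof -
      define P where "P = m\<^sup>2 + (y * k)\<^sup>2"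
      have P: "P > 0" unfolding P_def using that by (intro add_pos_nonneg) auto
      have "k\<^sup>2 + (m / y)\<^sup>2 = P / y\<^sup>2" "k\<^sup>2 - (m / y)\<^sup>2 = - (m\<^sup>2 - (y * k)\<^sup>2) / y\<^sup>2"
        using y by (simp_all add: P_def field_simps)
      hence "- (1 / y\<^sup>2) * ((k\<^sup>2 - (m / y)\<^sup>2) / (k\<^sup>2 + (m / y)\<^sup>2)\<^sup>2) = (m\<^sup>2 - (y * k)\<^sup>2) / P\<^sup>2"
        using y P by (simp add: power_divide) (simp add: power2_eq_square minus_divide_left)
      thus ?thesis by (simp add: P_def)
    qed
    ultimately have "(\<lambda>k. A n (Suc k)) sums
        (- (1 / y\<^sup>2) * (1 / (2 * (N n / y)\<^sup>2) - pi\<^sup>2 / (2 * (sinh (pi * (N n / y)))\<^sup>2)))"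
      using N by (simp only: A_def)
    hence "A n sums (- (1 / y\<^sup>2) * (1 / (2 * (N n / y)\<^sup>2) - pi\<^sup>2 / (2 * (sinh (pi * (N n / y)))\<^sup>2)) + A n 0)"
      by (subst (asm) sums_Suc_iff) simp
    also have "- (1 / y\<^sup>2) * (1 / (2 * (N n / y)\<^sup>2) - pi\<^sup>2 / (2 * (sinh (pi * (N n / y)))\<^sup>2)) + A n 0
      = 1 / (2 * (N n)\<^sup>2) + pi\<^sup>2 / (2 * y\<^sup>2) * (1 / (sinh (pi * (1 / y) * N n))\<^sup>2)"
      using y N[of n] by (simp add: A_def power2_eq_square right_diff_distrib)
    finally have sA: "A n sums (1 / (2 * (N n)\<^sup>2) + pi\<^sup>2 / (2 * y\<^sup>2) * (1 / (sinh (pi * (1 / y) * N n))\<^sup>2))" .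
    have "(\<lambda>k. X n k) \<longlonglongrightarrow> 0"
      using y N[of n] unfolding X_def by real_asymp
    hence "(\<lambda>k. X n (Suc k) - X n k) sums (0 - X n 0)"
      by (rule telescope_sums)
    from sums_diff[OF sA sums_divide[OF this, of y]] show ?thesis
      unfolding f_def by (simp add: X_def)
  qed

  \<comment> \<open>These are the column sums of \<open>X\<close> and \<open>A\<close>. The closed
    forms divide by zero at \<open>k = 0\<close>, so there the values are given directly:
    \<open>X\<close> vanishes and \<open>A\<close> sums to zeta(2).\<close>
  define H where "H = (\<lambda>k. if k = 0 then 0 else (pi * cosh (pi * (y * real k)) / sinh (pi * (y * real k)) - 1 / (y * real k)) / 2)"
  define Q where "Q = (\<lambda>k. if k = 0 then pi\<^sup>2 / 6 else 1 / (2 * (y * real k)\<^sup>2) - pi\<^sup>2 / (2 * (sinh (pi * (y * real k)))\<^sup>2))"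
  have "(\<lambda>n. X n k) sums H k" for k
    using coth_partial_fractions[of "y * real k"] y
    by (cases "k = 0") (simp_all add: X_def H_def N_def)
  moreover have "(\<lambda>n. A n k) sums Q k" for k
  proof (cases "k = 0")
    case True
    thus ?thesis using sums_inverse_Suc_squares[of 1]
      by (simp add: A_def Q_def N_def power4_eq_xxxx power2_eq_square)
  next
    case False
    thus ?thesis using inverse_sinh_squared_partial_fractions[of "y * real k"] y
      by (simp add: A_def Q_def N_def)
  qed
  ultimately have columns: "(\<lambda>n. f n k) sums (Q k - (H (Suc k) - H k) / y)" for k
    unfolding f_def by (intro sums_diff sums_divide)
  have "summable (\<lambda>n. C * N n powr (-3/2))" "\<And>n. C * N n powr (-3/2) \<ge> 0" "\<And>k. b k \<ge> 0"
    using a C by (auto simp: b_def)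
  from sums_swap_product_bound[OF bound[folded real_norm_def] this(1,2) b this(3) rows columns] obtain S where
    S: "(\<lambda>n. 1 / (2 * (N n)\<^sup>2) + pi\<^sup>2 / (2 * y\<^sup>2) * (1 / (sinh (pi * (1 / y) * N n))\<^sup>2)) sums S"
       "(\<lambda>k. Q k - (H (Suc k) - H k) / y) sums S" by blast
  have "(\<lambda>n. 1 / (2 * (N n)\<^sup>2) + pi\<^sup>2 / (2 * y\<^sup>2) * (1 / (sinh (pi * (1 / y) * N n))\<^sup>2)) sums
         (1 / 2 * (pi\<^sup>2 / 6) + pi\<^sup>2 / (2 * y\<^sup>2) * csch_sum (1 / y))"
    using sums_add[OF sums_inverse_Suc_squares[of "1/2"]
        sums_mult[OF csch_sum_sums[of "1/y"], of "pi\<^sup>2 / (2 * y\<^sup>2)"]] y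
    by (simp only: N_def divide_divide_eq_left zero_less_divide_1_iff simp_thms)
  with S(1) have S1: "S = 1 / 2 * (pi\<^sup>2 / 6) + pi\<^sup>2 / (2 * y\<^sup>2) * csch_sum (1 / y)"
    using sums_unique2 by blast
  have "(\<lambda>k. Q (Suc k)) sums (1 / (2 * y\<^sup>2) * (pi\<^sup>2 / 6) - pi\<^sup>2 / 2 * csch_sum y)"
    using sums_diff[OF sums_inverse_Suc_squares[of "1 / (2 * y\<^sup>2)"] sums_mult[OF csch_sum_sums[OF y], of "pi\<^sup>2/2"]]
    by (simp add: Q_def power_mult_distrib mult.assoc)
  hence "Q sums (1 / (2 * y\<^sup>2) * (pi\<^sup>2 / 6) - pi\<^sup>2 / 2 * csch_sum y + pi\<^sup>2 / 6)"
    by (subst (asm) sums_Suc_iff) (simp add: Q_def)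
  \<comment> \<open>For each fixed \<open>n\<close> the values \<open>X n k\<close> tend to 0, yet
    their sums over \<open>n\<close> tend to \<open>pi / 2\<close>, because coth tends to 1. This
    failure to exchange limit and sum is the source of the anomalous term.\<close>
  moreover have "(\<lambda>k. H (Suc k) - H k) sums (pi / 2 - H 0)"
  proof (rule telescope_sums)
    have "(\<lambda>k. (pi * cosh (pi * (y * real k)) / sinh (pi * (y * real k)) - 1 / (y * real k)) / 2) \<longlonglongrightarrow> pi / 2"
      using y unfolding cosh_field_def sinh_field_def by real_asymp
    thus "H \<longlonglongrightarrow> pi / 2"
      by (rule Lim_transform_eventually, intro eventually_mono[OF eventually_gt_at_top[of 0]])
         (simp add: H_def)
  qed
  ultimately have "(\<lambda>k. Q k - (H (Suc k) - H k) / y) sums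
      (1 / (2 * y\<^sup>2) * (pi\<^sup>2 / 6) - pi\<^sup>2 / 2 * csch_sum y + pi\<^sup>2 / 6 - (pi / 2 - H 0) / y)"
    by (rule sums_diff[OF _ sums_divide])
  with S(2) S1 have eq: "1 / 2 * (pi\<^sup>2 / 6) + pi\<^sup>2 / (2 * y\<^sup>2) * csch_sum (1 / y)
      = 1 / (2 * y\<^sup>2) * (pi\<^sup>2 / 6) - pi\<^sup>2 / 2 * csch_sum y + pi\<^sup>2 / 6 - (pi / 2 - H 0) / y"
    using sums_unique2 by blast
  have "H 0 = 0" "pi\<^sup>2 / 2 * (1 / (pi * y)) = pi / 2 / y" by (simp_all add: H_def power2_eq_square)
  with eq have "pi\<^sup>2 / 2 * (csch_sum y + csch_sum (1 / y) / y\<^sup>2)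
      = pi\<^sup>2 / 2 * (1 / (6 * y\<^sup>2)) + pi\<^sup>2 / 2 * (1 / 6) - pi\<^sup>2 / 2 * (1 / (pi * y))"
    by (simp add: algebra_simps)
  hence "pi\<^sup>2 / 2 * (csch_sum y + csch_sum (1 / y) / y\<^sup>2)
      = pi\<^sup>2 / 2 * (1 / (6 * y\<^sup>2) + 1 / 6 - 1 / (pi * y))"
    by (simp only: distrib_left right_diff_distrib)
  thus ?thesis by simp
qed

section \<open>Divisor sums and \<open>log \<eta>\<close>\<close>

lemma summable_poly_times_geometric:
  fixes r :: real
  assumes "\<bar>r\<bar> < 1"
  shows "summable (\<lambda>m. real m ^ j * r ^ m)"
  using assms
proof (induction j arbitrary: r)
  case 0
  thus ?case by (simp add: summable_geometric)
next
  case (Suc j)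
  have "summable (\<lambda>m. diffs (\<lambda>m. real m ^ j) m * r ^ m)"
    by (rule termdiff_converges[of _ 1]) (use Suc in auto)
  hence "summable (\<lambda>m. real (Suc m) ^ Suc j * r ^ m * r)"
    by (intro summable_mult2) (simp add: diffs_def)
  hence "summable (\<lambda>m. real (Suc m) ^ Suc j * r ^ Suc m)"
    by (simp only: power_Suc2[of r] mult.assoc)
  thus ?case by (subst (asm) summable_Suc_iff)
qed

text \<open>As \<open>0 dvd d\<close> only for \<open>d = 0\<close>, the choice \<open>s = 0\<close> yields the full divisor sum.\<close>

definition regular_divisor_sum :: "nat \<Rightarrow> nat \<Rightarrow> nat" where
  "regular_divisor_sum s m = (\<Sum>d | d dvd m \<and> \<not> s dvd d. d)"

text \<open>The coefficient of \<open>q ^ m\<close> in \<open>F\<close>: the expansion of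
  \<open>- log (1 - q ^ d)\<close> contains \<open>q ^ (d * k) / k\<close>, and for
  \<open>d * k = m\<close> the weight \<open>1 / k\<close> is \<open>d / m\<close>.\<close>

definition log_coeff :: "nat \<Rightarrow> nat \<Rightarrow> real" where
  "log_coeff s m = real (regular_divisor_sum s m) / real m"

lemma regular_divisor_sum_le:
  assumes "m > 0"
  shows "regular_divisor_sum s m \<le> m\<^sup>2"
proof -
  have "regular_divisor_sum s m \<le> (\<Sum>d\<in>{1..m}. m)"
    unfolding regular_divisor_sum_def using assms
    by (intro order.trans[OF sum_mono2[of "{1..m}"] sum_mono])
       (auto dest: dvd_imp_le intro: Nat.gr0I)
  thus ?thesis by (simp add: power2_eq_square)
qed

lemma log_coeff_nonneg [simp]: "log_coeff s m \<ge> 0"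
  by (simp add: log_coeff_def)

lemma log_coeff_0 [simp]: "log_coeff s 0 = 0"
  by (simp add: log_coeff_def)

lemma log_coeff_le: "log_coeff s m \<le> real m"
proof (cases "m = 0")
  case False
  have "real (regular_divisor_sum s m) \<le> real m ^ 2"
    using regular_divisor_sum_le[of m s] False by (metis neq0_conv of_nat_le_iff of_nat_power)
  thus ?thesis using False by (simp add: log_coeff_def field_simps power2_eq_square)
qed auto

lemma summable_log_moment:
  assumes "0 \<le> r" "r < 1"
  shows "summable (\<lambda>m. real m ^ j * log_coeff s m * r ^ m)"
proof (rule summable_comparison_test'[OF summable_poly_times_geometric[of r "Suc j"], of 0])
  fix m
  have "real m ^ j * log_coeff s m * r ^ m \<le> real m ^ j * real m * r ^ m"
    using assms log_coeff_le by (intro mult_right_mono mult_left_mono) auto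
  thus "norm (real m ^ j * log_coeff s m * r ^ m) \<le> real m ^ Suc j * r ^ m"
    using assms by (simp add: abs_mult mult_ac)
qed (use assms in auto)

text \<open>The operator \<open>q d/dq\<close>, applied \<open>j\<close> times to \<open>F\<close>,
  at the real point \<open>q = r\<close>. For \<open>r = exp (- 2 * pi * y)\<close> this operator is
  \<open>- 1 / (2 * pi)\<close> times the derivative in \<open>y\<close>.\<close>

definition log_moment :: "nat \<Rightarrow> nat \<Rightarrow> real \<Rightarrow> real" where
  "log_moment s j r = (\<Sum>m. real m ^ j * log_coeff s m * r ^ m)"

lemma log_moment_sums:
  "0 \<le> r \<Longrightarrow> r < 1 \<Longrightarrow> (\<lambda>m. real m ^ j * log_coeff s m * r ^ m) sums log_moment s j r"
  unfolding log_moment_def by (intro summable_sums summable_log_moment)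

text \<open>The divisors of \<open>m\<close> that are divisible by \<open>s\<close> are
  \<open>s\<close> times the divisors of \<open>m div s\<close>.\<close>

lemma regular_divisor_sum_split:
  assumes "s > 0" "m > 0"
  shows "regular_divisor_sum s m + (if s dvd m then s * regular_divisor_sum 0 (m div s) else 0)
         = regular_divisor_sum 0 m"
proof -
  have "(\<Sum>d | d dvd m \<and> s dvd d. d) = (if s dvd m then s * regular_divisor_sum 0 (m div s) else 0)"
  proof (cases "s dvd m")
    case True
    then obtain n where n: "m = s * n" by auto
    have "(\<Sum>d | d dvd m \<and> s dvd d. d) = (\<Sum>d | d dvd n \<and> \<not> 0 dvd d. s * d)"
      using assms n by (intro sum.reindex_bij_witness[of _ "\<lambda>d. s * d" "\<lambda>d. d div s"]) (auto elim!: dvdE)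
    thus ?thesis using n assms by (simp add: regular_divisor_sum_def sum_distrib_left)
  next
    case False
    hence e: "{d. d dvd m \<and> s dvd d} = {}" using dvd_trans by blast
    show ?thesis unfolding e using False by simp
  qed
  moreover have "regular_divisor_sum 0 m = (\<Sum>d | d dvd m \<and> \<not> s dvd d. d) + (\<Sum>d | d dvd m \<and> s dvd d. d)"
    unfolding regular_divisor_sum_def using assms
    by (subst sum.union_disjoint[symmetric]) (auto intro!: sum.cong)
  ultimately show ?thesis by (simp add: regular_divisor_sum_def)
qed

text \<open>The moment form of \<open>F y = G y - G (s * y)\<close>, where \<open>G\<close> is the
  logarithm of the generating function of all partitions. The power of \<open>s\<close> comes from
  differentiating the inner argument.\<close>

lemma log_moment_split:
  assumes s: "s > 0" and r: "0 \<le> r" "r < 1"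
  shows "log_moment s j r = log_moment 0 j r - real s ^ j * log_moment 0 j (r ^ s)"
proof -
  define f where "f = (\<lambda>m. if s dvd m then real s ^ j * (real (m div s) ^ j * log_coeff 0 (m div s) * r ^ m) else 0)"
  have rs: "0 \<le> r ^ s" "r ^ s < 1" using r s by (auto intro: power_less_one_iff[THEN iffD2] simp: power_less_one_iff)
  have "strict_mono (\<lambda>m. s * m)" using s by (simp add: strict_mono_def)
  moreover have "f n = 0" if "n \<notin> range (\<lambda>m. s * m)" for n
    using that by (auto simp: f_def)
  ultimately have "(\<lambda>m. f (s * m)) sums c \<longleftrightarrow> f sums c" for c
    by (rule sums_mono_reindex)
  moreover have "(\<lambda>m. f (s * m)) sums (real s ^ j * log_moment 0 j (r ^ s))"
    using sums_mult[OF log_moment_sums[OF rs, of j 0], of "real s ^ j"] s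
    by (simp add: f_def power_mult)
  ultimately have "f sums (real s ^ j * log_moment 0 j (r ^ s))" by simp
  from sums_diff[OF log_moment_sums[OF r, of j 0] this]
  have "(\<lambda>m. real m ^ j * log_coeff 0 m * r ^ m - f m) sums
          (log_moment 0 j r - real s ^ j * log_moment 0 j (r ^ s))" .
  also have "(\<lambda>m. real m ^ j * log_coeff 0 m * r ^ m - f m) = (\<lambda>m. real m ^ j * log_coeff s m * r ^ m)"
  proof
    fix m
    show "real m ^ j * log_coeff 0 m * r ^ m - f m = real m ^ j * log_coeff s m * r ^ m"
    proof (cases "m = 0")
      case True
      thus ?thesis by (simp add: f_def)
    next
      case False
      have "real m ^ j * log_coeff 0 m = real m ^ j * log_coeff s m +
          (if s dvd m then real s ^ j * (real (m div s) ^ j * log_coeff 0 (m div s)) else 0)"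
        unfolding log_coeff_def regular_divisor_sum_split[OF s, of m, symmetric, OF False[unfolded neq0_conv]]
        using s False by (auto simp: field_simps elim!: dvdE)
      thus ?thesis by (simp add: f_def algebra_simps)
    qed
  qed
  finally show ?thesis using log_moment_sums[OF r, of j s] sums_unique2 by blast
qed

section \<open>Power series in q and the derivatives of log eta\<close>

definition log_series :: "nat \<Rightarrow> nat \<Rightarrow> complex fps" where
  "log_series s j = Abs_fps (\<lambda>m. of_real (real m ^ j * log_coeff s m))"

lemma conv_radius_log_series: "fps_conv_radius (log_series s j) \<ge> 1"
  unfolding fps_conv_radius_def
proof (rule conv_radius_geI_ex')
  fix r :: real assume "0 < r" "ereal r < 1"
  hence "summable (\<lambda>m. real m ^ j * log_coeff s m * r ^ m)" by (intro summable_log_moment) auto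
  hence "summable (\<lambda>m. complex_of_real (real m ^ j * log_coeff s m * r ^ m))"
    by (rule summable_of_real)
  thus "summable (\<lambda>n. fps_nth (log_series s j) n * of_real r ^ n)" by (simp add: log_series_def)
qed

lemma norm_less_conv_radius_log_series [simp]: "norm z < 1 \<Longrightarrow> ereal (norm z) < fps_conv_radius (log_series s j)"
  using conv_radius_log_series[of s j] less_le_trans[of "ereal (norm z)" 1] by simp

lemma eval_log_series_of_real:
  assumes "0 \<le> r" "r < 1"
  shows "eval_fps (log_series s j) (of_real r) = of_real (log_moment s j r)"
proof -
  have "(\<lambda>m. complex_of_real (real m ^ j * log_coeff s m * r ^ m)) sums of_real (log_moment s j r)"
    using log_moment_sums[OF assms] by (simp only: sums_of_real_iff)
  thus ?thesis by (simp add: eval_fps_def log_series_def sums_iff)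
qed

text \<open>Multiplying the formal derivative by \<open>fps_X\<close> gives \<open>q d/dq\<close>,
  which multiplies each coefficient by its index.\<close>

lemma log_series_Suc: "fps_deriv (log_series s j) * fps_X = log_series s (Suc j)"
proof (rule fps_ext)
  fix n show "fps_nth (fps_deriv (log_series s j) * fps_X) n = fps_nth (log_series s (Suc j)) n"
    by (cases n) (simp_all add: log_series_def)
qed

lemma has_field_derivative_log_series:
  assumes "Im z > 0"
  shows "((\<lambda>z. eval_fps (log_series s j) (exp (2 * of_real pi * \<i> * z))) has_field_derivative
           (2 * of_real pi * \<i> * eval_fps (log_series s (Suc j)) (exp (2 * of_real pi * \<i> * z)))) (at z)"
proof -
  define q where "q = exp (2 * of_real pi * \<i> * z)"
  have q: "norm q < 1" using assms by (simp add: q_def norm_exp_eq_Re)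
  hence q': "ereal (norm q) < fps_conv_radius (fps_deriv (log_series s j))"
    using less_le_trans[OF norm_less_conv_radius_log_series fps_conv_radius_deriv] by blast
  have "((\<lambda>z. eval_fps (log_series s j) (exp (2 * of_real pi * \<i> * z))) has_field_derivative
           (eval_fps (fps_deriv (log_series s j)) q * (q * (2 * of_real pi * \<i>)))) (at z)"
    unfolding q_def
    by (rule DERIV_chain2[OF has_field_derivative_eval_fps])
       (use q in \<open>auto simp: q_def[symmetric] intro!: derivative_eq_intros\<close>)
  also have "eval_fps (fps_deriv (log_series s j)) q * (q * (2 * of_real pi * \<i>))
      = 2 * of_real pi * \<i> * eval_fps (fps_deriv (log_series s j) * fps_X) q"
    using q' by (subst eval_fps_mult) simp_all
  finally show ?thesis by (simp add: log_series_Suc q_def)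
qed

text \<open>Each \<open>Ln (1 - q ^ n)\<close> is expanded into its power series, legitimate for the
  principal branch as \<open>norm q < 1\<close>, and the double series is regrouped by
  \<open>divisor_sum_sums\<close>.\<close>

lemma log_eta_eq:
  assumes "Im z > 0"
  shows "log_eta z = of_real pi * \<i> * z / 12 - eval_fps (log_series 0 0) (exp (2 * of_real pi * \<i> * z))"
proof -
  define q where "q = exp (2 * of_real pi * \<i> * z)"
  have q: "norm q < 1" using assms by (simp add: q_def norm_exp_eq_Re)
  have q0: "q \<noteq> 0" by (simp add: q_def)
  have qn: "exp (2 * of_real pi * \<i> * of_nat n * z) = q ^ n" for n
    unfolding q_def by (simp flip: exp_of_nat_mult add: mult_ac)
  define f where "f = (\<lambda>n k. q ^ (n * k) / of_nat k)"
  have geo: "summable (\<lambda>n. norm q ^ n)" using q by (simp add: summable_geometric)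
  have bound: "norm (f (Suc n) (Suc k)) \<le> norm q ^ n * norm q ^ k" for n k
  proof -
    have "norm (f (Suc n) (Suc k)) = norm q ^ (Suc n * Suc k) / real (Suc k)"
      unfolding f_def norm_divide norm_power norm_of_nat ..
    also have "\<dots> \<le> norm q ^ (Suc n * Suc k)"
      using divide_left_mono[of 1 "real (Suc k)" "norm q ^ (Suc n * Suc k)"] by simp
    also have "\<dots> \<le> norm q ^ (n + k)" using q q0
      by (intro power_decreasing) (simp_all del: power_Suc)
    finally show ?thesis by (simp add: power_add)
  qed
  have rows: "(\<lambda>k. f (Suc n) (Suc k)) sums (- Ln (1 - q ^ Suc n))" for n
  proof -
    have "norm (- (q ^ Suc n)) < 1"
      using q by (simp only: norm_minus_cancel norm_power) (intro power_Suc_less_one, use q0 in auto)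
    from sums_minus[OF Ln_series'[OF this]]
    have "f (Suc n) sums (- Ln (1 - q ^ Suc n))"
      unfolding f_def power_mult by simp
    thus ?thesis by (subst sums_Suc_iff) (simp add: f_def)
  qed
  from divisor_sum_sums[OF bound geo _ geo _ rows] obtain S where
    S: "(\<lambda>n. - Ln (1 - q ^ Suc n)) sums S" "(\<lambda>m. \<Sum>d | d dvd Suc m. f d (Suc m div d)) sums S" by auto
  have "(\<Sum>d | d dvd Suc m. f d (Suc m div d)) = fps_nth (log_series 0 0) (Suc m) * q ^ Suc m" for m
  proof -
    have "(\<Sum>d | d dvd Suc m. f d (Suc m div d)) =
        (\<Sum>d | d dvd Suc m \<and> \<not> 0 dvd d. of_nat d / of_nat (Suc m) * q ^ Suc m)"
    proof (rule sum.cong)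
      fix d assume "d \<in> {d. d dvd Suc m \<and> \<not> 0 dvd d}"
      then obtain k where k: "Suc m = d * k" by auto
      moreover from this have "d > 0" "k > 0" by (auto intro!: Nat.gr0I)
      ultimately show "f d (Suc m div d) = of_nat d / of_nat (Suc m) * q ^ Suc m"
        unfolding k by (simp add: f_def)
    qed (auto intro!: Nat.gr0I)
    also have "\<dots> = of_nat (regular_divisor_sum 0 (Suc m)) / of_nat (Suc m) * q ^ Suc m"
      by (simp only: regular_divisor_sum_def of_nat_sum sum_divide_distrib sum_distrib_right)
    finally show ?thesis
      by (simp only: log_series_def log_coeff_def fps_nth_Abs_fps power_0 mult_1 of_real_divide of_real_of_nat_eq)
  qed
  with S(2) have "(\<lambda>m. fps_nth (log_series 0 0) (Suc m) * q ^ Suc m) sums S" by simp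
  hence "(\<lambda>m. fps_nth (log_series 0 0) m * q ^ m) sums S"
    by (subst (asm) sums_Suc_iff) (simp add: log_series_def)
  hence "eval_fps (log_series 0 0) q = S" by (simp add: eval_fps_def sums_iff)
  moreover have "(\<Sum>n. Ln (1 - q ^ Suc n)) = - S"
    using sums_minus[OF S(1)] by (simp add: sums_iff)
  ultimately show ?thesis unfolding log_eta_def qn q_def[symmetric] by simp
qed

lemma deriv_log_eta:
  assumes "Im z > 0"
  shows "deriv log_eta z = of_real pi * \<i> / 12 -
           2 * of_real pi * \<i> * eval_fps (log_series 0 1) (exp (2 * of_real pi * \<i> * z))"
proof -
  have "((\<lambda>z. of_real pi * \<i> * z / 12 - eval_fps (log_series 0 0) (exp (2 * of_real pi * \<i> * z)))
     has_field_derivative (of_real pi * \<i> / 12 -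
       2 * of_real pi * \<i> * eval_fps (log_series 0 (Suc 0)) (exp (2 * of_real pi * \<i> * z)))) (at z)"
    by (intro DERIV_diff has_field_derivative_log_series assms) (auto intro!: derivative_eq_intros)
  also have "?this \<longleftrightarrow> (log_eta has_field_derivative (of_real pi * \<i> / 12 -
       2 * of_real pi * \<i> * eval_fps (log_series 0 (Suc 0)) (exp (2 * of_real pi * \<i> * z)))) (at z)"
    using eventually_nhds_in_open[OF open_halfspace_Im_gt[of 0], of z] assms
    by (intro DERIV_cong_ev) (auto elim!: eventually_mono simp: log_eta_eq)
  finally show ?thesis using DERIV_imp_deriv by fastforce
qed

lemma deriv_deriv_log_eta:
  assumes "Im z > 0"
  shows "(deriv ^^ 2) log_eta z = 4 * of_real pi ^ 2 * eval_fps (log_series 0 2) (exp (2 * of_real pi * \<i> * z))"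
proof -
  have "((\<lambda>z. of_real pi * \<i> / 12 - 2 * of_real pi * \<i> * eval_fps (log_series 0 1) (exp (2 * of_real pi * \<i> * z)))
     has_field_derivative (- (2 * of_real pi * \<i> *
       (2 * of_real pi * \<i> * eval_fps (log_series 0 (Suc 1)) (exp (2 * of_real pi * \<i> * z)))))) (at z)"
    by (rule derivative_eq_intros has_field_derivative_log_series assms refl)+ simp
  also have "?this \<longleftrightarrow> (deriv log_eta has_field_derivative (- (2 * of_real pi * \<i> *
       (2 * of_real pi * \<i> * eval_fps (log_series 0 (Suc 1)) (exp (2 * of_real pi * \<i> * z)))))) (at z)"
    using eventually_nhds_in_open[OF open_halfspace_Im_gt[of 0], of z] assms
    by (intro DERIV_cong_ev) (auto elim!: eventually_mono simp: deriv_log_eta)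
  finally have "deriv (deriv log_eta) z = (- (2 * of_real pi * \<i> *
       (2 * of_real pi * \<i> * eval_fps (log_series 0 (Suc 1)) (exp (2 * of_real pi * \<i> * z)))))"
    by (rule DERIV_imp_deriv)
  thus ?thesis by (simp add: numeral_2_eq_2 power2_eq_square mult_ac)
qed

section \<open>mu and eta at purely imaginary points\<close>

lemma exp_imaginary_axis: "exp (2 * of_real pi * \<i> * (\<i> * of_real y)) = of_real (exp (- 2 * pi * y))"
proof -
  have "2 * of_real pi * \<i> * (\<i> * of_real y) = of_real (- 2 * pi * y)"
    by (simp add: complex_eq_iff)
  thus ?thesis by (simp only: exp_of_real)
qed

lemma mu_1_imaginary_axis:
  assumes "y > 0"
  shows "mu 1 (\<i> * of_real y) = of_real (y\<^sup>2 * (1 / 24 - log_moment 0 1 (exp (- 2 * pi * y))))"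
proof -
  have "(deriv ^^ 1) log_eta (\<i> * of_real y) = of_real pi * \<i> / 12 -
           2 * of_real pi * \<i> * of_real (log_moment 0 1 (exp (- 2 * pi * y)))"
    using assms by (simp only: funpow.simps One_nat_def o_apply id_apply, subst deriv_log_eta, simp,
       subst exp_imaginary_axis, subst eval_log_series_of_real) auto
  hence "mu 1 (\<i> * of_real y) = - ((\<i> * of_real y) ^ (1 + 1) / (2 * of_real pi * \<i>)) *
      (of_real pi * \<i> / 12 - 2 * of_real pi * \<i> * of_real (log_moment 0 1 (exp (- 2 * pi * y))))"
    unfolding mu_def by (simp only:)
  also have "\<dots> = of_real (y\<^sup>2 * (1 / 24 - log_moment 0 1 (exp (- 2 * pi * y))))"
    by (simp add: power2_eq_square field_simps)
  finally show ?thesis .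
qed

lemma mu_2_imaginary_axis:
  assumes "y > 0"
  shows "mu 2 (\<i> * of_real y) = of_real (2 * pi * y ^ 3 * log_moment 0 2 (exp (- 2 * pi * y)))"
proof -
  have "(deriv ^^ 2) log_eta (\<i> * of_real y) =
      4 * of_real pi ^ 2 * of_real (log_moment 0 2 (exp (- 2 * pi * y)))"
    using assms by (subst deriv_deriv_log_eta, simp, subst exp_imaginary_axis, subst eval_log_series_of_real) auto
  thus ?thesis unfolding mu_def by (simp add: power2_eq_square power3_eq_cube divide_simps)
qed

lemma eta_imaginary_axis:
  assumes "y > 0"
  shows "eta (\<i> * of_real y) = of_real (exp (- pi * y / 12 - log_moment 0 0 (exp (- 2 * pi * y))))"
proof -
  have "eta (\<i> * of_real y) = exp (log_eta (\<i> * of_real y))"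
    using assms by (subst exp_log_eta) auto
  also have "log_eta (\<i> * of_real y) = of_real (- pi * y / 12 - log_moment 0 0 (exp (- 2 * pi * y)))"
    using assms by (subst log_eta_eq, simp, subst exp_imaginary_axis, subst eval_log_series_of_real)
      (auto simp: complex_eq_iff)
  finally show ?thesis by (simp only: exp_of_real)
qed

section \<open>Existence and location of the saddle point\<close>

text \<open>The sum of \<open>n * x ^ n\<close> is \<open>x / (1 - x)\<^sup>2\<close>, which for
  \<open>x = exp (- 2 * a)\<close> equals \<open>1 / (4 * (sinh a)\<^sup>2)\<close>. Regrouping the
  double series by exponents produces the divisor sum.\<close>

lemma log_moment_eq_csch_sum:
  assumes y: "y > 0"
  shows "log_moment 0 1 (exp (- 2 * pi * y)) = csch_sum y / 4"
proof -
  define r where "r = exp (- 2 * pi * y)"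
  have r: "0 < r" "r < 1" using y by (auto simp: r_def)
  define f where "f = (\<lambda>k n. real n * r ^ (k * n))"
  have geo: "summable (\<lambda>k. r ^ k)" "summable (\<lambda>n. real (Suc n) * r ^ n)"
    using r sums_summable[OF geometric_deriv_sums[of r]] by (simp_all add: summable_geometric)
  have bound: "norm (f (Suc k) (Suc n)) \<le> r ^ k * (real (Suc n) * r ^ n)" for k n
  proof -
    have "r ^ (Suc k * Suc n) \<le> r ^ (k + n)" using r by (intro power_decreasing) auto
    hence "real (Suc n) * r ^ (Suc k * Suc n) \<le> real (Suc n) * r ^ (k + n)"
      by (intro mult_left_mono) auto
    also have "\<dots> = r ^ k * (real (Suc n) * r ^ n)"
      by (simp only: power_add mult.left_commute[of "r ^ k"])
    also have "real (Suc n) * r ^ (Suc k * Suc n) = norm (f (Suc k) (Suc n))"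
      using r unfolding f_def real_norm_def by (subst abs_of_nonneg) auto
    finally show ?thesis .
  qed
  have rows: "(\<lambda>n. f (Suc k) (Suc n)) sums (1 / (sinh (pi * y * real (Suc k)))\<^sup>2 / 4)" for k
  proof -
    define x where "x = r ^ Suc k"
    define a where "a = pi * y * real (Suc k)"
    have x: "0 < x" "x < 1" using r power_Suc_less_one[of r k] by (auto simp: x_def)
    have xa: "x = exp (-a) * exp (-a)"
      unfolding x_def r_def a_def by (simp add: algebra_simps flip: exp_of_nat_mult exp_add)
    have "(\<lambda>n. x * (real (Suc n) * x ^ n)) sums (x * (1 / (1 - x)\<^sup>2))"
      using x by (intro sums_mult geometric_deriv_sums) auto
    also have "(\<lambda>n. x * (real (Suc n) * x ^ n)) = (\<lambda>n. f (Suc k) (Suc n))"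
      unfolding f_def x_def power_mult by (auto simp: mult_ac)
    also have "x * (1 / (1 - x)\<^sup>2) = 1 / (sinh a)\<^sup>2 / 4"
    proof -
      have ea: "exp a * exp (-a) = 1" by (simp flip: exp_add)
      have ax: "exp a * x = exp (-a)" unfolding xa mult.assoc[symmetric] ea by simp
      hence "2 * sinh a = exp a * (1 - x)" by (simp add: sinh_field_def right_diff_distrib)
      hence "(2 * sinh a)\<^sup>2 = (exp a * exp a) * (1 - x)\<^sup>2" by (simp add: power2_eq_square)
      moreover have "x * (exp a * exp a) = (exp a * x) * exp a" by (simp only: mult_ac)
      hence "x * (exp a * exp a) = 1" unfolding ax using ea by (simp only: mult.commute)
      ultimately have "x * (2 * sinh a)\<^sup>2 = 1 * (1 - x)\<^sup>2" by (simp only: mult.assoc[symmetric])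
      hence "(1 - x)\<^sup>2 = x * (2 * sinh a)\<^sup>2" by simp
      thus ?thesis using x by (simp add: power_mult_distrib)
    qed
    finally show ?thesis by (simp add: a_def)
  qed
  have nn: "r ^ k \<ge> 0" "real (Suc n) * r ^ n \<ge> 0" for k n using r by auto
  from divisor_sum_sums[OF bound geo(1) nn(1) geo(2) nn(2) rows] obtain S where
    S: "(\<lambda>k. 1 / (sinh (pi * y * real (Suc k)))\<^sup>2 / 4) sums S"
       "(\<lambda>m. \<Sum>d | d dvd Suc m. f d (Suc m div d)) sums S" by blast
  have "(\<Sum>d | d dvd Suc m. f d (Suc m div d)) = real (Suc m) ^ 1 * log_coeff 0 (Suc m) * r ^ Suc m" for m
  proof -
    have "(\<Sum>d | d dvd Suc m. f d (Suc m div d)) = (\<Sum>d | d dvd Suc m \<and> \<not> 0 dvd d. real d * r ^ Suc m)"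
    \<comment> \<open>The summand is here the codivisor \<open>Suc m div d\<close>, so divisor and
      codivisor have to be exchanged first.\<close>
    proof (rule sum.reindex_bij_witness[of _ "\<lambda>d. Suc m div d" "\<lambda>d. Suc m div d"])
      fix d assume "d \<in> {d. d dvd Suc m}"
      then obtain k where k: "Suc m = d * k" by (auto elim: dvdE)
      moreover from this have dk: "d > 0" "k > 0" by (auto intro!: Nat.gr0I)
      ultimately have div: "Suc m div d = k" "Suc m div k = d"
        using nonzero_mult_div_cancel_left[of d k] nonzero_mult_div_cancel_right[of k d] by simp_all
      show "Suc m div (Suc m div d) = d" unfolding div ..
      show "Suc m div d \<in> {d. d dvd Suc m \<and> \<not> 0 dvd d}" unfolding div using k dk by simp
      show "real (Suc m div d) * r ^ Suc m = f d (Suc m div d)"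
        unfolding div k by (simp add: f_def)
    next
      fix d assume "d \<in> {d. d dvd Suc m \<and> \<not> 0 dvd d}"
      then obtain k where k: "Suc m = d * k" by (auto elim: dvdE)
      moreover from this have dk: "d > 0" "k > 0" by (auto intro!: Nat.gr0I)
      ultimately have div: "Suc m div d = k" "Suc m div k = d"
        using nonzero_mult_div_cancel_left[of d k] nonzero_mult_div_cancel_right[of k d] by simp_all
      show "Suc m div (Suc m div d) = d" unfolding div ..
      show "Suc m div d \<in> {d. d dvd Suc m}" unfolding div using k dk by simp
    qed
    also have "\<dots> = real (regular_divisor_sum 0 (Suc m)) * r ^ Suc m"
      by (simp only: regular_divisor_sum_def of_nat_sum sum_distrib_right)
    also have "\<dots> = real (Suc m) ^ 1 * log_coeff 0 (Suc m) * r ^ Suc m"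
      by (simp add: log_coeff_def)
    finally show ?thesis .
  qed
  with S(2) have "(\<lambda>m. real (Suc m) ^ 1 * log_coeff 0 (Suc m) * r ^ Suc m) sums S" by simp
  hence "(\<lambda>m. real m ^ 1 * log_coeff 0 m * r ^ m) sums S"
    by (subst (asm) sums_Suc_iff) simp
  with log_moment_sums[of r 1 0] r have "S = log_moment 0 1 r" using sums_unique2 by force
  moreover have "S = csch_sum y / 4"
    using sums_divide[OF csch_sum_sums[OF y], of 4] S(1) sums_unique2 by blast
  ultimately show ?thesis by (simp add: r_def)
qed

lemma csch_sum_le:
  assumes y: "y > 0"
  shows "csch_sum y \<le> 1 / (6 * y\<^sup>2)"
proof -
  have "1 / (sinh (pi * y * real (Suc k)))\<^sup>2 \<le> 1 / (pi\<^sup>2 * y\<^sup>2) / (real (Suc k))\<^sup>2" for k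
  proof -
    have "(pi * y * real (Suc k))\<^sup>2 \<le> (sinh (pi * y * real (Suc k)))\<^sup>2"
      using y by (intro power_mono sinh_ge_self) auto
    hence "1 / (sinh (pi * y * real (Suc k)))\<^sup>2 \<le> 1 / (pi * y * real (Suc k))\<^sup>2"
      using y by (intro divide_left_mono mult_pos_pos) auto
    thus ?thesis by (simp add: power_mult_distrib)
  qed
  from sums_le[OF this csch_sum_sums[OF y] sums_inverse_Suc_squares] show ?thesis by simp
qed

lemma log_coeff_1: "s \<noteq> 1 \<Longrightarrow> log_coeff s 1 = 1"
proof -
  assume "s \<noteq> 1"
  hence "{d::nat. d dvd 1 \<and> \<not> s dvd d} = {1}" by auto
  thus ?thesis by (simp add: log_coeff_def regular_divisor_sum_def)
qed

lemma log_moment_ge: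
  assumes "s \<noteq> 1" "0 \<le> r" "r < 1"
  shows "r \<le> log_moment s j r"
proof -
  have "(\<Sum>m\<in>{1}. real m ^ j * log_coeff s m * r ^ m) \<le> log_moment s j r"
    unfolding log_moment_def using assms by (intro sum_le_suminf summable_log_moment) auto
  thus ?thesis using assms log_coeff_1 by simp
qed

text \<open>For \<open>s \<noteq> 1\<close> the coefficient of index 1 is 1, and this single term
  makes the increase strict.\<close>

lemma log_moment_strict_mono:
  assumes "s \<noteq> 1" "0 \<le> r" "r < r'" "r' < 1"
  shows "log_moment s j r < log_moment s j r'"
proof -
  let ?f = "\<lambda>r m. real m ^ j * log_coeff s m * r ^ m"
  have "(\<lambda>m. ?f r' m - ?f r m) sums (log_moment s j r' - log_moment s j r)"
    using assms by (intro sums_diff log_moment_sums) auto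
  moreover have "(\<Sum>m\<in>{1}. ?f r' m - ?f r m) \<le> (\<Sum>m. ?f r' m - ?f r m)"
  proof (rule sum_le_suminf)
    show "summable (\<lambda>m. ?f r' m - ?f r m)" using calculation by (simp add: sums_iff)
    show "0 \<le> ?f r' m - ?f r m" for m
      using assms power_mono[of r r' m] by (simp add: mult_left_mono)
  qed auto
  ultimately show ?thesis using assms log_coeff_1 by (simp add: sums_iff)
qed

lemma isCont_log_moment:
  assumes "0 \<le> r" "r < 1"
  shows "isCont (log_moment s j) r"
proof -
  have "summable (\<lambda>m. real m ^ j * log_coeff s m * ((r + 1) / 2) ^ m)"
    using assms by (intro summable_log_moment) auto
  hence "isCont (\<lambda>r. \<Sum>m. real m ^ j * log_coeff s m * r ^ m) r"
    by (rule isCont_powser) (use assms in auto)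
  thus ?thesis by (simp add: log_moment_def[abs_def])
qed

lemma exp_power_nat: "exp (- 2 * pi * y) ^ s = exp (- 2 * pi * (real s * y))"
  by (simp add: algebra_simps flip: exp_of_nat_mult)

lemma log_moment_split_exp:
  assumes "s > 0" "y > 0"
  shows "log_moment s j (exp (- 2 * pi * y)) = log_moment 0 j (exp (- 2 * pi * y)) -
           real s ^ j * log_moment 0 j (exp (- 2 * pi * (real s * y)))"
  using log_moment_split[of s "exp (- 2 * pi * y)" j] assms by (simp only: exp_power_nat) simp

lemma log_moment_1_le:
  assumes "y > 0"
  shows "log_moment 0 1 (exp (- 2 * pi * y)) \<le> 1 / (24 * y\<^sup>2)"
  using csch_sum_le[OF assms] log_moment_eq_csch_sum[OF assms] by (simp add: field_simps)

lemma log_moment_nonneg: "0 \<le> r \<Longrightarrow> r < 1 \<Longrightarrow> 0 \<le> log_moment s j r"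
  unfolding log_moment_def by (intro suminf_nonneg summable_log_moment) auto

lemma log_moment_le_full:
  assumes "s > 0" "y > 0"
  shows "log_moment s j (exp (- 2 * pi * y)) \<le> log_moment 0 j (exp (- 2 * pi * y))"
  unfolding log_moment_split_exp[OF assms] using assms by (simp add: log_moment_nonneg)

lemma log_moment_1_eq_csch_sum:
  assumes "s > 0" "y > 0"
  shows "log_moment s 1 (exp (- 2 * pi * y)) = (csch_sum y - real s * csch_sum (real s * y)) / 4"
proof -
  have "real s * y > 0" using assms by simp
  from log_moment_split_exp[OF assms, of 1] show ?thesis
    unfolding log_moment_eq_csch_sum[OF assms(2)] log_moment_eq_csch_sum[OF \<open>real s * y > 0\<close>]
    by simp
qed

text \<open>Reciprocity is applied at \<open>y\<close> and at \<open>s * y\<close>. The anomalous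
  terms cancel, and as \<open>s * w = 1 / y\<close> the csch sums at \<open>w\<close> and
  \<open>1 / y\<close> recombine into a positive multiple of the first moment at \<open>w\<close>:
  the Fricke involution at work. Discarding that positive term gives the strict bound.\<close>

lemma log_moment_1_gt:
  assumes s: "s \<ge> 2" and y: "y > 0"
  shows "(1 - 1 / real s) / (24 * y\<^sup>2) - (real s - 1) / 24 < log_moment s 1 (exp (- 2 * pi * y))"
proof -
  define w where "w = 1 / (real s * y)"
  have w: "w > 0" "real s * w = 1 / y" "1 / (real s * y) = w" using s y by (auto simp: w_def)
  have "exp (- 2 * pi * w) \<le> log_moment s 1 (exp (- 2 * pi * w))"
    using s w by (intro log_moment_ge) auto
  hence "0 < log_moment s 1 (exp (- 2 * pi * w))" by (rule less_le_trans[OF exp_gt_zero])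
  also have "\<dots> = (csch_sum w - real s * csch_sum (1 / y)) / 4"
    using log_moment_1_eq_csch_sum[of s w] s w(1) unfolding w(2) by simp
  finally have pos: "0 < csch_sum w - real s * csch_sum (1 / y)" by simp
  have "4 * log_moment s 1 (exp (- 2 * pi * y)) = csch_sum y - real s * csch_sum (real s * y)"
    using log_moment_1_eq_csch_sum[of s y] s y by simp
  also have "csch_sum y = 1 / (6 * y\<^sup>2) + 1 / 6 - 1 / (pi * y) - csch_sum (1 / y) / y\<^sup>2"
    using csch_sum_reciprocity[OF y] by simp
  also have "csch_sum (real s * y) = 1 / (6 * (real s * y)\<^sup>2) + 1 / 6 - 1 / (pi * (real s * y)) - csch_sum w / (real s * y)\<^sup>2"
  proof -
    have "real s * y > 0" using s y by simp
    from csch_sum_reciprocity[OF this] show ?thesis unfolding w(3) by (simp only: eq_diff_eq)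
  qed
  also have "1 / (6 * y\<^sup>2) + 1 / 6 - 1 / (pi * y) - csch_sum (1 / y) / y\<^sup>2 -
      real s * (1 / (6 * (real s * y)\<^sup>2) + 1 / 6 - 1 / (pi * (real s * y)) - csch_sum w / (real s * y)\<^sup>2)
    = (1 - 1 / real s) / (6 * y\<^sup>2) - (real s - 1) / 6 + (csch_sum w - real s * csch_sum (1 / y)) / (real s * y\<^sup>2)"
  proof -
    \<comment> \<open>The csch sums are generalised to arbitrary \<open>A\<close> and
      \<open>B\<close>; the identity is purely algebraic.\<close>
    have id: "a + b - c - B / y\<^sup>2 - S * (1 / (6 * (S * y)\<^sup>2) + b - 1 / (pi * (S * y)) - A / (S * y)\<^sup>2)
      = a - 1 / S * (1 / (6 * y\<^sup>2)) - (S - 1) * b + (1 / (pi * y) - c) + (A - S * B) / (S * y\<^sup>2)"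
      if "S > 0" for a b c S A B
    proof -
      have "S * (1 / (6 * (S * y)\<^sup>2)) = 1 / S * (1 / (6 * y\<^sup>2))" "S * (1 / (pi * (S * y))) = 1 / (pi * y)"
        "S * (A / (S * y)\<^sup>2) = A / (S * y\<^sup>2)" "(A - S * B) / (S * y\<^sup>2) = A / (S * y\<^sup>2) - B / y\<^sup>2"
        using that y by (simp_all add: power2_eq_square diff_divide_distrib)
      thus ?thesis by (simp only: right_diff_distrib distrib_left left_diff_distrib mult_1)
    qed
    have "real s > 0" using s by simp
    from id[OF this, of "1 / (6 * y\<^sup>2)" "1 / 6" "1 / (pi * y)"] show ?thesis
      by (simp add: diff_divide_distrib)
  qed
  finally have "4 * log_moment s 1 (exp (- 2 * pi * y)) =
     (1 - 1 / real s) / (6 * y\<^sup>2) - (real s - 1) / 6 + (csch_sum w - real s * csch_sum (1 / y)) / (real s * y\<^sup>2)" .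
  moreover have "(csch_sum w - real s * csch_sum (1 / y)) / (real s * y\<^sup>2) > 0"
    by (rule divide_pos_pos[OF pos]) (use s y in simp)
  moreover have "x / (6 * z) = 4 * (x / (24 * z))" for x z :: real by simp
  ultimately show ?thesis by (smt (verit))
qed

text \<open>The constants \<open>1 / 24\<close> in the values of \<open>mu 1\<close> contribute
  \<open>(s - 1) / 24\<close>, which is the \<open>t / 24\<close> on the right-hand side of the
  equation.\<close>

lemma saddle_point_eq_iff:
  assumes "y > 0"
  shows "saddle_point_eq N t y \<longleftrightarrow> log_moment (t + 1) 1 (exp (- 2 * pi * y)) = real N"
proof -
  define s where "s = real (t + 1)"
  have s: "s > 0" by (simp add: s_def)
  define a b where "a = log_moment 0 1 (exp (- 2 * pi * y))" and "b = log_moment 0 1 (exp (- 2 * pi * (s * y)))"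
  have split: "log_moment (t + 1) 1 (exp (- 2 * pi * y)) = a - s * b"
    using log_moment_split_exp[of "t + 1" y 1] assms by (simp add: a_def b_def s_def)
  have arg: "of_nat (t + 1) * \<i> * complex_of_real y = \<i> * of_real (s * y)" by (simp add: s_def)
  have "s * y > 0" using assms s by simp
  hence "mu 1 (of_nat (t + 1) * \<i> * of_real y) = of_real ((s * y)\<^sup>2 * (1 / 24 - b))"
    unfolding b_def arg by (rule mu_1_imaginary_axis)
  moreover have "mu 1 (\<i> * of_real y) = of_real (y\<^sup>2 * (1 / 24 - a))"
    unfolding a_def by (rule mu_1_imaginary_axis[OF assms])
  moreover have "complex_of_nat (t + 1) = of_real s" by (simp add: s_def)
  ultimately have "(mu 1 (of_nat (t + 1) * \<i> * of_real y) - of_nat (t + 1) * mu 1 (\<i> * of_real y)) /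
       (of_nat (t + 1) * of_real y ^ 2) =
     of_real (((s * y)\<^sup>2 * (1 / 24 - b) - s * (y\<^sup>2 * (1 / 24 - a))) / (s * y\<^sup>2))"
    by (simp only: of_real_diff of_real_mult of_real_divide of_real_power)
  also have "((s * y)\<^sup>2 * (1 / 24 - b) - s * (y\<^sup>2 * (1 / 24 - a))) / (s * y\<^sup>2) = real t / 24 + (a - s * b)"
    using s assms by (simp add: field_simps power2_eq_square) (simp add: s_def algebra_simps)
  finally have "saddle_point_eq N t y \<longleftrightarrow> complex_of_real (real t / 24 + (a - s * b)) = of_real (real N + real t / 24)"
    unfolding saddle_point_eq_def by simp
  also have "\<dots> \<longleftrightarrow> a - s * b = real N" by (simp only: of_real_eq_iff) auto
  finally show ?thesis using split by simp
qed

lemma saddle_point_exists_unique: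
  assumes N: "N \<ge> 1" and t: "t \<ge> 1"
  shows "\<exists>!y. y > 0 \<and> saddle_point_eq N t y"
    and "\<And>y. y > 0 \<Longrightarrow> saddle_point_eq N t y \<Longrightarrow>
           sqrt (real t / (24 * (real t + 1) * (real N + real t / 24))) < y \<and> y < 1 / sqrt (24 * real N - 1)"
proof -
  define s where "s = t + 1"
  have s: "s \<ge> 2" using t by (simp add: s_def)
  define g where "g = (\<lambda>y. log_moment s 1 (exp (- 2 * pi * y)))"
  have g_mono: "g y' < g y" if "0 < y" "y < y'" for y y'
    unfolding g_def using that s by (intro log_moment_strict_mono) auto
  have iff: "saddle_point_eq N t y \<longleftrightarrow> g y = real N" if "y > 0" for y
    using saddle_point_eq_iff[OF that] by (simp add: g_def s_def)
  \<comment> \<open>At \<open>a\<close> the lower bound of \<open>log_moment_1_gt\<close> is exactly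
    \<open>N\<close>, and at \<open>b\<close> the upper bound \<open>1 / (24 * y\<^sup>2)\<close> is
    exactly \<open>N\<close>. As \<open>b\<close> lies slightly below the claimed upper end, the
    non-strict \<open>gb\<close> is enough for a strict inequality.\<close>
  define a where "a = sqrt (real t / (24 * (real t + 1) * (real N + real t / 24)))"
  define b where "b = 1 / sqrt (24 * real N)"
  have a: "a > 0" unfolding a_def using t N by (auto intro!: divide_pos_pos mult_pos_pos add_pos_nonneg)
  have b: "b > 0" unfolding b_def using N by auto
  have "a\<^sup>2 = real t / (24 * (real t + 1) * (real N + real t / 24))"
    unfolding a_def by (rule real_sqrt_pow2) auto
  hence "1 / (24 * a\<^sup>2) = (real t + 1) * (real N + real t / 24) / real t"
    using t N by (simp add: field_simps)
  moreover have "1 - 1 / real s = real t / (real t + 1)" by (simp add: s_def field_simps)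
  ultimately have "(1 - 1 / real s) * (1 / (24 * a\<^sup>2)) = real N + real t / 24"
    using t by simp
  with log_moment_1_gt[OF s a] have ga: "real N < g a" by (simp add: g_def s_def)
  have gb: "g b \<le> real N"
  proof -
    have "g b \<le> 1 / (24 * b\<^sup>2)"
      unfolding g_def using log_moment_le_full[of s b 1] log_moment_1_le[OF b] s b by simp
    also have "\<dots> = real N" using N by (simp add: b_def power_divide)
    finally show ?thesis .
  qed
  have ab: "a < b"
  proof (rule ccontr)
    assume "\<not> a < b"
    hence "g a \<le> g b" using g_mono[of b a] b by (cases "a = b") auto
    with ga gb show False by simp
  qed
  have "continuous_on {a..b} g"
    unfolding g_def
    by (intro continuous_at_imp_continuous_on ballI isCont_o2[OF _ isCont_log_moment] continuous_intros)
       (use a in auto)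
  with IVT2'[of g b "real N" a] ga gb ab obtain y where y: "a \<le> y" "y \<le> b" "g y = real N" by auto
  have uniq: "y' = y" if "y' > 0" "g y' = real N" for y'
    using that y a g_mono[of y y'] g_mono[of y' y] by (cases y y' rule: linorder_cases) auto
  show "\<exists>!y. y > 0 \<and> saddle_point_eq N t y"
    using y a uniq iff by (intro ex1I[of _ y]) auto
  fix y' assume y': "y' > 0" "saddle_point_eq N t y'"
  hence "y' = y" using iff uniq by auto
  moreover have "a \<noteq> y" using y ga by auto
  moreover have "b < 1 / sqrt (24 * real N - 1)"
    unfolding b_def using N by (intro divide_strict_left_mono mult_pos_pos) auto
  ultimately show "a < y' \<and> y' < 1 / sqrt (24 * real N - 1)" using y by auto
qed

section \<open>Cauchy's formula for the number of regular partitions\<close>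

lemma sum_mset_conv_count:
  fixes P :: "nat multiset"
  assumes "finite A" "set_mset P \<subseteq> A"
  shows "sum_mset P = (\<Sum>n\<in>A. n * count P n)"
  using assms(2)
proof (induction P)
  case (add x P)
  have "(\<Sum>n\<in>A. n * count (add_mset x P) n) = (\<Sum>n\<in>A. n * count P n + (if n = x then x else 0))"
    by (intro sum.cong) auto
  also have "\<dots> = (\<Sum>n\<in>A. n * count P n) + x"
    using add.prems assms(1) by (simp add: sum.distrib)
  finally show ?case using add by simp
qed simp

text \<open>Removing \<open>j\<close> copies of the part \<open>n\<close> is a bijection onto the
  partitions of \<open>N - n * j\<close>.\<close>

lemma card_count_ge:
  assumes n: "n > 0" "\<not> (t + 1) dvd n"
  shows "card {P \<in> regular_partitions N t. j \<le> count P n} =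
           (if n * j \<le> N then num_regular_partitions (N - n * j) t else 0)"
proof (cases "n * j \<le> N")
  case True
  have "bij_betw (\<lambda>P. P + replicate_mset j n) (regular_partitions (N - n * j) t)
          {P \<in> regular_partitions N t. j \<le> count P n}"
  proof (rule bij_betwI[where g = "\<lambda>P. P - replicate_mset j n"])
    show "(\<lambda>P. P - replicate_mset j n) \<in> {P \<in> regular_partitions N t. j \<le> count P n} \<rightarrow> regular_partitions (N - n * j) t"
    proof
      fix P assume P: "P \<in> {P \<in> regular_partitions N t. j \<le> count P n}"
      hence sub: "replicate_mset j n \<subseteq># P" by (auto simp: subseteq_mset_def)
      hence "sum_mset (P - replicate_mset j n) = sum_mset P - j * n"
        by (simp add: sum_mset_diff)
      moreover have "0 < x \<and> \<not> (t + 1) dvd x" if "x \<in># P - replicate_mset j n" for x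
        using P in_diffD[OF that] unfolding regular_partitions_def by blast
      ultimately show "P - replicate_mset j n \<in> regular_partitions (N - n * j) t"
        using P by (simp add: regular_partitions_def mult.commute)
    qed
    show "(\<lambda>P. P + replicate_mset j n) \<in> regular_partitions (N - n * j) t \<rightarrow> {P \<in> regular_partitions N t. j \<le> count P n}"
      using True n by (auto simp: regular_partitions_def mult.commute)
    show "P - replicate_mset j n + replicate_mset j n = P"
      if "P \<in> {P \<in> regular_partitions N t. j \<le> count P n}" for P
      using that by (intro subset_mset.diff_add) (auto simp: subseteq_mset_def)
  qed auto
  thus ?thesis using True by (simp add: num_regular_partitions_def bij_betw_same_card[symmetric])
next
  case False
  have "\<not> j \<le> count P n" if "P \<in> regular_partitions N t" for P
  proof
    assume "j \<le> count P n"
    hence "replicate_mset j n \<subseteq># P" by (auto simp: subseteq_mset_def)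
    then obtain Q where "P = replicate_mset j n + Q" by (auto simp: mset_subset_eq_exists_conv)
    hence "sum_mset P = j * n + sum_mset Q" by simp
    with False that show False by (simp add: regular_partitions_def mult.commute)
  qed
  hence "{P \<in> regular_partitions N t. j \<le> count P n} = {}" by blast
  thus ?thesis using False by (simp only: card.empty if_False)
qed

text \<open>The total size of all the partitions is counted twice. A part \<open>n\<close> of
  multiplicity c contributes \<open>n\<close> once for each \<open>j\<close> from 1 to c,
  \<open>card_count_ge\<close> counts the partitions belonging to a pair \<open>(n, j)\<close>, and
  the pairs are collected by their product \<open>m\<close>.\<close>

lemma num_regular_partitions_recurrence:
  "N * num_regular_partitions N t =
     (\<Sum>m=1..N. regular_divisor_sum (t + 1) m * num_regular_partitions (N - m) t)"
proof -
  define R where "R = regular_partitions N t"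
  define A where "A = {n\<in>{1..N}. \<not> (t + 1) dvd n}"
  have fin: "finite R" "finite A" by (auto simp: R_def A_def finite_regular_partitions)
  have part: "count P n \<le> N" "set_mset P \<subseteq> A" "sum_mset P = N" if "P \<in> R" for P n
  proof -
    have P: "sum_mset P = N" "\<forall>x\<in>#P. 0 < x \<and> \<not> (t + 1) dvd x"
      using that by (auto simp: R_def regular_partitions_def)
    have "x \<le> N" if "x \<in># P" for x using P(1) multi_member_split[OF that] by auto
    thus "set_mset P \<subseteq> A" using P by (force simp: A_def)
    have "size P \<le> sum_mset P" using P(2) by (induction P) auto
    thus "count P n \<le> N" unfolding P(1) using count_le_size[of P n] by (rule order.trans[rotated])
    show "sum_mset P = N" by (rule P(1))
  qed
  have "N * num_regular_partitions N t = (\<Sum>P\<in>R. sum_mset P)"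
    unfolding num_regular_partitions_def R_def[symmetric] by (simp add: part(3) cong: sum.cong)
  also have "\<dots> = (\<Sum>P\<in>R. \<Sum>n\<in>A. n * count P n)"
  proof (rule sum.cong)
    fix P assume P: "P \<in> R"
    show "sum_mset P = (\<Sum>n\<in>A. n * count P n)"
      using part[OF P] fin by (intro sum_mset_conv_count)
  qed auto
  also have "\<dots> = (\<Sum>n\<in>A. n * (\<Sum>P\<in>R. count P n))"
    unfolding sum_distrib_left by (rule sum.swap)
  also have "\<dots> = (\<Sum>n\<in>A. n * (\<Sum>j=1..N. if n * j \<le> N then num_regular_partitions (N - n * j) t else 0))"
  proof (rule sum.cong)
    fix n assume n: "n \<in> A"
    have "(\<Sum>P\<in>R. count P n) = (\<Sum>P\<in>R. \<Sum>j=1..N. if j \<le> count P n then 1 else 0)"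
    proof (rule sum.cong)
      fix P assume "P \<in> R"
      from part(1)[OF this, of n] have "{j\<in>{1..N}. j \<le> count P n} = {1..count P n}" by auto
      hence "card {j\<in>{1..N}. j \<le> count P n} = count P n" by simp
      thus "count P n = (\<Sum>j=1..N. if j \<le> count P n then 1 else 0)"
        by (simp only: card_eq_sum sum.inter_filter finite_atLeastAtMost)
    qed auto
    also have "\<dots> = (\<Sum>j=1..N. card {P \<in> R. j \<le> count P n})"
      by (subst sum.swap) (simp only: card_eq_sum sum.inter_filter fin)
    also have "\<dots> = (\<Sum>j=1..N. if n * j \<le> N then num_regular_partitions (N - n * j) t else 0)"
      using n unfolding R_def A_def by (intro sum.cong card_count_ge) auto
    finally show "n * (\<Sum>P\<in>R. count P n) = n * \<dots>" by simp
  qed auto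
  also have "\<dots> = (\<Sum>(n,j)\<in>A \<times> {1..N}. if n * j \<le> N then n * num_regular_partitions (N - n * j) t else 0)"
    unfolding sum_distrib_left sum.cartesian_product[symmetric] by (intro sum.cong) auto
  also have "\<dots> = (\<Sum>(n,j) | (n, j) \<in> A \<times> {1..N} \<and> n * j \<le> N. n * num_regular_partitions (N - n * j) t)"
    using fin by (intro sum.mono_neutral_cong_right) (auto split: if_splits)
  also have "\<dots> = (\<Sum>(m,d) \<in> (SIGMA m:{1..N}. {d. d dvd m \<and> \<not> (t + 1) dvd d}). d * num_regular_partitions (N - m) t)"
  proof (rule sum.reindex_bij_witness[where i = "\<lambda>(m,d). (d, m div d)" and j = "\<lambda>(n,j). (n * j, n)"], goal_cases)
    case (4 p)
    then obtain m d where p: "p = (m, d)" "m \<in> {1..N}" "d dvd m" "\<not> (t + 1) dvd d" by auto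
    from p(3) obtain k where k: "m = d * k" by (auto elim: dvdE)
    hence dk: "d > 0" "k > 0" using p(2) by (auto intro!: Nat.gr0I)
    have div: "m div d = k" unfolding k using dk by simp
    have le: "d \<le> m" "k \<le> m" unfolding k using dk by simp_all
    have "m \<le> N" using p(2) by simp
    hence N: "d \<le> N" "k \<le> N" "d * k \<le> N" using le k by (blast intro: order.trans)+
    have "d \<in> A" "k \<in> {1..N}" using N dk p(4) unfolding A_def by simp_all
    thus ?case using N(3) unfolding p(1) case_prod_conv div by simp
  qed (auto simp: A_def)
  also have "\<dots> = (\<Sum>m=1..N. \<Sum>d | d dvd m \<and> \<not> (t + 1) dvd d. d * num_regular_partitions (N - m) t)"
    by (subst sum.Sigma) auto
  also have "\<dots> = (\<Sum>m=1..N. regular_divisor_sum (t + 1) m * num_regular_partitions (N - m) t)"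
    by (simp add: regular_divisor_sum_def sum_distrib_right)
  finally show ?thesis .
qed

section \<open>The generating function and its coefficients as integrals\<close>

lemma num_regular_partitions_0: "num_regular_partitions 0 t = 1"
proof -
  have "P = {#}" if "P \<in> regular_partitions 0 t" for P
  proof (rule ccontr)
    assume "P \<noteq> {#}"
    then obtain x where x: "x \<in># P" by (rule multiset_nonemptyE)
    from multi_member_split[OF x] obtain Q where Q: "P = add_mset x Q" ..
    have "sum_mset P = 0" "0 < x" using that x unfolding regular_partitions_def by blast+
    thus False unfolding Q by simp
  qed
  hence "regular_partitions 0 t = {{#}}" by (auto simp: regular_partitions_def)
  thus ?thesis by (simp add: num_regular_partitions_def)
qed

text \<open>With \<open>L\<close> the log series and \<open>E\<close> its exponential, comparing
  coefficients in \<open>q E' = E (q L')\<close> gives the recurrence of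
  \<open>num_regular_partitions_recurrence\<close>. No infinite product has to be formed.\<close>

lemma fps_nth_exp_log_series:
  "fps_nth (fps_exp 1 oo log_series (t + 1) 0) N = of_nat (num_regular_partitions N t)"
proof (induction N rule: less_induct)
  case (less N)
  define E where "E = fps_exp 1 oo log_series (t + 1) 0"
  show ?case
  proof (cases "N = 0")
    case True
    thus ?thesis by (simp add: num_regular_partitions_0 fps_compose_nth_0)
  next
    case False
    have "fps_deriv E = E * fps_deriv (log_series (t + 1) 0)"
      unfolding E_def by (subst fps_compose_deriv) (simp_all add: log_series_def)
    hence "fps_deriv E * fps_X = E * log_series (t + 1) 1"
      using log_series_Suc[of "t + 1" 0] by (simp add: mult.assoc)
    hence "fps_nth (fps_deriv E * fps_X) N = fps_nth (log_series (t + 1) 1 * E) N" by (simp add: mult.commute)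
    also have "fps_nth (fps_deriv E * fps_X) N = of_nat N * fps_nth E N"
      using False by (cases N) auto
    also have "fps_nth (log_series (t + 1) 1 * E) N = (\<Sum>m=0..N. fps_nth (log_series (t + 1) 1) m * fps_nth E (N - m))"
      by (simp add: fps_mult_nth)
    \<comment> \<open>The term \<open>m = 0\<close> vanishes, so that only smaller arguments remain
      and the induction hypothesis applies.\<close>
    also have "\<dots> = (\<Sum>m=1..N. fps_nth (log_series (t + 1) 1) m * fps_nth E (N - m))"
      by (rule sum.mono_neutral_right) (auto simp: log_series_def)
    also have "\<dots> = (\<Sum>m=1..N. of_nat (regular_divisor_sum (t + 1) m * num_regular_partitions (N - m) t))"
      using less.IH by (intro sum.cong) (auto simp: E_def log_series_def log_coeff_def)
    also have "\<dots> = of_nat (N * num_regular_partitions N t)"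
      by (simp only: num_regular_partitions_recurrence of_nat_sum)
    finally show ?thesis using False by (simp add: E_def)
  qed
qed

lemma num_regular_partitions_integral:
  assumes r: "0 < r" "r < 1"
  shows "((\<lambda>\<theta>. exp (eval_fps (log_series (t + 1) 0) (of_real r * cis \<theta>)) * cis (- real N * \<theta>)) has_integral
           of_real (2 * pi * r ^ N) * of_nat (num_regular_partitions N t)) {0..2 * pi}"
proof -
  define L where "L = log_series (t + 1) 0"
  define f where "f = (\<lambda>q. exp (eval_fps L q))"
  have rad: "norm z < 1 \<Longrightarrow> ereal (norm z) < fps_conv_radius L" for z by (simp add: L_def)
  have "ereal 0 < fps_conv_radius L" using rad[of 0] by simp
  hence "(exp \<circ> eval_fps L) has_fps_expansion (fps_exp 1 oo L)"
    by (intro has_fps_expansion_compose eval_fps_has_fps_expansion fps_expansion_intros has_fps_expansion_exp1)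
       (auto simp: L_def log_series_def zero_ereal_def)
  from fps_nth_fps_expansion[OF this, of N]
  have coeff: "(deriv ^^ N) f 0 = fact N * of_nat (num_regular_partitions N t)"
    using fps_nth_exp_log_series[of t N] by (simp add: f_def L_def o_def field_simps)
  have hol: "f holomorphic_on ball 0 1"
    unfolding f_def by (intro holomorphic_intros) (use rad in \<open>auto simp: eball_def\<close>)
  have "((\<lambda>u. f u / (u - 0) ^ Suc N) has_contour_integral (2 * pi * \<i> / fact N * (deriv ^^ N) f 0)) (circlepath 0 r)"
  proof (rule Cauchy_has_contour_integral_higher_derivative_circlepath)
    have sub: "cball 0 r \<subseteq> ball (0::complex) 1" using r by auto
    show "continuous_on (cball 0 r) f"
      by (rule continuous_on_subset[OF holomorphic_on_imp_continuous_on[OF hol] sub])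
    show "f holomorphic_on ball 0 r"
      by (rule holomorphic_on_subset[OF hol order.trans[OF ball_subset_cball sub]])
    show "0 \<in> ball (0::complex) r" using r by simp
  qed
  hence "((\<lambda>u. f u / u ^ Suc N) has_contour_integral (2 * pi * \<i> * of_nat (num_regular_partitions N t)))
      (part_circlepath 0 r 0 (2 * pi))"
    unfolding coeff circlepath_def by (simp add: mult_ac)
  hence "((\<lambda>\<theta>. f (r * cis \<theta>) / (r * cis \<theta>) ^ Suc N * r * \<i> * cis \<theta>) has_integral
     (2 * pi * \<i> * of_nat (num_regular_partitions N t))) {0..2 * pi}"
    by (subst (asm) has_contour_integral_part_circlepath_iff) simp_all
  \<comment> \<open>On the circle \<open>dq\<close> is \<open>\<i> q d\<theta>\<close>, which
    cancels one factor of \<open>q ^ Suc N\<close>; the multiplier then removes \<open>\<i>\<close>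
    and the remaining \<open>r ^ N\<close>.\<close>
  note int = has_integral_mult_right[OF this, of "of_real (r ^ N) / \<i>"]
  have "x / \<i> * (w * \<i> * P) = w * x * P" for x w P :: complex by (simp add: field_simps)
  from this[of "of_real (r ^ N)" "2 * of_real pi"]
  have val: "of_real (r ^ N) / \<i> * (2 * pi * \<i> * P) = of_real (2 * pi * r ^ N) * P" for P
    by (simp only: of_real_mult of_real_numeral)
  have fun_eq: "of_real (r ^ N) / \<i> * (z / (r * cis \<theta>) ^ Suc N * r * \<i> * cis \<theta>) = z * cis (- real N * \<theta>)" for \<theta> z
  proof -
    define c where "c = cis \<theta>"
    have c: "c \<noteq> 0" by (simp add: c_def)
    have "cis (- real N * \<theta>) = inverse (c ^ N)"
      by (simp add: Complex.DeMoivre cis_inverse c_def)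
    moreover have "of_real (r ^ N) / \<i> * (z / (r * c) ^ Suc N * r * \<i> * c) = z * inverse (c ^ N)"
      using r c by (simp add: field_simps power_mult_distrib)
    ultimately show ?thesis by (simp only: c_def)
  qed
  show ?thesis using int unfolding val fun_eq unfolding f_def L_def .
qed

text \<open>Puts the peak \<open>\<theta> = 0\<close> in the middle of the interval; the decay
  estimate is for \<open>\<bar>\<theta>\<bar> \<le> pi\<close>.\<close>

lemma has_integral_period_shift:
  fixes f :: "real \<Rightarrow> complex"
  assumes int: "(f has_integral I) {0..2 * pi}" and per: "\<And>x. f (x + 2 * pi) = f x"
  shows "(f has_integral I) {-pi..pi}"
proof -
  have "f integrable_on {0..2 * pi}" using int by blast
  hence int12: "f integrable_on {0..pi}" "f integrable_on {pi..2 * pi}"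
    by (rule integrable_on_subinterval; simp)+
  then obtain A B where AB: "(f has_integral A) {0..pi}" "(f has_integral B) {pi..2 * pi}" by blast
  have "(f has_integral (A + B)) {0..2 * pi}"
    by (rule has_integral_combine[OF _ _ AB]) auto
  hence I: "I = A + B" using int has_integral_unique by blast
  have "(f has_integral B) {-pi..0}"
    using has_integral_shift_real_ivl[OF AB(2), of "2 * pi"] per by simp
  hence "(f has_integral (B + A)) {-pi..pi}"
    by (rule has_integral_combine[OF _ _ _ AB(1), rotated 2]) auto
  thus ?thesis using I by (simp add: add.commute)
qed

lemma eval_log_series_cis:
  assumes r: "0 < r" "r < 1"
  shows "eval_fps (log_series s 0) (of_real r * cis \<theta>) =
           of_real (log_moment s 0 r + (\<Sum>m. log_coeff s m * r ^ m * (cos (real m * \<theta>) - 1))) +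
           \<i> * of_real (\<Sum>m. log_coeff s m * r ^ m * sin (real m * \<theta>))"
proof -
  define a where "a = (\<lambda>m. log_coeff s m * r ^ m)"
  define z where "z = of_real r * cis \<theta>"
  have "norm z < 1" using r by (simp add: z_def norm_mult)
  hence "(\<lambda>m. fps_nth (log_series s 0) m * z ^ m) sums eval_fps (log_series s 0) z"
    by (intro sums_eval_fps norm_less_conv_radius_log_series)
  also have "(\<lambda>m. fps_nth (log_series s 0) m * z ^ m) = (\<lambda>m. of_real (a m) * cis (real m * \<theta>))"
    by (simp add: log_series_def z_def a_def power_mult_distrib Complex.DeMoivre mult.assoc)
  finally have sums: "(\<lambda>m. of_real (a m) * cis (real m * \<theta>)) sums eval_fps (log_series s 0) z" .
  have re: "(\<lambda>m. a m * cos (real m * \<theta>)) sums Re (eval_fps (log_series s 0) z)"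
    using sums_Re[OF sums] by simp
  have im: "(\<lambda>m. a m * sin (real m * \<theta>)) sums Im (eval_fps (log_series s 0) z)"
    using sums_Im[OF sums] by simp
  have "a sums log_moment s 0 r"
    using log_moment_sums[of r 0 s] r by (simp add: a_def)
  from sums_diff[OF re this]
  have "(\<lambda>m. a m * (cos (real m * \<theta>) - 1)) sums (Re (eval_fps (log_series s 0) z) - log_moment s 0 r)"
    by (simp add: algebra_simps)
  from sums_unique[OF this] sums_unique[OF im] show ?thesis
    unfolding a_def z_def[symmetric] by (simp add: complex_eq_iff)
qed

text \<open>The integral is real, so taking real parts loses nothing. \<open>U\<close> is the drop
  of the logarithm of the modulus below its peak value \<open>log_moment s 0 r\<close>, and
  \<open>V\<close> is the phase.\<close>

lemma num_regular_partitions_real_integral: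
  fixes r :: real and N t :: nat
  defines "s \<equiv> t + 1"
  defines "U \<equiv> (\<lambda>\<theta>. \<Sum>m. log_coeff s m * r ^ m * (cos (real m * \<theta>) - 1))"
    and "V \<equiv> (\<lambda>\<theta>. (\<Sum>m. log_coeff s m * r ^ m * sin (real m * \<theta>)) - real N * \<theta>)"
  assumes r: "0 < r" "r < 1"
  shows "((\<lambda>\<theta>. exp (U \<theta>) * cos (V \<theta>)) has_integral
           2 * pi * r ^ N * real (num_regular_partitions N t) * exp (- log_moment s 0 r)) {-pi..pi}"
proof -
  define f where "f = (\<lambda>\<theta>. exp (eval_fps (log_series s 0) (of_real r * cis \<theta>)) * cis (- real N * \<theta>))"
  define M where "M = log_moment s 0 r"
  have per: "f (\<theta> + 2 * pi) = f \<theta>" for \<theta>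
  proof -
    have "cis (\<theta> + 2 * pi) = cis \<theta>" by (simp flip: cis_mult)
    moreover have "cis (- real N * (\<theta> + 2 * pi)) = cis (- real N * \<theta>) * cis (- (2 * pi * real N))"
      by (simp add: cis_mult algebra_simps)
    moreover have "cis (- (2 * pi * real N)) = 1"
      using cis_multiple_2pi[of "- real N"] by simp
    ultimately show ?thesis by (simp add: f_def)
  qed
  have "(f has_integral of_real (2 * pi * r ^ N) * of_nat (num_regular_partitions N t)) {0..2 * pi}"
    unfolding f_def s_def by (rule num_regular_partitions_integral[OF r])
  from has_integral_Re[OF has_integral_period_shift[OF this per]]
  have "((\<lambda>\<theta>. Re (f \<theta>)) has_integral (2 * pi * r ^ N * real (num_regular_partitions N t))) {-pi..pi}"
    by simp
  from has_integral_mult_left[OF this, of "exp (- M)"]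
  have int: "((\<lambda>\<theta>. Re (f \<theta>) * exp (- M)) has_integral (2 * pi * r ^ N * real (num_regular_partitions N t) * exp (- M))) {-pi..pi}" .
  have "Re (f \<theta>) * exp (- M) = exp (U \<theta>) * cos (V \<theta>)" for \<theta>
  proof -
    define S where "S = (\<Sum>m. log_coeff s m * r ^ m * sin (real m * \<theta>))"
    have "eval_fps (log_series s 0) (of_real r * cis \<theta>) = of_real (M + U \<theta>) + \<i> * of_real S"
      unfolding eval_log_series_cis[OF r] M_def U_def S_def ..
    hence "f \<theta> = of_real (exp (M + U \<theta>)) * cis (S - real N * \<theta>)"
      by (simp only: f_def exp_add cis_conv_exp[symmetric] exp_of_real mult.assoc cis_mult) simp
    hence "Re (f \<theta>) = exp M * exp (U \<theta>) * cos (V \<theta>)" by (simp add: V_def S_def exp_add)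
    thus ?thesis by (simp add: exp_minus)
  qed
  with int show ?thesis by (simp add: M_def)
qed

section \<open>Decay on the circle\<close>

lemma one_minus_cos_eq: "1 - cos x = 2 * (sin (x / 2))\<^sup>2" for x :: real
  using cos_double_sin[of "x / 2"] by simp

text \<open>In terms of half angles: the addition formula for \<open>sin (p + q)\<close> together
  with \<open>(u + v)\<^sup>2 \<le> 2 * u\<^sup>2 + 2 * v\<^sup>2\<close>.\<close>

lemma one_minus_cos_add_le: "1 - cos (a + b) \<le> 2 * (1 - cos a) + 2 * (1 - cos b)" for a b :: real
proof -
  define p q where "p = a / 2" and "q = b / 2"
  have "(sin (p + q))\<^sup>2 \<le> 2 * (sin p * cos q)\<^sup>2 + 2 * (cos p * sin q)\<^sup>2"
    using sum_squares_bound[of "sin p * cos q" "cos p * sin q"]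
    by (simp add: sin_add power2_sum)
  also have "\<dots> \<le> 2 * (sin p)\<^sup>2 + 2 * (sin q)\<^sup>2"
  proof -
    have "(cos x)\<^sup>2 \<le> 1" for x :: real by (simp add: abs_square_le_1)
    hence "(sin p)\<^sup>2 * (cos q)\<^sup>2 \<le> (sin p)\<^sup>2 * 1" "(cos p)\<^sup>2 * (sin q)\<^sup>2 \<le> 1 * (sin q)\<^sup>2"
      by (intro mult_left_mono mult_right_mono; simp)+
    thus ?thesis by (simp add: power_mult_distrib)
  qed
  finally show ?thesis
    unfolding one_minus_cos_eq p_def q_def by (simp add: add_divide_distrib)
qed

text \<open>Taylor gives \<open>x\<^sup>2 / 2 - x ^ 4 / 24\<close>, and
  \<open>x\<^sup>2 \<le> 10\<close> on this range; 1/2 - 10/24 is the 1/12.\<close>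

lemma one_minus_cos_ge:
  fixes x :: real
  assumes "\<bar>x\<bar> \<le> pi"
  shows "x\<^sup>2 / 12 \<le> 1 - cos x"
proof -
  obtain t where t: "cos x = (\<Sum>m<4. cos_coeff m * x ^ m) + (cos (t + 1/2 * real 4 * pi) / fact 4) * x ^ 4"
    using Maclaurin_cos_expansion[of x 4] by auto
  have "{..<4::nat} = {0, 1, 2, 3}" by auto
  hence "(\<Sum>m<4. cos_coeff m * x ^ m) = 1 - x\<^sup>2 / 2" by (simp add: cos_coeff_def)
  moreover have "cos (t + 1/2 * real 4 * pi) / fact 4 * x ^ 4 \<le> 1 / 24 * x ^ 4"
    by (intro mult_right_mono) (simp_all add: fact_numeral)
  moreover have "x ^ 4 \<le> 10 * x\<^sup>2"
  proof -
    have "\<bar>x\<bar> \<le> 3.15" using assms pi_approx by simp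
    hence "\<bar>x\<bar>\<^sup>2 \<le> 3.15\<^sup>2" by (intro power_mono) auto
    hence "x\<^sup>2 \<le> 10" by (simp add: power2_eq_square)
    hence "x\<^sup>2 * x\<^sup>2 \<le> 10 * x\<^sup>2" by (intro mult_right_mono) auto
    thus ?thesis by (simp add: power4_eq_xxxx power2_eq_square mult.assoc)
  qed
  ultimately show ?thesis using t by linarith
qed

lemma cos_taylor_bounds:
  fixes x :: real
  shows "\<bar>cos x - 1 + x\<^sup>2 / 2\<bar> \<le> x ^ 4 / 24" "1 - cos x \<le> x\<^sup>2 / 2" "\<bar>sin x - x\<bar> \<le> \<bar>x\<bar> ^ 3 / 6"
proof -
  obtain t where t: "cos x = (\<Sum>m<4. cos_coeff m * x ^ m) + (cos (t + 1/2 * real 4 * pi) / fact 4) * x ^ 4"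
    using Maclaurin_cos_expansion[of x 4] by auto
  have "{..<4::nat} = {0, 1, 2, 3}" by auto
  hence "(\<Sum>m<4. cos_coeff m * x ^ m) = 1 - x\<^sup>2 / 2" by (simp add: cos_coeff_def)
  with t have "\<bar>cos x - 1 + x\<^sup>2 / 2\<bar> = \<bar>cos (t + 1/2 * real 4 * pi)\<bar> / 24 * x ^ 4"
    by (simp add: abs_mult fact_numeral)
  also have "\<dots> \<le> 1 / 24 * x ^ 4" by (intro mult_right_mono divide_right_mono) auto
  finally show "\<bar>cos x - 1 + x\<^sup>2 / 2\<bar> \<le> x ^ 4 / 24" by simp
  have "(sin (x / 2))\<^sup>2 \<le> (x / 2)\<^sup>2" using abs_sin_x_le_abs_x[of "x / 2"] by (simp only: abs_le_square_iff)
  thus "1 - cos x \<le> x\<^sup>2 / 2" unfolding one_minus_cos_eq by (simp add: power_divide)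
  have "{..<3::nat} = {0, 1, 2}" by auto
  hence "(\<Sum>m<3. sin_coeff m * x ^ m) = x" by (simp add: sin_coeff_def)
  with Maclaurin_sin_bound[of x 3] show "\<bar>sin x - x\<bar> \<le> \<bar>x\<bar> ^ 3 / 6"
    by (simp add: fact_numeral field_simps)
qed

lemma geometric_cos_sums:
  fixes r \<theta> :: real
  assumes r: "0 < r" "r < 1"
  defines "x \<equiv> 1 - cos \<theta>"
  shows "(\<lambda>m. r ^ m * (1 - cos (real m * \<theta>))) sums
           (r * (1 + r) * x / ((1 - r) * ((1 - r)\<^sup>2 + 2 * r * x)))"
proof -
  define z where "z = of_real r * cis \<theta>"
  \<comment> \<open>This is the square of the modulus of \<open>1 - z\<close>.\<close>
  define Q where "Q = (1 - r)\<^sup>2 + 2 * r * x"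
  have x: "x \<ge> 0" by (simp add: x_def)
  have Q: "Q > 0" unfolding Q_def using r x by (intro add_pos_nonneg) auto
  have nz: "norm z < 1" using r by (simp add: z_def norm_mult)
  have "(\<lambda>m. z ^ m) sums (1 / (1 - z))" by (rule geometric_sums[OF nz])
  from sums_Re[OF this] have "(\<lambda>m. r ^ m * cos (real m * \<theta>)) sums Re (1 / (1 - z))"
    by (simp add: z_def power_mult_distrib Complex.DeMoivre)
  moreover have "(\<lambda>m. r ^ m) sums (1 / (1 - r))" using r by (intro geometric_sums) auto
  ultimately have "(\<lambda>m. r ^ m - r ^ m * cos (real m * \<theta>)) sums (1 / (1 - r) - Re (1 / (1 - z)))"
    by (intro sums_diff)
  moreover have "Re (1 / (1 - z)) = (1 - r * cos \<theta>) / Q"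
  proof -
    have "(1 - r * c)\<^sup>2 + (r * s)\<^sup>2 = 1 - 2 * r * c + r\<^sup>2 * (s\<^sup>2 + c\<^sup>2)" for c s
      by (simp add: power2_eq_square algebra_simps)
    hence "(1 - r * cos \<theta>)\<^sup>2 + (r * sin \<theta>)\<^sup>2 = 1 - 2 * r * cos \<theta> + r\<^sup>2 * ((sin \<theta>)\<^sup>2 + (cos \<theta>)\<^sup>2)" .
    also have "\<dots> = Q" unfolding Q_def x_def sin_cos_squared_add
      by (simp add: power2_eq_square algebra_simps)
    finally show ?thesis by (simp add: z_def Re_divide)
  qed
  moreover have "1 / (1 - r) - (1 - r * cos \<theta>) / Q = r * (1 + r) * x / ((1 - r) * Q)"
  proof -
    have "1 / (1 - r) - (1 - r * cos \<theta>) / Q = (Q - (1 - r * cos \<theta>) * (1 - r)) / ((1 - r) * Q)"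
      using Q r by (simp add: diff_frac_eq)
    also have "Q - (1 - r * cos \<theta>) * (1 - r) = r * (1 + r) * x"
      unfolding Q_def x_def by (simp add: power2_eq_square algebra_simps)
    finally show ?thesis .
  qed
  ultimately show ?thesis by (simp add: Q_def right_diff_distrib)
qed

lemma geometric_multiples_sums:
  fixes r :: real
  assumes "0 < r" "r < 1" and s: "s > 0"
  shows "(\<lambda>m. if s dvd Suc m then r ^ Suc m else 0) sums (r ^ s / (1 - r ^ s))"
proof -
  define g where "g = (\<lambda>j. s * Suc j - 1)"
  have Sg: "Suc (g j) = s * Suc j" for j using s by (simp add: g_def)
  have "g i < g j" if "i < j" for i j
  proof -
    have "Suc (g i) < Suc (g j)" unfolding Sg using that s by simp
    thus ?thesis by simp
  qed
  hence mono: "strict_mono g" by (simp add: strict_mono_def)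
  have rs: "0 < r ^ s" "r ^ s < 1" using assms by (simp_all add: power_less_one_iff)
  have "(\<lambda>j. r ^ s * (r ^ s) ^ j) sums (r ^ s * (1 / (1 - r ^ s)))"
    using rs by (intro sums_mult geometric_sums) auto
  also have "(\<lambda>j. r ^ s * (r ^ s) ^ j) = (\<lambda>j. if s dvd Suc (g j) then r ^ Suc (g j) else 0)"
    unfolding Sg power_mult by auto
  finally have sums: "(\<lambda>j. if s dvd Suc (g j) then r ^ Suc (g j) else 0) sums (r ^ s / (1 - r ^ s))" by simp
  have "(if s dvd Suc n then r ^ Suc n else 0) = 0" if n: "n \<notin> range g" for n
  proof -
    have "\<not> s dvd Suc n"
    proof
      assume "s dvd Suc n"
      then obtain k where k: "Suc n = s * k" by (elim dvdE)
      then obtain j where j: "k = Suc j" by (cases k) auto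
      hence "Suc n = Suc (g j)" unfolding Sg using k by simp
      with n show False by auto
    qed
    thus ?thesis by simp
  qed
  from sums_mono_reindex[where f = "\<lambda>m. if s dvd Suc m then r ^ Suc m else 0", OF mono this] sums
  show ?thesis by blast
qed

lemma divide_le_divide_cross:
  fixes a b c d :: real
  assumes "a * d \<le> c * b" "b > 0" "d > 0"
  shows "a / b \<le> c / d"
  using assms by (simp add: field_simps)

text \<open>None of \<open>1, r, ..., r ^ (s - 1)\<close> is smaller than the last, so their sum is
  at least \<open>s * r ^ (s - 1)\<close>. The factor \<open>1 / s\<close> gained over the whole
  geometric series is what makes a large \<open>s\<close> helpful.\<close>

lemma power_div_one_minus_power_le:
  fixes r :: real
  assumes r: "0 < r" "r < 1" and s: "s > 0"
  shows "r ^ s / (1 - r ^ s) \<le> r / (real s * (1 - r))"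
proof -
  have rs: "r ^ s < 1" using assms by (simp add: power_less_one_iff)
  have "real s * r ^ (s - 1) = (\<Sum>i<s. r ^ (s - 1))" by simp
  also have "\<dots> \<le> (\<Sum>i<s. r ^ i)" using r by (intro sum_mono power_decreasing) auto
  finally have "r * (1 - r) * (real s * r ^ (s - 1)) \<le> r * (1 - r) * (\<Sum>i<s. r ^ i)"
    using r by (intro mult_left_mono) auto
  also have "\<dots> = r * (1 - r ^ s)" using one_diff_power_eq[of r s] by simp
  also have "r * (1 - r) * (real s * r ^ (s - 1)) = r ^ s * (real s * (1 - r))"
    using s by (cases s) (simp_all add: mult_ac)
  finally show ?thesis using r rs s by (intro divide_le_divide_cross) simp_all
qed

text \<open>If \<open>s\<close> divides \<open>m\<close>, then it does not divide \<open>m - 1\<close>; so by \<open>one_minus_cos_add_le\<close> the terms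
  at multiples of \<open>s\<close> are controlled by the others, up to an error that \<open>s \<ge> 5\<close> makes harmless.\<close>
lemma nonmultiples_cos_sum_ge:
  fixes r \<theta> :: real and s :: nat
  assumes r: "0 < r" "r < 1" and s: "s \<ge> 5"
  defines "x \<equiv> 1 - cos \<theta>"
  shows "r * (1 + r) * x / ((1 - r) * ((1 - r)\<^sup>2 + 2 * r * x)) / 15
           \<le> (\<Sum>m. if s dvd m then 0 else r ^ m * (1 - cos (real m * \<theta>)))"
proof -
  define b where "b = (\<lambda>m. r ^ m * (1 - cos (real m * \<theta>)))"
  define u where "u = (\<lambda>m. if s dvd m then 0 else b m)"
  define w where "w = (\<lambda>m. if s dvd m then b m else 0)"
  define D where "D = r * (1 + r) * x / ((1 - r) * ((1 - r)\<^sup>2 + 2 * r * x))"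
  have x: "0 \<le> x" "x \<le> 2" by (auto simp: x_def)
  have b_nonneg: "b m \<ge> 0" for m using r by (simp add: b_def)
  have D: "b sums D" unfolding b_def D_def x_def by (rule geometric_cos_sums[OF r])
  have "summable u" "summable w"
    by (rule summable_comparison_test'[OF sums_summable[OF D], of 0]; use b_nonneg in \<open>simp add: u_def w_def\<close>)+
  have "w 0 = 0" by (simp add: w_def b_def)
  define e where "e = (\<lambda>m. if s dvd Suc m then r ^ Suc m else 0)"
  have e: "e sums (r ^ s / (1 - r ^ s))" unfolding e_def using r s by (intro geometric_multiples_sums) auto
  have le: "w (Suc m) \<le> 2 * u m + 2 * x * e m" for m
  proof (cases "s dvd Suc m")
    case True
    have "\<not> s dvd m"
    proof
      assume "s dvd m"
      with True have "s dvd Suc m - m" by (intro dvd_diff_nat)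
      thus False using s by simp
    qed
    hence u: "u m = r ^ m * (1 - cos (real m * \<theta>))" by (simp add: u_def b_def)
    have "w (Suc m) = r ^ Suc m * (1 - cos (real m * \<theta> + \<theta>))"
      using True by (simp add: w_def b_def distrib_right add.commute)
    also have "\<dots> \<le> r ^ Suc m * (2 * (1 - cos (real m * \<theta>)) + 2 * x)"
      unfolding x_def using r by (intro mult_left_mono one_minus_cos_add_le) auto
    also have "\<dots> = r * (2 * u m) + 2 * x * e m"
      using True by (simp add: u e_def algebra_simps)
    also have "r * (2 * u m) \<le> 1 * (2 * u m)"
      using r b_nonneg[of m] by (intro mult_right_mono) (simp_all add: u_def)
    finally show ?thesis by simp
  next
    case False
    thus ?thesis using x r b_nonneg[of m] by (simp add: w_def e_def u_def)
  qed
  have "D = suminf u + suminf w"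
  proof -
    have "(\<lambda>m. u m + w m) sums (suminf u + suminf w)"
      using \<open>summable u\<close> \<open>summable w\<close> by (intro sums_add summable_sums)
    moreover have "(\<lambda>m. u m + w m) = b" by (auto simp: u_def w_def)
    ultimately show ?thesis using D sums_unique2 by metis
  qed
  moreover have "suminf w \<le> 2 * suminf u + 2 * x * (r ^ s / (1 - r ^ s))"
  proof (rule sums_le[OF le])
    show "(\<lambda>m. w (Suc m)) sums suminf w"
      using summable_sums[OF \<open>summable w\<close>] \<open>w 0 = 0\<close> by (subst sums_Suc_iff) simp
    show "(\<lambda>m. 2 * u m + 2 * x * e m) sums (2 * suminf u + 2 * x * (r ^ s / (1 - r ^ s)))"
      by (rule sums_add[OF sums_mult[OF summable_sums[OF \<open>summable u\<close>]] sums_mult[OF e]])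
  qed
  \<comment> \<open>The proportion is \<open>4 / s\<close>, bounded by 4/5; being less than 1, it
    can be absorbed into the left-hand side.\<close>
  moreover have "2 * x * (r ^ s / (1 - r ^ s)) \<le> 4 / 5 * D"
  proof -
    have "r ^ s / (1 - r ^ s) \<le> r / (real s * (1 - r))"
      using r s by (intro power_div_one_minus_power_le) auto
    also have "\<dots> \<le> r / (5 * (1 - r))"
      using r s by (intro divide_left_mono mult_right_mono mult_pos_pos) auto
    finally have "2 * x * (r ^ s / (1 - r ^ s)) \<le> 2 * x * (r / (5 * (1 - r)))"
      using x by (intro mult_left_mono) auto
    also have "\<dots> = 4 / 5 * (x * r / (1 - r) * (1 / 2))"
    proof -
      have "2 * x * (r / (5 * d)) = 4 / 5 * (x * r / d * (1 / 2))" for d by simp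
      thus ?thesis .
    qed
    also have "\<dots> \<le> 4 / 5 * (x * r / (1 - r) * ((1 + r) / ((1 - r)\<^sup>2 + 2 * r * x)))"
    proof (intro mult_left_mono)
      have Q: "(1 - r)\<^sup>2 + 2 * r * x > 0" using r x by (intro add_pos_nonneg) auto
      \<comment> \<open>As \<open>x \<le> 2\<close>, the denominator is at most its value
        \<open>(1 + r)\<^sup>2\<close> at \<open>\<theta> = pi\<close>.\<close>
      have "2 * r * x \<le> 2 * r * 2" using r x by (intro mult_left_mono) auto
      hence "(1 - r)\<^sup>2 + 2 * r * x \<le> (1 + r) * (1 + r)" by (simp add: power2_eq_square algebra_simps)
      also have "\<dots> \<le> (1 + r) * 2" using r by (intro mult_left_mono) auto
      finally show "1 / 2 \<le> (1 + r) / ((1 - r)\<^sup>2 + 2 * r * x)" using Q by (simp add: le_divide_eq)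
    qed (use r x in auto)
    also have "x * r / (1 - r) * ((1 + r) / ((1 - r)\<^sup>2 + 2 * r * x)) = D"
      unfolding D_def by (simp add: mult_ac)
    finally show ?thesis .
  qed
  \<comment> \<open>With \<open>D = suminf u + suminf w\<close> and the bound for
    \<open>suminf w\<close> one has \<open>D \<le> 3 * suminf u + 4 / 5 * D\<close>, whence the
    15.\<close>
  ultimately have "D / 15 \<le> suminf u" by linarith
  thus ?thesis unfolding D_def u_def b_def .
qed

lemma log_coeff_ge_1:
  assumes "\<not> s dvd m" "m > 0"
  shows "log_coeff s m \<ge> 1"
proof -
  have "finite {d. d dvd m \<and> \<not> s dvd d}" using assms by (intro finite_subset[OF _ finite_divisors_nat[of m]]) auto
  hence "m \<le> (\<Sum>d | d dvd m \<and> \<not> s dvd d. d)"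
    using assms by (intro member_le_sum) auto
  hence "real m \<le> real (regular_divisor_sum s m)" by (simp only: regular_divisor_sum_def of_nat_le_iff)
  thus ?thesis using assms by (simp add: log_coeff_def)
qed

lemma summable_log_coeff_cos:
  assumes "0 \<le> r" "r < 1"
  shows "summable (\<lambda>m. log_coeff s m * r ^ m * (cos (real m * \<theta>) - 1))"
proof (rule summable_comparison_test'[of "\<lambda>m. 2 * (log_coeff s m * r ^ m)" 0])
  show "summable (\<lambda>m. 2 * (log_coeff s m * r ^ m))"
    using summable_log_moment[OF assms, of 0 s] by (intro summable_mult) simp
  fix m
  have "\<bar>cos (real m * \<theta>) - 1\<bar> \<le> 2"
    using cos_ge_minus_one[of "real m * \<theta>"] cos_le_one[of "real m * \<theta>"] by linarith
  hence "log_coeff s m * r ^ m * \<bar>cos (real m * \<theta>) - 1\<bar> \<le> log_coeff s m * r ^ m * 2"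
    using assms by (intro mult_left_mono) auto
  thus "norm (log_coeff s m * r ^ m * (cos (real m * \<theta>) - 1)) \<le> 2 * (log_coeff s m * r ^ m)"
    using assms by (simp add: abs_mult)
qed

text \<open>1440 is 15 * 12 * 8: 15 from \<open>nonmultiples_cos_sum_ge\<close>, 12 from
  \<open>one_minus_cos_ge\<close>, and \<open>8 * pi ^ 3\<close> from
  \<open>1 - r \<le> 2 * pi * y\<close>, used once linearly and once squared. The exponential is a
  lower bound for \<open>r\<close> when \<open>y \<le> 1\<close>.\<close>

definition decay_const :: real where
  "decay_const = exp (- 2 * pi) / (1440 * pi ^ 3)"

lemma decay_const_pos: "decay_const > 0"
  by (simp add: decay_const_def)

text \<open>All terms are nonpositive. Those at multiples of \<open>s\<close> are dropped and the
  other coefficients are lowered to 1, which leaves the sum estimated in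
  \<open>nonmultiples_cos_sum_ge\<close>.\<close>

lemma log_coeff_cos_sum_le:
  fixes y \<theta> :: real and s :: nat
  assumes y: "0 < y" "y \<le> 1" and s: "s \<ge> 5" and \<theta>: "\<bar>\<theta>\<bar> \<le> pi"
  defines "r \<equiv> exp (- 2 * pi * y)"
  shows "(\<Sum>m. log_coeff s m * r ^ m * (cos (real m * \<theta>) - 1)) \<le> - (decay_const * \<theta>\<^sup>2 / (y * (y\<^sup>2 + \<theta>\<^sup>2)))"
proof -
  have r: "0 < r" "r < 1" using y by (auto simp: r_def)
  define x where "x = 1 - cos \<theta>"
  define a where "a = \<theta>\<^sup>2 / 12"
  have x: "x \<ge> a" "a \<ge> 0" using one_minus_cos_ge[OF \<theta>] by (auto simp: x_def a_def)
  let ?u = "\<lambda>m. if s dvd m then 0 else r ^ m * (1 - cos (real m * \<theta>))"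
  have "summable ?u"
    by (rule summable_comparison_test'[OF sums_summable[OF geometric_cos_sums[OF r, of \<theta>]], of 0])
       (use r in simp)
  moreover have "summable (\<lambda>m. - (log_coeff s m * r ^ m * (cos (real m * \<theta>) - 1)))"
    using r by (intro summable_minus summable_log_coeff_cos) auto
  moreover have "?u m \<le> - (log_coeff s m * r ^ m * (cos (real m * \<theta>) - 1))" for m
  proof -
    have "(if s dvd m then 0 else 1) * (r ^ m * (1 - cos (real m * \<theta>))) \<le> log_coeff s m * (r ^ m * (1 - cos (real m * \<theta>)))"
      using r log_coeff_ge_1[of s m] by (intro mult_right_mono) (auto intro!: Nat.gr0I)
    thus ?thesis by (simp add: algebra_simps split: if_splits)
  qed
  ultimately have "(\<Sum>m. ?u m) \<le> (\<Sum>m. - (log_coeff s m * r ^ m * (cos (real m * \<theta>) - 1)))"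
    by (intro suminf_le) auto
  also have "\<dots> = - (\<Sum>m. log_coeff s m * r ^ m * (cos (real m * \<theta>) - 1))"
    using r by (intro suminf_minus summable_log_coeff_cos) auto
  finally have le: "r * (1 + r) * x / ((1 - r) * ((1 - r)\<^sup>2 + 2 * r * x)) / 15
      \<le> - (\<Sum>m. log_coeff s m * r ^ m * (cos (real m * \<theta>) - 1))"
    using nonmultiples_cos_sum_ge[OF r s, of \<theta>] unfolding x_def by linarith
  have "1 - r \<le> 2 * pi * y"
    unfolding r_def using exp_ge_add_one_self[of "- 2 * pi * y"] by simp
  hence r': "0 < 1 - r" "1 - r \<le> 2 * pi * y" using r by auto
  have Q: "0 < (1 - r)\<^sup>2 + 2 * r * a" "0 < (1 - r)\<^sup>2 + 2 * r * x"
    using r x by (intro add_pos_nonneg; simp)+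
  have "exp (- 2 * pi) \<le> r" using y by (simp add: r_def)
  have "15 * (decay_const * \<theta>\<^sup>2 / (y * (y\<^sup>2 + \<theta>\<^sup>2))) = (exp (- 2 * pi) * a) / ((2 * pi * y) * (4 * pi\<^sup>2 * (y\<^sup>2 + \<theta>\<^sup>2)))"
  proof -
    have "15 * (e / (1440 * pi ^ 3) * T / (y * z)) = (e * (T / 12)) / ((2 * pi * y) * (4 * pi\<^sup>2 * z))" for e T z :: real
      by (simp add: power2_eq_square power3_eq_cube mult_ac)
    thus ?thesis unfolding decay_const_def a_def .
  qed
  also have "\<dots> \<le> (r * (1 + r) * a) / ((1 - r) * ((1 - r)\<^sup>2 + 2 * r * a))"
  proof (rule frac_le)
    have "r * 1 \<le> r * (1 + r)" using r by (intro mult_left_mono) auto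
    hence "exp (- 2 * pi) \<le> r * (1 + r)" using \<open>exp (- 2 * pi) \<le> r\<close> by simp
    thus "exp (- 2 * pi) * a \<le> r * (1 + r) * a" using x by (intro mult_right_mono) auto
    have "(1 - r)\<^sup>2 \<le> (2 * pi * y)\<^sup>2" using r' by (intro power_mono) auto
    moreover have "2 * r * a \<le> 2 * 1 * a" using r x by (intro mult_right_mono mult_left_mono) auto
    moreover have "2 * 1 * a \<le> 4 * pi\<^sup>2 * \<theta>\<^sup>2"
    proof -
      have "(1::real) \<le> pi" using pi_gt3 by linarith
      hence "(1::real) \<le> pi\<^sup>2" by (simp add: one_le_power)
      hence "1 / 6 \<le> 4 * pi\<^sup>2" by linarith
      hence "1 / 6 * \<theta>\<^sup>2 \<le> 4 * pi\<^sup>2 * \<theta>\<^sup>2" by (intro mult_right_mono) auto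
      thus ?thesis by (simp add: a_def)
    qed
    ultimately have "(1 - r)\<^sup>2 + 2 * r * a \<le> 4 * pi\<^sup>2 * (y\<^sup>2 + \<theta>\<^sup>2)"
      by (simp add: power_mult_distrib distrib_left)
    thus "(1 - r) * ((1 - r)\<^sup>2 + 2 * r * a) \<le> (2 * pi * y) * (4 * pi\<^sup>2 * (y\<^sup>2 + \<theta>\<^sup>2))"
      using r' Q y by (intro mult_mono) auto
    show "0 < (1 - r) * ((1 - r)\<^sup>2 + 2 * r * a)" using r' Q by simp
    show "0 \<le> r * (1 + r) * a" using r x by simp
  qed
  \<comment> \<open>The quotient increases with \<open>x\<close>, so its value at the lower bound
    \<open>a\<close> is admissible.\<close>
  also have "\<dots> \<le> (r * (1 + r) * x) / ((1 - r) * ((1 - r)\<^sup>2 + 2 * r * x))"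
  proof -
    have "a * ((1 - r)\<^sup>2 + 2 * r * x) \<le> x * ((1 - r)\<^sup>2 + 2 * r * a)"
      using mult_right_mono[OF x(1), of "(1 - r)\<^sup>2"] by (simp add: algebra_simps)
    hence "a / ((1 - r)\<^sup>2 + 2 * r * a) \<le> x / ((1 - r)\<^sup>2 + 2 * r * x)"
      using Q by (intro divide_le_divide_cross)
    hence "r * (1 + r) / (1 - r) * (a / ((1 - r)\<^sup>2 + 2 * r * a)) \<le> r * (1 + r) / (1 - r) * (x / ((1 - r)\<^sup>2 + 2 * r * x))"
      using r by (intro mult_left_mono) auto
    thus ?thesis by (simp only: times_divide_times_eq)
  qed
  finally have "15 * (decay_const * \<theta>\<^sup>2 / (y * (y\<^sup>2 + \<theta>\<^sup>2))) \<le>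
      (r * (1 + r) * x) / ((1 - r) * ((1 - r)\<^sup>2 + 2 * r * x))" .
  moreover have "c \<le> - a" if "15 * a \<le> b" "b / 15 \<le> - c" for a b c :: real
    using that by linarith
  ultimately show ?thesis using le by blast
qed

section \<open>Upper bounds for the moments\<close>

lemma power_exp_neg_le:
  fixes x :: real
  assumes "x \<ge> 0"
  shows "x ^ k * exp (- x) \<le> fact k"
proof -
  have "(\<Sum>n\<in>{k}. x ^ n /\<^sub>R fact n) \<le> (\<Sum>n. x ^ n /\<^sub>R fact n)"
    using assms summable_exp_generic[of x] by (intro sum_le_suminf) auto
  hence "x ^ k / fact k \<le> exp x" by (simp add: exp_def divide_inverse mult.commute)
  thus ?thesis by (simp add: exp_minus field_simps)
qed

text \<open>Half of the exponential decay is spent on the extra factor \<open>m ^ k\<close>. What is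
  left is the first moment at \<open>y / 2\<close>, bounded independently of \<open>s\<close> by the
  full divisor sum; \<open>6 * y\<^sup>2\<close> is \<open>24 * (y / 2)\<^sup>2\<close>.\<close>

lemma log_moment_le:
  assumes y: "y > 0" and s: "s > 0"
  shows "log_moment s (Suc k) (exp (- 2 * pi * y)) \<le> fact k / (pi * y) ^ k / (6 * y\<^sup>2)"
proof -
  define r where "r = exp (- 2 * pi * (y / 2))"
  have r: "0 < r" "r < 1" using y by (auto simp: r_def)
  have rr: "exp (- 2 * pi * y) = r * r" by (simp add: r_def flip: exp_add)
  have "log_moment s (Suc k) (exp (- 2 * pi * y)) \<le> fact k / (pi * y) ^ k * log_moment s 1 r"
  proof (rule sums_le)
    show "(\<lambda>m. real m ^ Suc k * log_coeff s m * exp (- 2 * pi * y) ^ m) sums log_moment s (Suc k) (exp (- 2 * pi * y))"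
      using y by (intro log_moment_sums) auto
    show "(\<lambda>m. fact k / (pi * y) ^ k * (real m ^ 1 * log_coeff s m * r ^ m)) sums (fact k / (pi * y) ^ k * log_moment s 1 r)"
      using r by (intro sums_mult log_moment_sums) auto
    fix m :: nat
    have "(pi * y * real m) ^ k * exp (- (pi * y * real m)) \<le> fact k"
      using y by (intro power_exp_neg_le) auto
    moreover have "exp (- (pi * y * real m)) = r ^ m"
      unfolding r_def by (simp add: mult_ac flip: exp_of_nat_mult)
    ultimately have "(pi * y) ^ k * (real m ^ k * r ^ m) \<le> fact k"
      by (simp add: power_mult_distrib mult.assoc)
    hence "real m ^ k * r ^ m \<le> fact k / (pi * y) ^ k"
      using y by (simp add: le_divide_eq mult.commute)
    hence "(real m ^ k * r ^ m) * (real m ^ 1 * log_coeff s m * r ^ m) \<le> fact k / (pi * y) ^ k * (real m ^ 1 * log_coeff s m * r ^ m)"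
      using r by (intro mult_right_mono) auto
    thus "real m ^ Suc k * log_coeff s m * exp (- 2 * pi * y) ^ m \<le> fact k / (pi * y) ^ k * (real m ^ 1 * log_coeff s m * r ^ m)"
      unfolding rr power_mult_distrib by (simp add: mult_ac)
  qed
  also have "\<dots> \<le> fact k / (pi * y) ^ k * (1 / (6 * y\<^sup>2))"
  proof (rule mult_left_mono)
    have "log_moment s 1 r \<le> log_moment 0 1 r"
      unfolding r_def using y s by (intro log_moment_le_full) auto
    also have "\<dots> \<le> 1 / (24 * (y / 2)\<^sup>2)" unfolding r_def using y by (intro log_moment_1_le) auto
    also have "\<dots> = 1 / (6 * y\<^sup>2)" by (simp add: power_divide)
    finally show "log_moment s 1 r \<le> 1 / (6 * y\<^sup>2)" .
  qed (use y in auto)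
  finally show ?thesis by simp
qed

section \<open>Laplace's method\<close>

text \<open>Moments of the normal distribution of variance \<open>1 / (2 * a)\<close>, with the
  normalising factor removed.\<close>

lemma gaussian_moment_has_integral:
  assumes a: "a > 0"
  shows "((\<lambda>x. x ^ (2 * k) * exp (- a * x\<^sup>2)) has_integral
           (sqrt (pi / a) * (fact (2 * k) / ((4 * a) ^ k * fact k)))) UNIV"
proof -
  define \<sigma> where "\<sigma> = sqrt (1 / (2 * a))"
  have \<sigma>: "\<sigma> > 0" "\<sigma>\<^sup>2 = 1 / (2 * a)" using a by (auto simp: \<sigma>_def)
  have dens: "normal_density 0 \<sigma> x = exp (- a * x\<^sup>2) / sqrt (pi / a)" for x
  proof -
    have e: "2 * pi * (1 / (2 * a)) = pi / a" "- (x - 0)\<^sup>2 / (2 * (1 / (2 * a))) = - a * x\<^sup>2" by simp_all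
    show ?thesis unfolding normal_density_def \<sigma>(2) e by simp
  qed
  have \<sigma>': "2 / \<sigma>\<^sup>2 = 4 * a" unfolding \<sigma>(2) by simp
  have "has_bochner_integral lborel (\<lambda>x. normal_density 0 \<sigma> x * x ^ (2 * k)) (fact (2 * k) / ((4 * a) ^ k * fact k))"
    using normal_moment_even[OF \<sigma>(1), of 0 k] unfolding \<sigma>' diff_0_right .
  hence "integrable lborel (\<lambda>x. normal_density 0 \<sigma> x * x ^ (2 * k))"
    and int: "(LINT x|lborel. normal_density 0 \<sigma> x * x ^ (2 * k)) = fact (2 * k) / ((4 * a) ^ k * fact k)"
    by (auto simp: has_bochner_integral_iff)
  from has_integral_integral_lborel[OF this(1)]
  have "((\<lambda>x. normal_density 0 \<sigma> x * x ^ (2 * k)) has_integral (fact (2 * k) / ((4 * a) ^ k * fact k))) UNIV"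
    unfolding int .
  from has_integral_mult_right[OF this, of "sqrt (pi / a)"]
  have "((\<lambda>x. sqrt (pi / a) * (normal_density 0 \<sigma> x * x ^ (2 * k))) has_integral
           (sqrt (pi / a) * (fact (2 * k) / ((4 * a) ^ k * fact k)))) UNIV" .
  moreover have "sqrt (pi / a) * (normal_density 0 \<sigma> x * x ^ (2 * k)) = x ^ (2 * k) * exp (- a * x\<^sup>2)" for x
    unfolding dens using a by simp
  ultimately show ?thesis by (simp only:)
qed

text \<open>Both bounds are termwise. The fourth-order one serves near the peak; the one-sided one
  is what \<open>log_moment_2_ge\<close> needs.\<close>

lemma cos_sum_taylor:
  fixes r \<theta> :: real and s :: nat
  assumes r: "0 < r" "r < 1"
  defines "U \<equiv> (\<Sum>m. log_coeff s m * r ^ m * (cos (real m * \<theta>) - 1))"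
  shows "\<bar>U + log_moment s 2 r * \<theta>\<^sup>2 / 2\<bar> \<le> log_moment s 4 r * \<theta> ^ 4 / 24"
    and "- U \<le> log_moment s 2 r * \<theta>\<^sup>2 / 2"
proof -
  let ?a = "\<lambda>m. log_coeff s m * r ^ m"
  have U: "(\<lambda>m. ?a m * (cos (real m * \<theta>) - 1)) sums U"
    unfolding U_def by (rule summable_sums[OF summable_log_coeff_cos]) (use r in simp_all)
  have S2: "(\<lambda>m. ?a m * ((real m * \<theta>)\<^sup>2 / 2)) sums (log_moment s 2 r * \<theta>\<^sup>2 / 2)"
  proof -
    have "?a m * ((real m * \<theta>)\<^sup>2 / 2) = real m ^ 2 * log_coeff s m * r ^ m * (\<theta>\<^sup>2 / 2)" for m
      by (simp only: power_mult_distrib times_divide_eq_right mult_ac)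
    thus ?thesis using sums_mult2[OF log_moment_sums[of r 2 s], of "\<theta>\<^sup>2 / 2"] r
      by (simp only: less_imp_le times_divide_eq_right)
  qed
  have S4: "(\<lambda>m. ?a m * ((real m * \<theta>) ^ 4 / 24)) sums (log_moment s 4 r * \<theta> ^ 4 / 24)"
  proof -
    have "?a m * ((real m * \<theta>) ^ 4 / 24) = real m ^ 4 * log_coeff s m * r ^ m * (\<theta> ^ 4 / 24)" for m
      by (simp only: power_mult_distrib times_divide_eq_right mult_ac)
    thus ?thesis using sums_mult2[OF log_moment_sums[of r 4 s], of "\<theta> ^ 4 / 24"] r
      by (simp only: less_imp_le times_divide_eq_right)
  qed
  have a: "?a m \<ge> 0" for m using r by simp
  have diff: "(\<lambda>m. ?a m * (cos (real m * \<theta>) - 1 + (real m * \<theta>)\<^sup>2 / 2)) sums (U + log_moment s 2 r * \<theta>\<^sup>2 / 2)"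
    using sums_add[OF U S2] by (simp only: distrib_left)
  have b: "\<bar>cos (real m * \<theta>) - 1 + (real m * \<theta>)\<^sup>2 / 2\<bar> \<le> (real m * \<theta>) ^ 4 / 24" for m
    by (rule cos_taylor_bounds(1))
  have b': "- ((real m * \<theta>) ^ 4 / 24) \<le> cos (real m * \<theta>) - 1 + (real m * \<theta>)\<^sup>2 / 2" for m
    using b[of m] unfolding abs_le_iff by linarith
  have "U + log_moment s 2 r * \<theta>\<^sup>2 / 2 \<le> log_moment s 4 r * \<theta> ^ 4 / 24"
    by (rule sums_le[OF _ diff S4]) (intro mult_left_mono a abs_le_D1[OF b])
  moreover have "- (log_moment s 4 r * \<theta> ^ 4 / 24) \<le> U + log_moment s 2 r * \<theta>\<^sup>2 / 2"
    by (rule sums_le[OF _ sums_minus[OF S4] diff])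
       (unfold minus_mult_right, intro mult_left_mono a b')
  ultimately show "\<bar>U + log_moment s 2 r * \<theta>\<^sup>2 / 2\<bar> \<le> log_moment s 4 r * \<theta> ^ 4 / 24" by linarith
  show "- U \<le> log_moment s 2 r * \<theta>\<^sup>2 / 2"
  proof (rule sums_le[OF _ sums_minus[OF U] S2])
    fix m
    have "?a m * (1 - cos (real m * \<theta>)) \<le> ?a m * ((real m * \<theta>)\<^sup>2 / 2)"
      by (intro mult_left_mono a cos_taylor_bounds(2))
    thus "- (?a m * (cos (real m * \<theta>) - 1)) \<le> ?a m * ((real m * \<theta>)\<^sup>2 / 2)"
      by (simp only: minus_mult_right minus_diff_eq)
  qed
qed

lemma sin_sum_taylor:
  fixes r \<theta> :: real and s :: nat
  assumes r: "0 < r" "r < 1"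
  shows "\<bar>(\<Sum>m. log_coeff s m * r ^ m * sin (real m * \<theta>)) - log_moment s 1 r * \<theta>\<bar>
           \<le> log_moment s 3 r * \<bar>\<theta>\<bar> ^ 3 / 6"
proof -
  let ?a = "\<lambda>m. log_coeff s m * r ^ m"
  have a: "?a m \<ge> 0" for m using r by simp
  have "summable (\<lambda>m. ?a m * sin (real m * \<theta>))"
  proof (rule summable_comparison_test'[of ?a 0])
    show "summable ?a" using summable_log_moment[of r 0 s] r by simp
    fix m
    have "?a m * \<bar>sin (real m * \<theta>)\<bar> \<le> ?a m * 1" by (intro mult_left_mono a) auto
    thus "norm (?a m * sin (real m * \<theta>)) \<le> ?a m" using r by (simp add: abs_mult)
  qed
  hence V: "(\<lambda>m. ?a m * sin (real m * \<theta>)) sums (\<Sum>m. ?a m * sin (real m * \<theta>))" by (rule summable_sums)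
  have S1: "(\<lambda>m. ?a m * (real m * \<theta>)) sums (log_moment s 1 r * \<theta>)"
  proof -
    have "?a m * (real m * \<theta>) = real m ^ 1 * log_coeff s m * r ^ m * \<theta>" for m
      by (simp only: power_one_right mult_ac)
    thus ?thesis using sums_mult2[OF log_moment_sums[of r 1 s], of \<theta>] r by (simp only: less_imp_le)
  qed
  have S3: "(\<lambda>m. ?a m * (\<bar>real m * \<theta>\<bar> ^ 3 / 6)) sums (log_moment s 3 r * \<bar>\<theta>\<bar> ^ 3 / 6)"
  proof -
    have "?a m * (\<bar>real m * \<theta>\<bar> ^ 3 / 6) = real m ^ 3 * log_coeff s m * r ^ m * (\<bar>\<theta>\<bar> ^ 3 / 6)" for m
      by (simp only: abs_mult abs_of_nat power_mult_distrib times_divide_eq_right mult_ac)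
    thus ?thesis using sums_mult2[OF log_moment_sums[of r 3 s], of "\<bar>\<theta>\<bar> ^ 3 / 6"] r
      by (simp only: less_imp_le times_divide_eq_right)
  qed
  have diff: "(\<lambda>m. ?a m * (sin (real m * \<theta>) - real m * \<theta>)) sums
      ((\<Sum>m. ?a m * sin (real m * \<theta>)) - log_moment s 1 r * \<theta>)"
    using sums_diff[OF V S1] by (simp only: right_diff_distrib)
  have b: "\<bar>sin (real m * \<theta>) - real m * \<theta>\<bar> \<le> \<bar>real m * \<theta>\<bar> ^ 3 / 6" for m
    by (rule cos_taylor_bounds(3))
  have b': "- (\<bar>real m * \<theta>\<bar> ^ 3 / 6) \<le> sin (real m * \<theta>) - real m * \<theta>" for m
    using b[of m] unfolding abs_le_iff by linarith
  have "(\<Sum>m. ?a m * sin (real m * \<theta>)) - log_moment s 1 r * \<theta> \<le> log_moment s 3 r * \<bar>\<theta>\<bar> ^ 3 / 6"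
    by (rule sums_le[OF _ diff S3]) (intro mult_left_mono a abs_le_D1[OF b])
  moreover have "- (log_moment s 3 r * \<bar>\<theta>\<bar> ^ 3 / 6) \<le> (\<Sum>m. ?a m * sin (real m * \<theta>)) - log_moment s 1 r * \<theta>"
    by (rule sums_le[OF _ sums_minus[OF S3] diff])
       (unfold minus_mult_right, intro mult_left_mono a b')
  ultimately show ?thesis by linarith
qed

text \<open>At the angle \<open>\<theta> = y\<close> the drop of the log modulus is bounded below by
  the circle decay and above by half the second moment times \<open>\<theta>\<^sup>2\<close>.
  Comparing the two yields a bound free of \<open>s\<close>.\<close>

lemma log_moment_2_ge:
  assumes y: "0 < y" "y \<le> 1" and s: "s \<ge> 5"
  shows "decay_const / y ^ 3 \<le> log_moment s 2 (exp (- 2 * pi * y))"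
proof -
  define r where "r = exp (- 2 * pi * y)"
  have r: "0 < r" "r < 1" using y by (auto simp: r_def)
  have "\<bar>y\<bar> \<le> pi" using y pi_gt3 by linarith
  from log_coeff_cos_sum_le[OF y s this]
  have "decay_const * y\<^sup>2 / (y * (y\<^sup>2 + y\<^sup>2)) \<le> - (\<Sum>m. log_coeff s m * r ^ m * (cos (real m * y) - 1))"
    by (simp add: r_def)
  also have "\<dots> \<le> log_moment s 2 r * y\<^sup>2 / 2" by (rule cos_sum_taylor(2)[OF r])
  finally have "decay_const * y\<^sup>2 / (y * (y\<^sup>2 + y\<^sup>2)) * (2 / y\<^sup>2) \<le> log_moment s 2 r * y\<^sup>2 / 2 * (2 / y\<^sup>2)"
    by (intro mult_right_mono) auto
  also have "decay_const * y\<^sup>2 / (y * (y\<^sup>2 + y\<^sup>2)) * (2 / y\<^sup>2) = decay_const / y ^ 3"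
    using y by (simp add: field_simps power2_eq_square power3_eq_cube)
  also have "log_moment s 2 r * y\<^sup>2 / 2 * (2 / y\<^sup>2) = log_moment s 2 r" using y by simp
  finally show ?thesis by (simp add: r_def)
qed

text \<open>Below \<open>B\<close> the exponential is Lipschitz with constant \<open>exp B\<close>,
  and replacing the cosine by 1 costs only a term quadratic in the phase.\<close>

lemma exp_cos_diff_le:
  fixes U V A B :: real
  assumes "U \<le> B" "A \<le> B"
  shows "\<bar>exp U * cos V - exp A\<bar> \<le> exp B * (\<bar>U - A\<bar> + V\<^sup>2 / 2)"
proof -
  have ee: "exp x - exp z \<le> exp B * \<bar>x - z\<bar>" if "x \<le> B" for x z :: real
  proof -
    have "exp x * (1 + (z - x)) \<le> exp x * exp (z - x)"
      using exp_ge_add_one_self[of "z - x"] by (intro mult_left_mono) auto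
    also have "\<dots> = exp z" by (simp flip: exp_add)
    finally have "exp x - exp z \<le> exp x * (x - z)" by (simp add: algebra_simps)
    also have "\<dots> \<le> exp x * \<bar>x - z\<bar>" by (intro mult_left_mono) auto
    also have "\<dots> \<le> exp B * \<bar>x - z\<bar>" using that by (intro mult_right_mono) auto
    finally show ?thesis .
  qed
  have "\<bar>exp U - exp A\<bar> \<le> exp B * \<bar>U - A\<bar>"
    using ee[OF assms(1), of A] ee[OF assms(2), of U] by (simp add: abs_minus_commute abs_le_iff)
  moreover have "exp U * (1 - cos V) \<le> exp B * (V\<^sup>2 / 2)"
    using assms by (intro mult_mono cos_taylor_bounds(2)) auto
  moreover have "0 \<le> exp U * (1 - cos V)" by simp
  moreover have "exp U * cos V - exp A = (exp U - exp A) - exp U * (1 - cos V)" by (simp add: algebra_simps)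
  ultimately show ?thesis unfolding distrib_left by linarith
qed

text \<open>Beyond \<open>y\<close> the polynomial factor is at least 1, as
  \<open>y ^ 5 \<le> y ^ 4 \<le> \<theta> ^ 4\<close>. So the majorant used near the peak also
  covers the part of the Gaussian that has no counterpart in the integrand.\<close>

lemma gaussian_tail_le:
  fixes y \<theta> S c :: real
  assumes y: "0 < y" "y \<le> 1" and y\<theta>: "y < \<bar>\<theta>\<bar>" and S: "2 * c / y ^ 3 \<le> S"
  shows "exp (- (S * \<theta>\<^sup>2 / 2)) \<le> 2 * (\<theta> ^ 4 / y ^ 5 + \<theta> ^ 6 / y ^ 8) * exp (- (c / y ^ 3) * \<theta>\<^sup>2)"
proof -
  have "y ^ 5 \<le> y ^ 4" using y by (intro power_decreasing) auto
  also have "\<dots> \<le> \<bar>\<theta>\<bar> ^ 4" using y y\<theta> by (intro power_mono) auto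
  finally have "y ^ 5 \<le> \<theta> ^ 4" by simp
  hence "1 \<le> \<theta> ^ 4 / y ^ 5" using y by (simp add: le_divide_eq)
  moreover have "0 \<le> \<theta> ^ 6 / y ^ 8" using y by (intro divide_nonneg_pos zero_le_even_power) auto
  moreover have "1 \<le> 2 * (u + v)" if "1 \<le> u" "0 \<le> v" for u v :: real
    using add_mono[OF that] by simp
  ultimately have "1 \<le> 2 * (\<theta> ^ 4 / y ^ 5 + \<theta> ^ 6 / y ^ 8)" by blast
  moreover have "exp (- (S * \<theta>\<^sup>2 / 2)) \<le> exp (- (c / y ^ 3) * \<theta>\<^sup>2)"
    using mult_right_mono[OF S, of "\<theta>\<^sup>2 / 2"] by simp
  ultimately have "1 * exp (- (S * \<theta>\<^sup>2 / 2)) \<le> 2 * (\<theta> ^ 4 / y ^ 5 + \<theta> ^ 6 / y ^ 8) * exp (- (c / y ^ 3) * \<theta>\<^sup>2)"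
    by (intro mult_mono) auto
  thus ?thesis by simp
qed

text \<open>The range is split at \<open>\<bar>\<theta>\<bar> = y\<close>. Inside,
  \<open>y\<^sup>2 + \<theta>\<^sup>2 \<le> 2 * y\<^sup>2\<close> turns the circle decay into a
  Gaussian, and this 2 is the one in \<open>c\<close>. Outside, the decay has saturated at
  \<open>exp (- (c / y))\<close>, and integrand and Gaussian are bounded separately.\<close>

lemma saddle_integrand_bound:
  fixes y \<theta> :: real and s :: nat and N :: real
  assumes y: "0 < y" "y \<le> 1" and s: "s \<ge> 5" and \<theta>: "\<bar>\<theta>\<bar> \<le> pi"
    and saddle: "log_moment s 1 (exp (- 2 * pi * y)) = N"
  defines "r \<equiv> exp (- 2 * pi * y)"
  defines "U \<equiv> (\<Sum>m. log_coeff s m * r ^ m * (cos (real m * \<theta>) - 1))"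
    and "V \<equiv> (\<Sum>m. log_coeff s m * r ^ m * sin (real m * \<theta>)) - N * \<theta>"
    and "c \<equiv> decay_const / 2"
  shows "\<bar>exp (U) * cos (V) - exp (- (log_moment s 2 r * \<theta>\<^sup>2 / 2))\<bar> \<le>
           2 * (\<theta> ^ 4 / y ^ 5 + \<theta> ^ 6 / y ^ 8) * exp (- (c / y ^ 3) * \<theta>\<^sup>2) + exp (- (c / y))"
proof -
  have c: "c > 0" using decay_const_pos by (simp add: c_def)
  have r: "0 < r" "r < 1" using y by (auto simp: r_def)
  define S2 S3 S4 where "S2 = log_moment s 2 r" and "S3 = log_moment s 3 r" and "S4 = log_moment s 4 r"
  have U_le: "U \<le> - (decay_const * \<theta>\<^sup>2 / (y * (y\<^sup>2 + \<theta>\<^sup>2)))"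
    unfolding U_def r_def by (rule log_coeff_cos_sum_le[OF y s \<theta>])
  have S2: "2 * c / y ^ 3 \<le> S2" using log_moment_2_ge[OF y s] by (simp add: S2_def r_def c_def)
  define A where "A = - (S2 * \<theta>\<^sup>2 / 2)"
  define G where "G = exp (- (c / y ^ 3) * \<theta>\<^sup>2)"
  have A_le: "A \<le> - (c / y ^ 3) * \<theta>\<^sup>2"
    using mult_right_mono[OF S2, of "\<theta>\<^sup>2 / 2"] by (simp add: A_def)
  hence AG: "exp A \<le> G" by (simp add: G_def)
  have G: "G > 0" by (simp add: G_def)
  show ?thesis
  proof (cases "\<bar>\<theta>\<bar> \<le> y")
    case True
    hence \<theta>y: "\<theta>\<^sup>2 \<le> y\<^sup>2" using y by (simp add: abs_le_square_iff[symmetric])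
    have "- (decay_const * \<theta>\<^sup>2 / (y * (y\<^sup>2 + \<theta>\<^sup>2))) \<le> - (decay_const * \<theta>\<^sup>2 / (y * (y\<^sup>2 + y\<^sup>2)))"
    proof -
      have "decay_const * \<theta>\<^sup>2 / (y * (y\<^sup>2 + y\<^sup>2)) \<le> decay_const * \<theta>\<^sup>2 / (y * (y\<^sup>2 + \<theta>\<^sup>2))"
        using y \<theta>y decay_const_pos
        by (intro divide_left_mono mult_left_mono mult_pos_pos add_pos_nonneg add_left_mono mult_nonneg_nonneg) auto
      thus ?thesis by simp
    qed
    also have "\<dots> = - (c / y ^ 3) * \<theta>\<^sup>2"
      by (simp add: c_def power2_eq_square power3_eq_cube)
    finally have "U \<le> - (c / y ^ 3) * \<theta>\<^sup>2" using U_le by linarith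
    from exp_cos_diff_le[OF this A_le, of V]
    have "\<bar>exp U * cos V - exp A\<bar> \<le> G * (\<bar>U - A\<bar> + V\<^sup>2 / 2)" by (simp only: G_def)
    also have "\<dots> \<le> G * (2 * (\<theta> ^ 4 / y ^ 5 + \<theta> ^ 6 / y ^ 8))"
    proof (rule mult_left_mono)
      have pi1: "(1::real) \<le> pi ^ k" for k using pi_gt3 by (intro one_le_power) linarith
      have S4: "S4 \<le> 1 / y ^ 5"
      proof -
        have "S4 \<le> fact 3 / (pi * y) ^ 3 / (6 * y\<^sup>2)"
          using log_moment_le[of y s 3] y s by (simp add: S4_def r_def)
        also have "\<dots> = 1 / (pi ^ 3 * y ^ 5)"
          by (simp add: fact_numeral power_mult_distrib flip: power_add)
        also have "\<dots> \<le> 1 / (1 * y ^ 5)" using y pi1[of 3] by (intro divide_left_mono mult_right_mono) auto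
        finally show ?thesis by simp
      qed
      have S3: "0 \<le> S3" "S3 \<le> 1 / y ^ 4"
      proof -
        have "S3 \<le> fact 2 / (pi * y) ^ 2 / (6 * y\<^sup>2)"
          using log_moment_le[of y s 2] y s by (simp add: S3_def r_def eval_nat_numeral)
        also have "\<dots> = (1 / 3) / (pi ^ 2 * y ^ 4)"
          by (simp add: fact_numeral power_mult_distrib flip: power_add)
        also have "\<dots> \<le> 1 / (1 * y ^ 4)" using y pi1[of 2] by (intro frac_le mult_right_mono) auto
        finally show "S3 \<le> 1 / y ^ 4" by simp
        show "0 \<le> S3" unfolding S3_def using r by (intro log_moment_nonneg) auto
      qed
      have "\<bar>U - A\<bar> \<le> S4 * \<theta> ^ 4 / 24"
        using cos_sum_taylor(1)[OF r, of s \<theta>] by (simp add: U_def A_def S2_def S4_def)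
      also have "\<dots> \<le> (1 / y ^ 5) * \<theta> ^ 4 / 24"
        using S4 by (intro divide_right_mono mult_right_mono) auto
      also have "\<dots> \<le> 2 * (\<theta> ^ 4 / y ^ 5)"
      proof -
        have "0 \<le> \<theta> ^ 4 / y ^ 5" using y by (intro divide_nonneg_pos zero_le_even_power) auto
        thus ?thesis by simp
      qed
      finally have 1: "\<bar>U - A\<bar> \<le> 2 * (\<theta> ^ 4 / y ^ 5)" .
      \<comment> \<open>The saddle point equation removes the linear term of the phase.\<close>
      have "\<bar>V\<bar> \<le> S3 * \<bar>\<theta>\<bar> ^ 3 / 6"
        using sin_sum_taylor[OF r, of s \<theta>] saddle by (simp add: V_def S3_def r_def)
      also have "\<dots> \<le> (1 / y ^ 4) * \<bar>\<theta>\<bar> ^ 3 / 6"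
        using S3 by (intro divide_right_mono mult_right_mono) auto
      finally have "\<bar>V\<bar>\<^sup>2 \<le> ((1 / y ^ 4) * \<bar>\<theta>\<bar> ^ 3 / 6)\<^sup>2" by (intro power_mono) auto
      also have "\<dots> = \<theta> ^ 6 / y ^ 8 / 36"
        by (simp add: power_divide power_mult_distrib flip: power_mult)
      also have "\<dots> \<le> 4 * (\<theta> ^ 6 / y ^ 8)"
      proof -
        have "0 \<le> \<theta> ^ 6 / y ^ 8" using y by (intro divide_nonneg_pos zero_le_even_power) auto
        moreover have "w / 36 \<le> 4 * w" if "0 \<le> w" for w :: real using that by linarith
        ultimately show ?thesis by blast
      qed
      finally have 2: "V\<^sup>2 / 2 \<le> 2 * (\<theta> ^ 6 / y ^ 8)" by simp
      from 1 2 show "\<bar>U - A\<bar> + V\<^sup>2 / 2 \<le> 2 * (\<theta> ^ 4 / y ^ 5 + \<theta> ^ 6 / y ^ 8)" by (simp only: distrib_left)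
    qed (use G in simp)
    also have "\<dots> \<le> G * (2 * (\<theta> ^ 4 / y ^ 5 + \<theta> ^ 6 / y ^ 8)) + exp (- (c / y))" by simp
    finally show ?thesis by (simp only: A_def G_def S2_def mult.commute)
  next
    case False
    hence y\<theta>: "y < \<bar>\<theta>\<bar>" by simp
    hence y2: "y\<^sup>2 \<le> \<theta>\<^sup>2" using y by (simp add: abs_le_square_iff[symmetric])
    have \<theta>0: "\<theta>\<^sup>2 > 0" using y\<theta> y by auto
    have "c / y = decay_const * \<theta>\<^sup>2 / (y * (\<theta>\<^sup>2 + \<theta>\<^sup>2))"
    proof -
      have "decay_const / 2 / y = decay_const * T / (y * (T + T))" if "T > 0" for T
        using that by simp
      from this[OF \<theta>0] show ?thesis unfolding c_def .
    qed
    also have "\<dots> \<le> decay_const * \<theta>\<^sup>2 / (y * (y\<^sup>2 + \<theta>\<^sup>2))"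
      using y y2 decay_const_pos \<theta>0
      by (intro divide_left_mono mult_left_mono mult_pos_pos add_nonneg_pos add_right_mono mult_nonneg_nonneg) auto
    finally have "U \<le> - (c / y)" using U_le by linarith
    hence "\<bar>exp U * cos V\<bar> \<le> exp (- (c / y)) * 1" unfolding abs_mult by (intro mult_mono) auto
    moreover have "exp A \<le> 2 * (\<theta> ^ 4 / y ^ 5 + \<theta> ^ 6 / y ^ 8) * G"
      unfolding A_def G_def by (rule gaussian_tail_le[OF y y\<theta> S2])
    moreover have "exp A > 0" by simp
    ultimately have "\<bar>exp U * cos V - exp A\<bar> \<le> 2 * (\<theta> ^ 4 / y ^ 5 + \<theta> ^ 6 / y ^ 8) * G + exp (- (c / y))"
      by linarith
    thus ?thesis by (simp only: A_def G_def S2_def)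
  qed
qed

text \<open>Twice the fourth and twice the sixth moment of \<open>exp (- c * x\<^sup>2)\<close>, and
  a bound for the contribution of the exponentially small constant, in which \<open>12 * pi\<close>
  is \<open>2 * pi * fact 3\<close>.\<close>

definition saddle_const :: "real \<Rightarrow> real" where
  "saddle_const c = 2 * (sqrt (pi / c) * (fact 4 / ((4 * c)\<^sup>2 * fact 2))) +
     2 * (sqrt (pi / c) * (fact 6 / ((4 * c) ^ 3 * fact 3))) + 12 * pi / c ^ 3"

text \<open>On the scale \<open>y powr (3/2)\<close> of the Gaussian both
  \<open>\<theta> ^ 4 / y ^ 5\<close> and \<open>\<theta> ^ 6 / y ^ 8\<close> have order
  \<open>y\<close>, so either integral has order \<open>y powr (5/2)\<close>. The constant is cut
  off at \<open>pi\<close> to be integrable over the line.\<close>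

lemma saddle_bound_has_integral:
  fixes c y :: real
  assumes c: "c > 0" and y: "0 < y" "y \<le> 1"
  shows "\<exists>H \<le> saddle_const c * (y\<^sup>2 * sqrt y).
           ((\<lambda>\<theta>. 2 * (\<theta> ^ 4 / y ^ 5 + \<theta> ^ 6 / y ^ 8) * exp (- (c / y ^ 3) * \<theta>\<^sup>2) +
              (if \<theta> \<in> {-pi..pi} then exp (- (c / y)) else 0)) has_integral H) UNIV"
proof -
  define a where "a = c / y ^ 3"
  have a: "a > 0" using c y by (simp add: a_def)
  have root: "sqrt (pi / a) = sqrt (pi / c) * (y * sqrt y)"
  proof -
    have "pi / a = pi / c * (y\<^sup>2 * y)" by (simp add: a_def power2_eq_square power3_eq_cube)
    hence "sqrt (pi / a) = sqrt (pi / c) * (sqrt (y\<^sup>2) * sqrt y)" by (simp only: real_sqrt_mult)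
    thus ?thesis using y by simp
  qed
  define I4 where "I4 = sqrt (pi / c) * (fact 4 / ((4 * c)\<^sup>2 * fact 2))"
  define I6 where "I6 = sqrt (pi / c) * (fact 6 / ((4 * c) ^ 3 * fact 3))"
  have e4: "2 / y ^ 5 * (sqrt (pi / a) * (fact (2 * 2) / ((4 * a) ^ 2 * fact 2))) = 2 * I4 * (y\<^sup>2 * sqrt y)"
  proof -
    have "(4 * a) ^ 2 = (4 * c)\<^sup>2 / y ^ 6" by (simp add: a_def power_divide power_mult_distrib flip: power_mult)
    hence "2 / y ^ 5 * (sqrt (pi / a) * (fact (2 * 2) / ((4 * a) ^ 2 * fact 2)))
       = 2 * I4 * (sqrt y * (y * y ^ 6 / y ^ 5))"
      unfolding root I4_def by (simp add: mult_ac)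
    also have "y * y ^ 6 / y ^ 5 = y\<^sup>2" using y by (simp add: field_simps flip: power_Suc power_add)
    finally show ?thesis by (simp add: mult_ac)
  qed
  have e6: "2 / y ^ 8 * (sqrt (pi / a) * (fact (2 * 3) / ((4 * a) ^ 3 * fact 3))) = 2 * I6 * (y\<^sup>2 * sqrt y)"
  proof -
    have "(4 * a) ^ 3 = (4 * c) ^ 3 / y ^ 9" by (simp add: a_def power_divide power_mult_distrib flip: power_mult)
    hence "2 / y ^ 8 * (sqrt (pi / a) * (fact (2 * 3) / ((4 * a) ^ 3 * fact 3)))
       = 2 * I6 * (sqrt y * (y * y ^ 9 / y ^ 8))"
      unfolding root I6_def by (simp add: mult_ac)
    also have "y * y ^ 9 / y ^ 8 = y\<^sup>2" using y by (simp add: field_simps flip: power_Suc power_add)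
    finally show ?thesis by (simp add: mult_ac)
  qed
  have i4: "((\<lambda>\<theta>. 2 / y ^ 5 * (\<theta> ^ (2 * 2) * exp (- a * \<theta>\<^sup>2))) has_integral 2 * I4 * (y\<^sup>2 * sqrt y)) UNIV"
    using has_integral_mult_right[OF gaussian_moment_has_integral[OF a, of 2], of "2 / y ^ 5"] unfolding e4 .
  have i6: "((\<lambda>\<theta>. 2 / y ^ 8 * (\<theta> ^ (2 * 3) * exp (- a * \<theta>\<^sup>2))) has_integral 2 * I6 * (y\<^sup>2 * sqrt y)) UNIV"
    using has_integral_mult_right[OF gaussian_moment_has_integral[OF a, of 3], of "2 / y ^ 8"] unfolding e6 .
  have "((\<lambda>\<theta>. exp (- (c / y))) has_integral (2 * pi * exp (- (c / y)))) {-pi..pi}"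
    using has_integral_const_real[of "exp (- (c / y))" "-pi" pi] by simp
  hence i0: "((\<lambda>\<theta>. if \<theta> \<in> {-pi..pi} then exp (- (c / y)) else 0) has_integral (2 * pi * exp (- (c / y)))) UNIV"
    by (simp only: has_integral_restrict_UNIV)
  have fun_eq: "2 / y ^ 5 * (\<theta> ^ (2 * 2) * E) + 2 / y ^ 8 * (\<theta> ^ (2 * 3) * E) + z
      = 2 * (\<theta> ^ 4 / y ^ 5 + \<theta> ^ 6 / y ^ 8) * E + z" for \<theta> E z
    by (simp add: algebra_simps)
  note int = has_integral_add[OF has_integral_add[OF i4 i6] i0]
  have "2 * pi * exp (- (c / y)) \<le> 12 * pi / c ^ 3 * (y\<^sup>2 * sqrt y)"
  proof -
    have "(c / y) ^ 3 * exp (- (c / y)) \<le> fact 3" using c y by (intro power_exp_neg_le) auto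
    hence "exp (- (c / y)) \<le> 6 / c ^ 3 * (y\<^sup>2 * y)"
      using c y by (simp add: power_divide fact_numeral field_simps power2_eq_square power3_eq_cube)
    also have "\<dots> \<le> 6 / c ^ 3 * (y\<^sup>2 * sqrt y)"
    proof (intro mult_left_mono)
      have "sqrt y * sqrt y \<le> sqrt y * 1" using y by (intro mult_left_mono) auto
      thus "y \<le> sqrt y" using y by simp
    qed (use c in auto)
    finally have "2 * pi * exp (- (c / y)) \<le> 2 * pi * (6 / c ^ 3 * (y\<^sup>2 * sqrt y))"
      by (intro mult_left_mono) auto
    thus ?thesis by simp
  qed
  hence "2 * I4 * (y\<^sup>2 * sqrt y) + 2 * I6 * (y\<^sup>2 * sqrt y) + 2 * pi * exp (- (c / y)) \<le> saddle_const c * (y\<^sup>2 * sqrt y)"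
    unfolding saddle_const_def I4_def[symmetric] I6_def[symmetric] distrib_right by linarith
  with int show ?thesis unfolding fun_eq a_def by blast
qed

lemma saddle_point_integral_estimate:
  fixes N t :: nat and y :: real
  assumes t: "t \<ge> 4" and y: "0 < y" "y \<le> 1" and saddle: "saddle_point_eq N t y"
  defines "r \<equiv> exp (- 2 * pi * y)"
  shows "\<bar>2 * pi * r ^ N * real (num_regular_partitions N t) * exp (- log_moment (t + 1) 0 r)
            - sqrt (2 * pi / log_moment (t + 1) 2 r)\<bar> \<le> saddle_const (decay_const / 2) * (y\<^sup>2 * sqrt y)"
proof -
  define s c where "s = t + 1" and "c = decay_const / 2"
  have s: "s \<ge> 5" using t by (simp add: s_def)
  have c: "c > 0" using decay_const_pos by (simp add: c_def)
  have r: "0 < r" "r < 1" using y by (auto simp: r_def)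
  have N: "log_moment s 1 (exp (- 2 * pi * y)) = real N"
    using saddle saddle_point_eq_iff[OF y(1)] by (simp add: s_def)
  define S where "S = log_moment s 2 r"
  have S: "2 * c / y ^ 3 \<le> S" using log_moment_2_ge[OF y s] by (simp add: S_def r_def c_def)
  have "2 * c / y ^ 3 > 0" using c y by simp
  hence S_pos: "S > 0" using S by linarith
  define f where "f = (\<lambda>\<theta>. exp (\<Sum>m. log_coeff s m * r ^ m * (cos (real m * \<theta>) - 1)) *
      cos ((\<Sum>m. log_coeff s m * r ^ m * sin (real m * \<theta>)) - real N * \<theta>))"
  define I where "I = 2 * pi * r ^ N * real (num_regular_partitions N t) * exp (- log_moment s 0 r)"
  have "(f has_integral I) {-pi..pi}"
    unfolding f_def I_def s_def by (rule num_regular_partitions_real_integral[OF r])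
  \<comment> \<open>Extended by zero, the integrand can be compared with the Gaussian on the whole
    line, whose integral is explicit.\<close>
  hence int_f: "((\<lambda>\<theta>. if \<theta> \<in> {-pi..pi} then f \<theta> else 0) has_integral I) UNIV"
    by (simp only: has_integral_restrict_UNIV)
  have "S / 2 > 0" using S_pos by simp
  from gaussian_moment_has_integral[OF this, of 0]
  have int_g: "((\<lambda>\<theta>. exp (- (S * \<theta>\<^sup>2 / 2))) has_integral sqrt (2 * pi / S)) UNIV"
    by (simp add: mult.commute)
  obtain H h where H: "H \<le> saddle_const c * (y\<^sup>2 * sqrt y)" "(h has_integral H) UNIV"
    and h: "h = (\<lambda>\<theta>. 2 * (\<theta> ^ 4 / y ^ 5 + \<theta> ^ 6 / y ^ 8) * exp (- (c / y ^ 3) * \<theta>\<^sup>2) +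
              (if \<theta> \<in> {-pi..pi} then exp (- (c / y)) else 0))"
    using saddle_bound_has_integral[OF c y] by blast
  have le: "\<bar>(if \<theta> \<in> {-pi..pi} then f \<theta> else 0) - exp (- (S * \<theta>\<^sup>2 / 2))\<bar> \<le> h \<theta>" for \<theta>
  proof (cases "\<theta> \<in> {-pi..pi}")
    case True
    hence "\<bar>\<theta>\<bar> \<le> pi" by auto
    from saddle_integrand_bound[OF y s this N] True show ?thesis
      unfolding f_def S_def h c_def r_def by simp
  next
    case False
    hence "y < \<bar>\<theta>\<bar>" using y pi_gt3 by auto
    from gaussian_tail_le[OF y this S] show ?thesis
      unfolding h if_not_P[OF False] diff_0 abs_minus_cancel abs_exp_cancel add_0_right .
  qed
  note d = has_integral_diff[OF int_f int_g]
  have "I - sqrt (2 * pi / S) \<le> H"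
    by (rule has_integral_le[OF d H(2)]) (rule abs_le_D1[OF le])
  moreover have "- (I - sqrt (2 * pi / S)) \<le> H"
    by (rule has_integral_le[OF has_integral_neg[OF d] H(2)]) (rule abs_le_D2[OF le])
  ultimately have "\<bar>I - sqrt (2 * pi / S)\<bar> \<le> saddle_const c * (y\<^sup>2 * sqrt y)" using H(1) by linarith
  thus ?thesis by (simp only: I_def S_def s_def c_def)
qed

section \<open>The main term in terms of moments, and the conclusion\<close>

lemma main_term_eq:
  fixes N t :: nat and y :: real
  assumes y: "y > 0"
  defines "r \<equiv> exp (- 2 * pi * y)"
  shows "main_term N t y = of_real (exp (2 * pi * y * real N + log_moment (t + 1) 0 r) /
           sqrt (2 * pi * log_moment (t + 1) 2 r))"
proof -
  define s where "s = real (t + 1)"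
  have s: "s > 0" by (simp add: s_def)
  have sy: "s * y > 0" using s y by simp
  have arg: "of_nat (t + 1) * \<i> * complex_of_real y = \<i> * of_real (s * y)" by (simp add: s_def)
  define L0 L0' L2 L2' where "L0 = log_moment 0 0 r" and "L0' = log_moment 0 0 (exp (- 2 * pi * (s * y)))"
    and "L2 = log_moment 0 2 r" and "L2' = log_moment 0 2 (exp (- 2 * pi * (s * y)))"
  have M0: "log_moment (t + 1) 0 r = L0 - L0'"
    using log_moment_split_exp[of "t + 1" y 0] y by (simp add: L0_def L0'_def s_def r_def)
  define S where "S = log_moment (t + 1) 2 r"
  have S: "S = L2 - s\<^sup>2 * L2'"
    using log_moment_split_exp[of "t + 1" y 2] y by (simp add: S_def L2_def L2'_def s_def r_def)
  have "S \<ge> 0" unfolding S_def r_def using y by (intro log_moment_nonneg) auto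
  have eta1: "eta (\<i> * of_real y) = of_real (exp (- pi * y / 12 - L0))"
    unfolding L0_def r_def by (rule eta_imaginary_axis[OF y])
  have eta2: "eta (\<i> * of_real (s * y)) = of_real (exp (- pi * (s * y) / 12 - L0'))"
    unfolding L0'_def by (rule eta_imaginary_axis[OF sy])
  have "of_nat (t + 1) * mu 2 (\<i> * of_real y) - mu 2 (\<i> * of_real (s * y))
      = of_real (s * (2 * pi * y ^ 3 * L2) - 2 * pi * (s * y) ^ 3 * L2')"
    unfolding mu_2_imaginary_axis[OF y] mu_2_imaginary_axis[OF sy] L2_def L2'_def r_def
    by (simp add: s_def)
  \<comment> \<open>The common factor \<open>s * y ^ 3\<close> is what
    \<open>sqrt (t + 1) * y powr (3/2)\<close> in the main term cancels after taking the
    root.\<close>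
  also have "s * (2 * pi * y ^ 3 * L2) - 2 * pi * (s * y) ^ 3 * L2' = s * (y ^ 3 * (2 * pi * S))"
    unfolding S by (simp add: power2_eq_square power3_eq_cube algebra_simps)
  finally have mu: "csqrt (of_nat (t + 1) * mu 2 (\<i> * of_real y) - mu 2 (\<i> * of_real (s * y)))
      = of_real (sqrt s * (y powr (3/2) * sqrt (2 * pi * S)))"
  proof -
    assume *: "of_nat (t + 1) * mu 2 (\<i> * of_real y) - mu 2 (\<i> * of_real (s * y)) = complex_of_real (s * (y ^ 3 * (2 * pi * S)))"
    have "csqrt (of_real (s * (y ^ 3 * (2 * pi * S)))) = of_real (sqrt (s * (y ^ 3 * (2 * pi * S))))"
      using s y \<open>S \<ge> 0\<close> by (intro of_real_sqrt[symmetric]) auto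
    also have "sqrt (s * (y ^ 3 * (2 * pi * S))) = sqrt s * (sqrt (y ^ 3) * sqrt (2 * pi * S))"
      by (simp only: real_sqrt_mult)
    also have "sqrt (y ^ 3) = y powr (3/2)"
    proof -
      have "sqrt (y ^ 3) = (y powr 3) powr (1/2)" using y by (simp add: powr_half_sqrt powr_numeral)
      thus ?thesis by (simp add: powr_powr)
    qed
    finally show ?thesis unfolding * .
  qed
  define X where "X = exp (2 * pi * y * (real N + real t / 24))"
  have "main_term N t y = of_real (sqrt s * y powr (3/2) * X * exp (- pi * (s * y) / 12 - L0') /
      (sqrt s * (y powr (3/2) * sqrt (2 * pi * S)) * exp (- pi * y / 12 - L0)))"
    unfolding main_term_def arg mu eta1 eta2 s_def[symmetric] X_def[symmetric]
    by (simp only: of_real_mult of_real_divide)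
  also have "sqrt s * y powr (3/2) * X * exp (- pi * (s * y) / 12 - L0') /
      (sqrt s * (y powr (3/2) * sqrt (2 * pi * S)) * exp (- pi * y / 12 - L0))
     = (X * exp (- pi * (s * y) / 12 - L0') / exp (- pi * y / 12 - L0)) / sqrt (2 * pi * S)"
  proof -
    have "sqrt s \<noteq> 0" "y powr (3/2) \<noteq> 0" using s y by auto
    moreover have "A * B * x * z / (A * (B * w) * v) = (x * z / v) / w"
      if "A \<noteq> 0" "B \<noteq> 0" for A B x z w v :: real using that by (simp add: mult_ac)
    ultimately show ?thesis by blast
  qed
  \<comment> \<open>The prefactors of the two eta values combine to
    \<open>exp (- 2 * pi * y * t / 24)\<close>, which undoes the shift of \<open>N\<close> by
    \<open>t / 24\<close>.\<close>
  also have "X * exp (- pi * (s * y) / 12 - L0') / exp (- pi * y / 12 - L0) = exp (2 * pi * y * real N + (L0 - L0'))"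
  proof -
    have "2 * pi * y * (real N + real t / 24) + (- pi * (s * y) / 12 - L0') - (- pi * y / 12 - L0)
        = 2 * pi * y * real N + (L0 - L0')"
      by (simp add: s_def field_simps)
    thus ?thesis unfolding X_def by (simp only: exp_add[symmetric] exp_diff[symmetric])
  qed
  finally show ?thesis by (simp only: M0 S_def)
qed

text \<open>The absolute error of order \<open>y powr (5/2)\<close> becomes relative on division by
  the Gaussian mass. That mass is at least \<open>y powr (3/2)\<close> by the upper bound
  \<open>S \<le> 1 / y ^ 3\<close>.\<close>

lemma num_regular_partitions_asymptotics:
  fixes N t :: nat and y :: real
  assumes t: "t \<ge> 4" and y: "0 < y" "y \<le> 1" and saddle: "saddle_point_eq N t y"
  shows "\<exists>E::complex. norm E \<le> saddle_const (decay_const / 2) * y \<and>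
           of_nat (num_regular_partitions N t) = main_term N t y * (1 + E)"
proof -
  define r where "r = exp (- 2 * pi * y)"
  define K where "K = saddle_const (decay_const / 2)"
  define S where "S = log_moment (t + 1) 2 r"
  define M where "M = log_moment (t + 1) 0 r"
  define P where "P = real (num_regular_partitions N t)"
  define I where "I = 2 * pi * r ^ N * P * exp (- M)"
  have est: "\<bar>I - sqrt (2 * pi / S)\<bar> \<le> K * (y\<^sup>2 * sqrt y)"
    using saddle_point_integral_estimate[OF t y saddle]
    by (simp only: I_def S_def M_def P_def K_def r_def)
  have "decay_const / y ^ 3 \<le> S" unfolding S_def r_def using log_moment_2_ge[OF y] t by simp
  moreover have "decay_const / y ^ 3 > 0" using decay_const_pos y by simp
  ultimately have S: "S > 0" by linarith
  define E where "E = I / sqrt (2 * pi / S) - 1"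
  have "S \<le> 1 / y ^ 3"
  proof -
    have "S \<le> fact 1 / (pi * y) ^ 1 / (6 * y\<^sup>2)"
      using log_moment_le[of y "t + 1" 1] y by (simp add: S_def r_def numeral_2_eq_2)
    also have "\<dots> = 1 / (6 * pi * y ^ 3)" by (simp add: power2_eq_square power3_eq_cube mult_ac)
    also have "\<dots> \<le> 1 / (1 * y ^ 3)"
      using y pi_gt3 by (intro divide_left_mono mult_right_mono mult_pos_pos) auto
    finally show ?thesis by simp
  qed
  have root: "1 / sqrt (2 * pi / S) \<le> 1 / (y * sqrt y)"
  proof -
    have "1 / sqrt (2 * pi / S) = sqrt (S / (2 * pi))" by (simp add: real_sqrt_divide)
    also have "S / (2 * pi) \<le> (1 / y ^ 3) / 1"
      using \<open>S \<le> 1 / y ^ 3\<close> S y pi_gt3 by (intro frac_le) auto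
    hence "sqrt (S / (2 * pi)) \<le> sqrt (1 / y ^ 3)" by simp
    also have "sqrt (1 / y ^ 3) = 1 / (y * sqrt y)"
    proof -
      have "y ^ 3 = y\<^sup>2 * y" by (simp add: power2_eq_square power3_eq_cube)
      thus ?thesis using y by (simp add: real_sqrt_divide real_sqrt_mult)
    qed
    finally show ?thesis .
  qed
  have Q: "sqrt (2 * pi / S) > 0" using S by simp
  have "\<bar>E\<bar> \<le> K * y"
  proof -
    have "E = (I - sqrt (2 * pi / S)) * (1 / sqrt (2 * pi / S))"
      using Q S by (simp add: E_def diff_divide_distrib)
    hence "\<bar>E\<bar> = \<bar>I - sqrt (2 * pi / S)\<bar> * (1 / sqrt (2 * pi / S))" using Q by (simp add: abs_mult)
    also have "\<dots> \<le> K * (y\<^sup>2 * sqrt y) * (1 / (y * sqrt y))"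
      using est Q root by (intro mult_mono) auto
    also have "\<dots> = K * y" using y by (simp add: power2_eq_square)
    finally show ?thesis .
  qed
  moreover have "P = exp (2 * pi * y * real N + M) / sqrt (2 * pi * S) * (1 + E)"
  proof -
    have rN: "r ^ N = exp (- (2 * pi * y * real N))"
      unfolding r_def by (simp add: mult_ac flip: exp_of_nat_mult)
    have "exp (2 * pi * y * real N + M) * (r ^ N * exp (- M)) = 1"
      unfolding rN by (simp flip: exp_add)
    hence "exp (2 * pi * y * real N + M) * I = 2 * pi * P"
      unfolding I_def by (metis (no_types, lifting) mult.assoc mult.commute mult_1)
    moreover have "sqrt (2 * pi * S) * sqrt (2 * pi / S) = 2 * pi"
    proof -
      have e: "2 * pi * S * (2 * pi / S) = (2 * pi)\<^sup>2" using S by (simp add: power2_eq_square)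
      show ?thesis unfolding real_sqrt_mult[symmetric] e by (rule real_sqrt_unique) simp_all
    qed
    moreover have "exp (2 * pi * y * real N + M) / sqrt (2 * pi * S) * (1 + E)
        = exp (2 * pi * y * real N + M) * I / (sqrt (2 * pi * S) * sqrt (2 * pi / S))"
      by (simp add: E_def)
    ultimately show ?thesis by simp
  qed
  hence "complex_of_real P = of_real (exp (2 * pi * y * real N + M) / sqrt (2 * pi * S)) * (1 + of_real E)"
    by (simp only: of_real_mult of_real_add of_real_1)
  hence "of_nat (num_regular_partitions N t) = main_term N t y * (1 + of_real E)"
    unfolding main_term_eq[OF y(1)] by (simp only: P_def M_def S_def r_def of_real_of_nat_eq)
  ultimately show ?thesis by (intro exI[of _ "of_real E"]) (simp add: K_def)
qed

theorem theorem1p1: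
  shows "(\<forall>N t :: nat. N \<ge> 1 \<longrightarrow> t \<ge> 4 \<longrightarrow>
            (\<exists>!y::real. y > 0 \<and> saddle_point_eq N t y) \<and>
            (\<forall>y::real. y > 0 \<and> saddle_point_eq N t y \<longrightarrow>
               sqrt (real t / (24 * (real t + 1) * (real N + real t / 24))) < y \<and>
               y < 1 / sqrt (24 * real N - 1))) \<and>
         (\<exists>C::real. \<forall>(N::nat) (t::nat) (y::real).
            N \<ge> 1 \<longrightarrow> t \<ge> 4 \<longrightarrow> y > 0 \<longrightarrow> saddle_point_eq N t y \<longrightarrow>
            (\<exists>E::complex. norm E \<le> C * y \<and>
               of_nat (num_regular_partitions N t) = main_term N t y * (1 + E)))"
proof (rule conjI)
  show "\<forall>N t :: nat. N \<ge> 1 \<longrightarrow> t \<ge> 4 \<longrightarrow>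
            (\<exists>!y::real. y > 0 \<and> saddle_point_eq N t y) \<and>
            (\<forall>y::real. y > 0 \<and> saddle_point_eq N t y \<longrightarrow>
               sqrt (real t / (24 * (real t + 1) * (real N + real t / 24))) < y \<and>
               y < 1 / sqrt (24 * real N - 1))"
  proof (intro allI impI)
    fix N t :: nat assume N: "N \<ge> 1" and "t \<ge> 4"
    hence t: "t \<ge> 1" by simp
    show "(\<exists>!y::real. y > 0 \<and> saddle_point_eq N t y) \<and>
            (\<forall>y::real. y > 0 \<and> saddle_point_eq N t y \<longrightarrow>
               sqrt (real t / (24 * (real t + 1) * (real N + real t / 24))) < y \<and>
               y < 1 / sqrt (24 * real N - 1))"
      using saddle_point_exists_unique[OF N t] by blast
  qed
  have "\<exists>E::complex. norm E \<le> saddle_const (decay_const / 2) * y \<and>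
               of_nat (num_regular_partitions N t) = main_term N t y * (1 + E)"
    if N: "N \<ge> 1" and t: "t \<ge> 4" and y: "y > 0" "saddle_point_eq N t y" for N t :: nat and y :: real
  proof -
    have "t \<ge> 1" using t by simp
    \<comment> \<open>Part (i) supplies \<open>y \<le> 1\<close>, on which the estimates of part
      (ii) rest.\<close>
    have "y < 1 / sqrt (24 * real N - 1)"
      using saddle_point_exists_unique(2)[OF N \<open>t \<ge> 1\<close> y] by blast
    also have "\<dots> \<le> 1 / 1"
      using N by (intro divide_left_mono) auto
    finally have "y \<le> 1" by simp
    from num_regular_partitions_asymptotics[OF t y(1) this y(2)] show ?thesis .
  qed
  thus "\<exists>C::real. \<forall>(N::nat) (t::nat) (y::real).
            N \<ge> 1 \<longrightarrow> t \<ge> 4 \<longrightarrow> y > 0 \<longrightarrow> saddle_point_eq N t y \<longrightarrow>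
            (\<exists>E::complex. norm E \<le> C * y \<and>
               of_nat (num_regular_partitions N t) = main_term N t y * (1 + E))"
    by blast
qed

end
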